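(* There exist constants $0<c<C<\infty$ such that for all sufficiently large integers $n$, $$\frac{c}{\log n}\le \frac13\,\kappa_{n\lfloor(\log n)^4\rfloor}(\mathbb{T},1)\le \kappa_n(\overline{\mathbb{D}},1)\le \kappa_n(\mathbb{T},1)\le \frac{C}{\log\log n}.$$
   Context: $\mathbb{T}$ is the unit circle and $\overline{\mathbb{D}}$ the closed unit disc in $\mathbb{C}$. For compact $K\subseteq\mathbb{C}$, $\mathcal{P}_n(K)$ is the set of monic complex polynomials of degree $n$ all of whose zeros lie in $K$. For a polynomial $p$ and $t>0$, $\Lambda_p(t)=\{z\in\mathbb{C}: |p(z)|\le t\}$. $m$ is Lebesgue measure on $\mathbb{C}$, and $\kappa_n(K,t)=\inf\{m(\Lambda_p(t)): p\in\mathcal{P}_n(K)\}$. *)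

theory Defs
  imports "HOL-Analysis.Analysis" "HOL-Computational_Algebra.Polynomial"
begin

definition monic_polys_zeros_in :: "nat \<Rightarrow> complex set \<Rightarrow> complex poly set" where
  "monic_polys_zeros_in n K =
     {p. degree p = n \<and> lead_coeff p = 1 \<and> {z. poly p z = 0} \<subseteq> K}"

definition filled_lemniscate :: "complex poly \<Rightarrow> real \<Rightarrow> complex set" where
  "filled_lemniscate p t = {z. norm (poly p z) \<le> t}"

(* Real-valued infimum of areas. This is meaningful for n \<ge> 1 and nonempty K: then the family of
   polynomials is nonempty and every filled lemniscate is compact, so its area is finite.
   (For n = 0 and t \<ge> 1 the filled lemniscate is the whole plane, whose real-valued measure is 0.) *)
definition min_area :: "nat \<Rightarrow> complex set \<Rightarrow> real \<Rightarrow> real" where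
  "min_area n K t = (INF p \<in> monic_polys_zeros_in n K. measure lebesgue (filled_lemniscate p t))"

end

theory Submission
  imports Defs "HOL-Complex_Analysis.Complex_Analysis"
    "HOL-Computational_Algebra.Computational_Algebra" "HOL-Real_Asymp.Real_Asymp"
begin

text \<open>
  Lower bound on the circle. For \<open>p\<close> with zeros on the unit circle the function \<open>1 - p(0) / p\<close> is holomorphic
  in the disc, vanishes at \<open>0\<close> and has positive real part wherever \<open>|p| > 1\<close>. Let \<open>W = 1 + A (1 - p(0) / p)\<close>.
  The circular means \<open>T\<close> of a function that is close to \<open>log (1 + |W|)\<close>, and equal to \<open>Re log W\<close> where \<open>Re W \<ge> 1\<close>,
  can only grow through the part of the circle where \<open>Re W < 1\<close>, because \<open>Re log W\<close> and \<open>Im log W\<close> satisfy the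
  Cauchy-Riemann equations elsewhere. By Cauchy-Schwarz, and the bound of the energy
  \<open>\<integral> |W'|\<^sup>2 / (1 + |W|\<^sup>2)\<close> that follows from the subharmonicity of \<open>(1 + log (1 + |W|\<^sup>2))\<^sup>2\<close>, if \<open>T\<close> doubles on an
  annulus and at most doubles on the next one, of width \<open>d\<close>, then \<open>{|p| \<le> 1}\<close> has area at least a constant times \<open>d\<^sup>2\<close>
  in the former. As \<open>T\<close> grows from a constant to at most a constant times \<open>n\<close>, there are \<open>O(log n)\<close> such annuli
  and the total area is at least a constant over \<open>log n\<close>.

  From the disc to the circle. If \<open>p\<close> has its zeros in the closed disc and \<open>p\<^sup>*\<close> is its reflection, then
  \<open>z\<^sup>N p + p\<^sup>*\<close> has its zeros on the circle, and \<open>|p| \<le> |p\<^sup>*|\<close> in the disc. Hence its lemniscate lies in that of \<open>p\<close>,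
  up to a thin annulus and the set \<open>{1 < |p| \<le> 1 + \<eta>}\<close>, which is small because \<open>|p|\<^sup>2 - 1\<close> restricts to a monic
  polynomial of degree \<open>2 n\<close> on vertical lines.

  Upper bound on the circle. Pushing a pole from near \<open>0\<close> along the positive axis to \<open>2\<close> in steps of length \<open>1 / K\<close>
  gives a polynomial that is larger at \<open>0\<close> than anywhere in the disc outside the strip \<open>|Im z| < 20 / K\<close>. Scaling it
  gives a zero-free \<open>S\<close> with \<open>S(0) = 1\<close> and \<open>|S| > 1\<close> outside the strip, and \<open>z\<^sup>N S\<^sup>* + S\<close> is the required
  polynomial.
\<close>

text \<open>Energy at one radius is controlled only by the means at a slightly larger radius, so the
  area gained while \<open>T\<close> doubles is measured by the width of the next annulus. These
  widths add up to at least a constant, and Cauchy-Schwarz over \<open>O(log n)\<close> of them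
  costs the factor \<open>1 / log n\<close>. The number \<open>A\<close> removes the scale: it makes
  \<open>|W - 1| \<le> 1\<close> on a tiny disc, and the Schwarz lemma at 0 then forces
  \<open>W\<close> to be huge at some point of modulus below 1/4, so the means do double.

  The fourth power of \<open>log n\<close> splits into two squares. An annulus of width of order
  \<open>(log n)^-2\<close> is negligible against \<open>c / log n\<close>, and inside it
  \<open>z^N\<close> is at most \<open>exp (- n (log n)^2 / 2)\<close>, which makes the shell around
  \<open>|p| = 1\<close> equally small. These errors may use two thirds of the lower bound on the
  circle; the factor 1/3 is what remains.

  In the strip the approximation of the pole breaks down and only a crude bound \<open>B\<close> is
  known. Dividing by \<open>B\<close> keeps \<open>S\<close> free of zeros, but guarantees only an
  excess of \<open>|S|\<close> over 1 of order \<open>1 / B\<close>, and \<open>N\<close> has to be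
  so large that \<open>|z|^N\<close> is below it.\<close>

section \<open>Polar coordinates\<close>

text \<open>A full period that is the union of \<open>[-\<pi>/4, \<pi>/4]\<close> and its three translates by multiples of \<open>\<pi>/2\<close>.\<close>

abbreviation period :: "real set" where
  "period \<equiv> {-pi/4..7*pi/4}"

lemma lborel_complex_eq_distr:
  "(lborel :: complex measure) = distr (lborel \<Otimes>\<^sub>M lborel) borel (\<lambda>(x, y). Complex x y)"
proof (rule lborel_eqI)
  have m: "(\<lambda>(x, y). Complex x y) \<in> borel_measurable ((lborel :: real measure) \<Otimes>\<^sub>M (lborel :: real measure))"
    unfolding Complex_eq by measurable
  fix l u :: complex
  assume le: "\<And>b. b \<in> Basis \<Longrightarrow> l \<bullet> b \<le> u \<bullet> b"
  then have le': "Re l \<le> Re u" "Im l \<le> Im u"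
    using le[of 1] le[of \<i>] by (auto simp: Basis_complex_def)
  have "emeasure (distr (lborel \<Otimes>\<^sub>M lborel) borel (\<lambda>(x, y). Complex x y)) (box l u)
      = emeasure (lborel \<Otimes>\<^sub>M lborel) ((\<lambda>(x, y). Complex x y) -` box l u \<inter> space (lborel \<Otimes>\<^sub>M lborel))"
    by (rule emeasure_distr[OF m]) auto
  also have "(\<lambda>(x, y). Complex x y) -` box l u \<inter> space (lborel \<Otimes>\<^sub>M lborel)
      = {Re l<..<Re u} \<times> {Im l<..<Im u}"
    by (auto simp: box_def Basis_complex_def space_pair_measure)
  also have "emeasure (lborel \<Otimes>\<^sub>M lborel) \<dots> = emeasure lborel {Re l<..<Re u} * emeasure lborel {Im l<..<Im u}"
    by (rule lborel.emeasure_pair_measure_Times) auto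
  also have "\<dots> = ennreal (\<Prod>b\<in>Basis. (u - l) \<bullet> b)"
    using le' by (simp add: Basis_complex_def ennreal_mult)
  finally show "emeasure (distr (lborel \<Otimes>\<^sub>M lborel) borel (\<lambda>(x, y). Complex x y)) (box l u)
      = ennreal (\<Prod>b\<in>Basis. (u - l) \<bullet> b)" .
qed simp

lemma measurable_Complex [measurable (raw)]:
  assumes [measurable]: "f \<in> borel_measurable M" "g \<in> borel_measurable M"
  shows "(\<lambda>x. Complex (f x) (g x)) \<in> borel_measurable M"
  unfolding Complex_eq by measurable

lemma nn_integral_complex:
  fixes f :: "complex \<Rightarrow> ennreal"
  assumes [measurable]: "f \<in> borel_measurable borel"
  shows "(\<integral>\<^sup>+z. f z \<partial>lborel) = (\<integral>\<^sup>+x. \<integral>\<^sup>+y. f (Complex x y) \<partial>lborel \<partial>lborel)"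
proof -
  have m: "(\<lambda>(x, y). Complex x y) \<in> borel_measurable ((lborel :: real measure) \<Otimes>\<^sub>M (lborel :: real measure))"
    by measurable
  have "(\<integral>\<^sup>+z. f z \<partial>lborel) = (\<integral>\<^sup>+p. f (case p of (x, y) \<Rightarrow> Complex x y) \<partial>(lborel \<Otimes>\<^sub>M lborel))"
    by (subst lborel_complex_eq_distr, subst nn_integral_distr[OF m]) auto
  also have "\<dots> = (\<integral>\<^sup>+x. \<integral>\<^sup>+y. f (Complex x y) \<partial>lborel \<partial>lborel)"
    by (subst lborel.nn_integral_fst[symmetric]) auto
  finally show ?thesis .
qed

lemma nn_integral_complex_mult_ii:
  fixes f :: "complex \<Rightarrow> ennreal"
  assumes [measurable]: "f \<in> borel_measurable borel"
  shows "(\<integral>\<^sup>+z. f (\<i> * z) \<partial>lborel) = (\<integral>\<^sup>+z. f z \<partial>lborel)"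
proof -
  have "(\<integral>\<^sup>+z. f (\<i> * z) \<partial>lborel) = (\<integral>\<^sup>+x. \<integral>\<^sup>+y. f (Complex (- y) x) \<partial>lborel \<partial>lborel)"
    by (subst nn_integral_complex) (auto simp: Complex_eq algebra_simps)
  also have "\<dots> = (\<integral>\<^sup>+x. \<integral>\<^sup>+y. f (Complex y x) \<partial>lborel \<partial>lborel)"
  proof (rule nn_integral_cong)
    fix x :: real
    show "(\<integral>\<^sup>+y. f (Complex (- y) x) \<partial>lborel) = (\<integral>\<^sup>+y. f (Complex y x) \<partial>lborel)"
      by (subst (2) nn_integral_real_affine[where c = "-1" and t = 0]) auto
  qed
  also have "\<dots> = (\<integral>\<^sup>+y. \<integral>\<^sup>+x. f (Complex y x) \<partial>lborel \<partial>lborel)"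
    by (rule lborel_pair.Fubini') measurable
  also have "\<dots> = (\<integral>\<^sup>+z. f z \<partial>lborel)"
    by (subst nn_integral_complex) auto
  finally show ?thesis .
qed

text \<open>Polar coordinates by one-dimensional substitutions alone: \<open>y = x t\<close>,
  \<open>t = tan \<theta>\<close>, \<open>x = r cos \<theta>\<close>, \<open>r = exp s\<close>. The
  angle is restricted so that the tangent stays in \<open>[-1, 1]\<close> and rotations by
  \<open>\<i>\<close> can cover the rest of the plane. Only this direction of the comparison is used
  later.\<close>

lemma nn_integral_polar_sector:
  fixes f :: "complex \<Rightarrow> ennreal"
  assumes [measurable]: "f \<in> borel_measurable borel" and "a < b"
  shows "(\<integral>\<^sup>+\<theta>. (\<integral>\<^sup>+s. f (exp (Complex s \<theta>)) * ennreal (exp (2 * s)) * indicator {a..b} s \<partial>lborel)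
            * indicator {-pi/4..pi/4} \<theta> \<partial>lborel)
       \<le> (\<integral>\<^sup>+z. f z * indicator {z. 0 < Re z \<and> \<bar>Im z\<bar> < Re z} z \<partial>lborel)"
proof -
  have cos_pos: "cos \<theta> > 0" if "\<theta> \<in> {-pi/4..pi/4}" for \<theta> :: real
  proof -
    have "- pi / 4 \<le> \<theta>" "\<theta> \<le> pi / 4"
      using that by auto
    then show ?thesis
      using pi_gt_zero by (intro cos_gt_zero_pi; linarith)
  qed
  define V where "V = {z. 0 < Re z \<and> \<bar>Im z\<bar> < Re z}"
  have [measurable]: "V \<in> sets borel"
    unfolding V_def by measurable
  let ?F = "\<lambda>t x. f (Complex x (x * t)) * ennreal x * indicator {0<..} x"
  have [measurable]: "(\<lambda>\<theta>::real. tan \<theta>) \<in> borel_measurable borel" unfolding tan_def by measurable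
  have [measurable]: "(\<lambda>t. \<integral>\<^sup>+x. ?F t x \<partial>lborel) \<in> borel_measurable lborel"
    by measurable
  have "(\<integral>\<^sup>+z. f z * indicator V z \<partial>lborel)
      = (\<integral>\<^sup>+x. \<integral>\<^sup>+y. f (Complex x y) * indicator V (Complex x y) \<partial>lborel \<partial>lborel)"
    by (rule nn_integral_complex) measurable
  also have "\<dots> = (\<integral>\<^sup>+x. \<integral>\<^sup>+t. ?F t x * indicator {-1<..<1} t \<partial>lborel \<partial>lborel)"
  proof (rule nn_integral_cong)
    fix x :: real
    show "(\<integral>\<^sup>+y. f (Complex x y) * indicator V (Complex x y) \<partial>lborel)
        = (\<integral>\<^sup>+t. ?F t x * indicator {-1<..<1} t \<partial>lborel)"
    proof (cases "0 < x")
      case True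
      have "(\<integral>\<^sup>+y. f (Complex x y) * indicator V (Complex x y) \<partial>lborel)
          = \<bar>x\<bar> * (\<integral>\<^sup>+t. f (Complex x (0 + x * t)) * indicator V (Complex x (0 + x * t)) \<partial>lborel)"
        using True by (intro nn_integral_real_affine) auto
      also have "\<dots> = (\<integral>\<^sup>+t. x * (f (Complex x (0 + x * t)) * indicator V (Complex x (0 + x * t))) \<partial>lborel)"
        using True by (subst nn_integral_cmult) auto
      also have "\<dots> = (\<integral>\<^sup>+t. ?F t x * indicator {-1<..<1} t \<partial>lborel)"
      proof (rule nn_integral_cong)
        fix t :: real
        have "\<bar>x * t\<bar> < x \<longleftrightarrow> \<bar>t\<bar> < 1"
          using True by (simp add: abs_mult)
        then have "indicator V (Complex x (0 + x * t)) = (indicator {-1<..<1} t :: ennreal)"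
          using True by (auto simp: V_def indicator_def abs_less_iff)
        then show "x * (f (Complex x (0 + x * t)) * indicator V (Complex x (0 + x * t))) = ?F t x * indicator {-1<..<1} t"
          using True by (simp add: mult_ac)
      qed
      finally show ?thesis .
    next
      case False
      then show ?thesis by (simp add: V_def)
    qed
  qed
  also have "\<dots> = (\<integral>\<^sup>+t. \<integral>\<^sup>+x. ?F t x * indicator {-1<..<1} t \<partial>lborel \<partial>lborel)"
    by (rule lborel_pair.Fubini') measurable
  also have "\<dots> = (\<integral>\<^sup>+t. (\<integral>\<^sup>+x. ?F t x \<partial>lborel) * indicator {-1<..<1} t \<partial>lborel)"
    by (rule nn_integral_cong, subst nn_integral_multc) auto
  also have "\<dots> = (\<integral>\<^sup>+t. (\<integral>\<^sup>+x. ?F t x \<partial>lborel) * indicator {-1..1} t \<partial>lborel)"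
  proof (rule nn_integral_cong_AE)
    have "AE t in lborel. t \<noteq> (-1::real) \<and> t \<noteq> 1"
      using AE_lborel_singleton[of "-1::real"] AE_lborel_singleton[of "1::real"] by eventually_elim auto
    then show "AE t in lborel. (\<integral>\<^sup>+x. ?F t x \<partial>lborel) * indicator {-1<..<1} t = (\<integral>\<^sup>+x. ?F t x \<partial>lborel) * indicator {-1..1} t"
      by eventually_elim (auto simp: indicator_def)
  qed
  also have "\<dots> = (\<integral>\<^sup>+t. (\<integral>\<^sup>+x. ?F t x \<partial>lborel) * indicator {tan (-pi/4)..tan (pi/4)} t \<partial>lborel)"
    by (simp add: tan_45)
  also have "\<dots> = (\<integral>\<^sup>+\<theta>. (\<integral>\<^sup>+x. ?F (tan \<theta>) x \<partial>lborel) * ennreal (inverse ((cos \<theta>)\<^sup>2)) * indicator {-pi/4..pi/4} \<theta> \<partial>lborel)"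
  proof (rule nn_integral_substitution_aux)
    fix \<theta> :: real
    assume "\<theta> \<in> {-pi/4..pi/4}"
    then have "cos \<theta> > 0"
      by (rule cos_pos)
    then show "(tan has_real_derivative inverse ((cos \<theta>)\<^sup>2)) (at \<theta>)"
      by (intro DERIV_tan) auto
    show "0 \<le> inverse ((cos \<theta>)\<^sup>2)" by simp
  next
    show "continuous_on {-pi/4..pi/4} (\<lambda>\<theta>. inverse ((cos \<theta>)\<^sup>2))"
    proof (intro continuous_intros ballI)
      fix \<theta> :: real
      assume "\<theta> \<in> {-pi/4..pi/4}"
      then have "cos \<theta> > 0"
      by (rule cos_pos)
      then show "(cos \<theta>)\<^sup>2 \<noteq> 0" by simp
    qed
  qed (auto)
  also have "\<dots> \<ge> (\<integral>\<^sup>+\<theta>. (\<integral>\<^sup>+s. f (exp (Complex s \<theta>)) * ennreal (exp (2 * s)) * indicator {a..b} s \<partial>lborel)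
            * indicator {-pi/4..pi/4} \<theta> \<partial>lborel)"
  proof (rule nn_integral_mono)
    fix \<theta> :: real
    show "(\<integral>\<^sup>+s. f (exp (Complex s \<theta>)) * ennreal (exp (2 * s)) * indicator {a..b} s \<partial>lborel) * indicator {-pi/4..pi/4} \<theta>
      \<le> (\<integral>\<^sup>+x. ?F (tan \<theta>) x \<partial>lborel) * ennreal (inverse ((cos \<theta>)\<^sup>2)) * indicator {-pi/4..pi/4} \<theta>"
    proof (cases "\<theta> \<in> {-pi/4..pi/4}")
      case True
      then have c: "cos \<theta> > 0"
        by (rule cos_pos)
      have "(\<integral>\<^sup>+x. ?F (tan \<theta>) x \<partial>lborel) = \<bar>cos \<theta>\<bar> * (\<integral>\<^sup>+r. ?F (tan \<theta>) (0 + cos \<theta> * r) \<partial>lborel)"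
        using c by (intro nn_integral_real_affine) auto
      also have "(\<integral>\<^sup>+r. ?F (tan \<theta>) (0 + cos \<theta> * r) \<partial>lborel)
          = (\<integral>\<^sup>+r. ennreal (cos \<theta>) * (f (rcis r \<theta>) * ennreal r * indicator {0<..} r) \<partial>lborel)"
      proof (rule nn_integral_cong)
        fix r :: real
        have "Complex (cos \<theta> * r) (cos \<theta> * r * tan \<theta>) = rcis r \<theta>"
          using c by (simp add: complex_eq_iff tan_def)
        then show "?F (tan \<theta>) (0 + cos \<theta> * r) = ennreal (cos \<theta>) * (f (rcis r \<theta>) * ennreal r * indicator {0<..} r)"
          using c by (auto simp: ennreal_mult zero_less_mult_iff indicator_def mult_ac)
      qed
      also have "\<dots> = ennreal (cos \<theta>) * (\<integral>\<^sup>+r. f (rcis r \<theta>) * ennreal r * indicator {0<..} r \<partial>lborel)"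
        unfolding rcis_def cis.code by (rule nn_integral_cmult) measurable
      finally have e: "(\<integral>\<^sup>+x. ?F (tan \<theta>) x \<partial>lborel) * ennreal (inverse ((cos \<theta>)\<^sup>2))
          = (\<integral>\<^sup>+r. f (rcis r \<theta>) * ennreal r * indicator {0<..} r \<partial>lborel)
             * (ennreal (cos \<theta>) * ennreal (cos \<theta>) * ennreal (inverse ((cos \<theta>)\<^sup>2)))"
        using c by (simp add: mult_ac)
      \<comment> \<open>The factors come from the density \<open>x = r cos \<theta>\<close>, from
        \<open>dx = cos \<theta> dr\<close> and from \<open>dt = d\<theta> / cos^2 \<theta>\<close>;
        what survives is the usual \<open>r\<close>.\<close>
      have e1: "ennreal (cos \<theta>) * ennreal (cos \<theta>) * ennreal (inverse ((cos \<theta>)\<^sup>2)) = 1"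
        using c by (simp add: ennreal_mult[symmetric] power2_eq_square field_simps del: ennreal_mult')
      have "(\<integral>\<^sup>+r. f (rcis r \<theta>) * ennreal r * indicator {0<..} r \<partial>lborel)
          \<ge> (\<integral>\<^sup>+r. f (rcis r \<theta>) * ennreal r * indicator {exp a..exp b} r \<partial>lborel)"
      proof (rule nn_integral_mono)
        fix r :: real
        have "r > 0" if "exp a \<le> r" using that less_le_trans[OF exp_gt_zero[of a]] by auto
        then show "f (rcis r \<theta>) * ennreal r * indicator {exp a..exp b} r \<le> f (rcis r \<theta>) * ennreal r * indicator {0<..} r"
          by (auto simp: indicator_def)
      qed
      also have "(\<integral>\<^sup>+r. f (rcis r \<theta>) * ennreal r * indicator {exp a..exp b} r \<partial>lborel)
         = (\<integral>\<^sup>+s. f (rcis (exp s) \<theta>) * ennreal (exp s) * ennreal (exp s) * indicator {a..b} s \<partial>lborel)"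
      proof (rule nn_integral_substitution_aux)
        show "(\<lambda>r. f (rcis r \<theta>) * ennreal r) \<in> borel_measurable borel"
          unfolding rcis_def cis.code by measurable
      qed (auto intro!: derivative_eq_intros continuous_intros \<open>a < b\<close>)
      also have "\<dots> = (\<integral>\<^sup>+s. f (exp (Complex s \<theta>)) * ennreal (exp (2 * s)) * indicator {a..b} s \<partial>lborel)"
      proof (rule nn_integral_cong)
        fix s :: real
        have "ennreal (exp s) * ennreal (exp s) = ennreal (exp (2 * s))"
          by (simp add: exp_double power2_eq_square flip: ennreal_mult)
        moreover have "rcis (exp s) \<theta> = exp (Complex s \<theta>)"
          by (simp add: rcis_def exp_eq_polar)
        ultimately show "f (rcis (exp s) \<theta>) * ennreal (exp s) * ennreal (exp s) * indicator {a..b} s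
            = f (exp (Complex s \<theta>)) * ennreal (exp (2 * s)) * indicator {a..b} s"
          by (simp only: mult.assoc)
      qed
      finally show ?thesis
        using True by (simp add: e e1)
    qed auto
  qed
  finally show ?thesis
    unfolding V_def .
qed


text \<open>Powers of \<open>\<i>\<close> carry the sector to four disjoint open sectors, while the
  four closed arcs cover \<open>period\<close>. Overlapping endpoints only enlarge the intermediate
  sum.\<close>

lemma nn_integral_polar_le:
  fixes f :: "complex \<Rightarrow> ennreal"
  assumes [measurable]: "f \<in> borel_measurable borel" and "a < b"
  shows "(\<integral>\<^sup>+\<theta>. (\<integral>\<^sup>+s. f (exp (Complex s \<theta>)) * ennreal (exp (2 * s)) * indicator {a..b} s \<partial>lborel)
            * indicator period \<theta> \<partial>lborel)
       \<le> (\<integral>\<^sup>+z. f z \<partial>lborel)"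
proof -
  define V where "V = {z. 0 < Re z \<and> \<bar>Im z\<bar> < Re z}"
  have [measurable]: "V \<in> sets borel"
    unfolding V_def by measurable
  define F where "F = (\<lambda>g \<theta>. \<integral>\<^sup>+s. g (exp (Complex s \<theta>)) * ennreal (exp (2 * s)) * indicator {a..b} s \<partial>lborel)"
  define g where "g = (\<lambda>k z. f (\<i> ^ k * z))"
  have [measurable]: "g k \<in> borel_measurable borel" for k
    unfolding g_def by measurable
  have Fm [measurable]: "F g' \<in> borel_measurable borel" if [measurable]: "g' \<in> borel_measurable borel" for g' :: "complex \<Rightarrow> ennreal"
  proof -
    have [measurable]: "(\<lambda>x. exp x) \<in> borel_measurable (borel :: complex measure)"
      by (intro borel_measurable_continuous_onI continuous_intros)
    show ?thesis unfolding F_def by measurable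
  qed
  have sec: "(\<integral>\<^sup>+\<theta>. F f \<theta> * indicator {-pi/4 + k*pi/2..pi/4 + k*pi/2} \<theta> \<partial>lborel)
      \<le> (\<integral>\<^sup>+z. g k z * indicator V z \<partial>lborel)" for k :: nat
  proof -
    have "(\<integral>\<^sup>+\<theta>. F f \<theta> * indicator {-pi/4 + k*pi/2..pi/4 + k*pi/2} \<theta> \<partial>lborel)
        = ennreal \<bar>1\<bar> * (\<integral>\<^sup>+\<theta>. F f (k*pi/2 + 1 * \<theta>) * indicator {-pi/4 + k*pi/2..pi/4 + k*pi/2} (k*pi/2 + 1 * \<theta>) \<partial>lborel)"
      by (rule nn_integral_real_affine) auto
    also have "\<dots> = (\<integral>\<^sup>+\<theta>. F (g k) \<theta> * indicator {-pi/4..pi/4} \<theta> \<partial>lborel)"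
    proof -
      have "F f (k*pi/2 + \<theta>) = F (g k) \<theta>" for \<theta>
      proof -
        have e: "cis (k*pi/2) = \<i> ^ k"
          by (metis Complex.DeMoivre cis_pi_half times_divide_eq_right)
        have "exp (Complex s (k*pi/2 + \<theta>)) = \<i> ^ k * exp (Complex s \<theta>)" for s
          unfolding e[symmetric] by (simp add: exp_eq_polar cis_mult mult_ac add_ac)
        then show ?thesis by (simp add: F_def g_def)
      qed
      moreover have "indicator {-pi/4 + k*pi/2..pi/4 + k*pi/2} (k*pi/2 + \<theta>) = (indicator {-pi/4..pi/4} \<theta> :: ennreal)" for \<theta>
        by (auto simp: indicator_def)
      ultimately show ?thesis by simp
    qed
    also have "\<dots> \<le> (\<integral>\<^sup>+z. g k z * indicator V z \<partial>lborel)"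
      unfolding F_def V_def by (rule nn_integral_polar_sector) (use \<open>a < b\<close> in auto)
    finally show ?thesis .
  qed
  define V' where "V' = (\<lambda>k::nat. {z. (- \<i>) ^ k * z \<in> V})"
  have [measurable]: "V' k \<in> sets borel" for k
    unfolding V'_def by measurable
  have rot: "(\<integral>\<^sup>+z. g k z * indicator V z \<partial>lborel) = (\<integral>\<^sup>+z. f z * indicator (V' k) z \<partial>lborel)" for k
  proof -
    have inv: "(\<integral>\<^sup>+z. h (\<i> ^ k * z) \<partial>lborel) = (\<integral>\<^sup>+z. h z \<partial>lborel)"
      if [measurable]: "h \<in> borel_measurable borel" for h :: "complex \<Rightarrow> ennreal"
    proof (induction k)
      case (Suc k)
      have "(\<integral>\<^sup>+z. h (\<i> ^ Suc k * z) \<partial>lborel) = (\<integral>\<^sup>+z. h (\<i> ^ k * (\<i> * z)) \<partial>lborel)"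
        by (simp add: mult_ac)
      also have "\<dots> = (\<integral>\<^sup>+z. h (\<i> ^ k * z) \<partial>lborel)"
        by (rule nn_integral_complex_mult_ii[where f = "\<lambda>z. h (\<i> ^ k * z)"]) measurable
      finally show ?case using Suc by simp
    qed simp
    have "(- \<i>) ^ k * (\<i> ^ k * z) = z" for z
      by (simp add: mult.assoc[symmetric] power_mult_distrib[symmetric])
    then have "(\<integral>\<^sup>+z. g k z * indicator V z \<partial>lborel) = (\<integral>\<^sup>+z. (\<lambda>w. f w * indicator (V' k) w) (\<i> ^ k * z) \<partial>lborel)"
      unfolding g_def V'_def by (intro nn_integral_cong) (simp only: indicator_def mem_Collect_eq)
    also have "\<dots> = (\<integral>\<^sup>+z. f z * indicator (V' k) z \<partial>lborel)"
      by (rule inv) measurable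
    finally show ?thesis .
  qed
  have "(\<integral>\<^sup>+\<theta>. F f \<theta> * indicator period \<theta> \<partial>lborel)
     \<le> (\<integral>\<^sup>+\<theta>. (\<Sum>k<4. F f \<theta> * indicator {-pi/4 + real k*pi/2..pi/4 + real k*pi/2} \<theta>) \<partial>lborel)"
  proof (rule nn_integral_mono)
    fix \<theta> :: real
    show "F f \<theta> * indicator period \<theta> \<le> (\<Sum>k<4. F f \<theta> * indicator {-pi/4 + real k*pi/2..pi/4 + real k*pi/2} \<theta>)"
    proof (cases "\<theta> \<in> period")
      case True
      then consider "\<theta> \<in> {-pi/4..pi/4}" | "\<theta> \<in> {pi/4..3*pi/4}" | "\<theta> \<in> {3*pi/4..5*pi/4}" | "\<theta> \<in> {5*pi/4..7*pi/4}"
        by fastforce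
      then obtain k :: nat where k: "k < 4" "\<theta> \<in> {-pi/4 + real k*pi/2..pi/4 + real k*pi/2}"
      proof cases
        case 1 then show ?thesis by (intro that[of 0]) auto
      next
        case 2 then show ?thesis by (intro that[of 1]) auto
      next
        case 3 then show ?thesis by (intro that[of 2]) auto
      next
        case 4 then show ?thesis by (intro that[of 3]) auto
      qed
      have "F f \<theta> * indicator period \<theta> = F f \<theta> * indicator {-pi/4 + real k*pi/2..pi/4 + real k*pi/2} \<theta>"
        using True k by simp
      also have "\<dots> \<le> (\<Sum>k<4. F f \<theta> * indicator {-pi/4 + real k*pi/2..pi/4 + real k*pi/2} \<theta>)"
        using k by (intro member_le_sum) auto
      finally show ?thesis .
    qed auto
  qed
  also have "\<dots> = (\<Sum>k<4. \<integral>\<^sup>+\<theta>. F f \<theta> * indicator {-pi/4 + real k*pi/2..pi/4 + real k*pi/2} \<theta> \<partial>lborel)"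
    by (rule nn_integral_sum) measurable
  also have "\<dots> \<le> (\<Sum>k<4. \<integral>\<^sup>+z. f z * indicator (V' k) z \<partial>lborel)"
    using sec rot by (intro sum_mono) simp
  also have "\<dots> = (\<integral>\<^sup>+z. (\<Sum>k<4. f z * indicator (V' k) z) \<partial>lborel)"
    by (rule nn_integral_sum[symmetric]) measurable
  also have "\<dots> \<le> (\<integral>\<^sup>+z. f z \<partial>lborel)"
  proof (rule nn_integral_mono)
    fix z :: complex
    have "(\<Sum>k<4. indicator (V' k) z) \<le> (1::ennreal)"
      by (auto simp: eval_nat_numeral V'_def V_def indicator_def)
    then have "f z * (\<Sum>k<4. indicator (V' k) z) \<le> f z * 1"
      by (intro mult_left_mono) auto
    then show "(\<Sum>k<4. f z * indicator (V' k) z) \<le> f z"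
      by (simp add: sum_distrib_left)
  qed
  finally show ?thesis
    unfolding F_def .
qed

section \<open>Circular means of functions of a holomorphic function\<close>

lemma has_vd_Re_Im:
  assumes "(f has_vector_derivative f') (at x within A)"
  shows "((\<lambda>x. Re (f x)) has_real_derivative Re f') (at x within A)"
    and "((\<lambda>x. Im (f x)) has_real_derivative Im f') (at x within A)"
  using bounded_linear.has_vector_derivative[OF bounded_linear_Re assms]
    bounded_linear.has_vector_derivative[OF bounded_linear_Im assms]
  by (simp_all add: has_real_derivative_iff_has_vector_derivative)

locale holomorphic_disc =
  fixes W :: "complex \<Rightarrow> complex" and R :: real
  assumes R_pos: "0 < R" and hol: "W holomorphic_on ball 0 R"
begin

definition G :: "real \<Rightarrow> real \<Rightarrow> complex" where
  "G s \<theta> = W (exp (Complex s \<theta>))"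

definition G1 :: "real \<Rightarrow> real \<Rightarrow> complex" where
  "G1 s \<theta> = deriv W (exp (Complex s \<theta>)) * exp (Complex s \<theta>)"

definition G2 :: "real \<Rightarrow> real \<Rightarrow> complex" where
  "G2 s \<theta> = deriv (deriv W) (exp (Complex s \<theta>)) * exp (Complex s \<theta>) * exp (Complex s \<theta>)
            + deriv W (exp (Complex s \<theta>)) * exp (Complex s \<theta>)"

lemma exp_in_ball: "s < ln R \<Longrightarrow> exp (Complex s \<theta>) \<in> ball 0 R"
  using R_pos exp_less_cancel_iff[of s "ln R"] by simp

lemma G_periodic: "G s (\<theta> + 2 * pi) = G s \<theta>" "G1 s (\<theta> + 2 * pi) = G1 s \<theta>"
  by (simp_all add: G_def G1_def exp_eq_polar flip: cis_mult)

lemma W_deriv: "z \<in> ball 0 R \<Longrightarrow> (W has_field_derivative deriv W z) (at z)"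
  using hol holomorphic_derivI by blast

lemma W_deriv2: "z \<in> ball 0 R \<Longrightarrow> (deriv W has_field_derivative deriv (deriv W) z) (at z)"
  using holomorphic_deriv[OF hol] holomorphic_derivI by blast

lemma exp_Complex_deriv:
  "((\<lambda>s. exp (Complex s \<theta>)) has_vector_derivative exp (Complex s \<theta>)) (at s within A)"
  "((\<lambda>\<theta>. exp (Complex s \<theta>)) has_vector_derivative \<i> * exp (Complex s \<theta>)) (at \<theta> within A)"
proof -
  have "((\<lambda>s. Complex s \<theta>) has_vector_derivative 1) (at s within A)"
    unfolding Complex_eq by (auto intro!: derivative_eq_intros)
  from field_vector_diff_chain_within[OF this, of exp "exp (Complex s \<theta>)"]
  show "((\<lambda>s. exp (Complex s \<theta>)) has_vector_derivative exp (Complex s \<theta>)) (at s within A)"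
    by (simp add: o_def DERIV_exp has_field_derivative_at_within)
  have "((\<lambda>\<theta>. Complex s \<theta>) has_vector_derivative \<i>) (at \<theta> within A)"
    unfolding Complex_eq by (auto intro!: derivative_eq_intros)
  from field_vector_diff_chain_within[OF this, of exp "exp (Complex s \<theta>)"]
  show "((\<lambda>\<theta>. exp (Complex s \<theta>)) has_vector_derivative \<i> * exp (Complex s \<theta>)) (at \<theta> within A)"
    by (simp add: o_def DERIV_exp has_field_derivative_at_within)
qed

text \<open>In the coordinates \<open>(s, \<theta>)\<close> the Cauchy-Riemann equations say that
  the angular derivative is \<open>\<i>\<close> times the radial one. The logarithm of the radius is
  used so that no powers of the radius appear in the Laplacian.\<close>

lemma G_deriv:
  assumes "s < ln R"
  shows "((\<lambda>s. G s \<theta>) has_vector_derivative G1 s \<theta>) (at s within A)"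
    and "((\<lambda>\<theta>. G s \<theta>) has_vector_derivative \<i> * G1 s \<theta>) (at \<theta> within A)"
    and "((\<lambda>s. G1 s \<theta>) has_vector_derivative G2 s \<theta>) (at s within A)"
    and "((\<lambda>\<theta>. G1 s \<theta>) has_vector_derivative \<i> * G2 s \<theta>) (at \<theta> within A)"
proof -
  note b = exp_in_ball[OF assms, of \<theta>]
  note W1 = has_field_derivative_at_within[OF W_deriv[OF b]] and W2 = has_field_derivative_at_within[OF W_deriv2[OF b]]
  show "((\<lambda>s. G s \<theta>) has_vector_derivative G1 s \<theta>) (at s within A)"
    using field_vector_diff_chain_within[OF exp_Complex_deriv(1) W1]
    by (simp add: o_def G_def G1_def mult_ac)
  show "((\<lambda>\<theta>. G s \<theta>) has_vector_derivative \<i> * G1 s \<theta>) (at \<theta> within A)"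
    using field_vector_diff_chain_within[OF exp_Complex_deriv(2) W1]
    by (simp add: o_def G_def G1_def mult_ac)
  show "((\<lambda>s. G1 s \<theta>) has_vector_derivative G2 s \<theta>) (at s within A)"
    using has_vector_derivative_mult[OF field_vector_diff_chain_within[OF exp_Complex_deriv(1) W2] exp_Complex_deriv(1)]
    by (simp add: o_def G2_def G1_def algebra_simps)
  show "((\<lambda>\<theta>. G1 s \<theta>) has_vector_derivative \<i> * G2 s \<theta>) (at \<theta> within A)"
    using has_vector_derivative_mult[OF field_vector_diff_chain_within[OF exp_Complex_deriv(2) W2] exp_Complex_deriv(2)]
    by (simp add: o_def G2_def G1_def algebra_simps)
qed

lemma G_cont:
  "continuous_on ({..<ln R} \<times> UNIV) (\<lambda>(s, \<theta>). G s \<theta>)"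
  "continuous_on ({..<ln R} \<times> UNIV) (\<lambda>(s, \<theta>). G1 s \<theta>)"
  "continuous_on ({..<ln R} \<times> UNIV) (\<lambda>(s, \<theta>). G2 s \<theta>)"
proof -
  have e: "continuous_on ({..<ln R} \<times> UNIV) (\<lambda>p. exp (Complex (fst p) (snd p)))"
    unfolding Complex_eq by (intro continuous_intros)
  have *: "continuous_on ({..<ln R} \<times> UNIV) (\<lambda>p. f (exp (Complex (fst p) (snd p))))"
    if "f holomorphic_on ball 0 R" for f
    by (rule continuous_on_compose2[OF holomorphic_on_imp_continuous_on[OF that] e])
      (auto intro: exp_in_ball simp del: norm_exp_eq_Re)
  note h1 = holomorphic_deriv[OF hol open_ball]
  note h2 = holomorphic_deriv[OF h1 open_ball]
  note [continuous_intros] = e *[OF hol] *[OF h1] *[OF h2]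
  show "continuous_on ({..<ln R} \<times> UNIV) (\<lambda>(s, \<theta>). G s \<theta>)"
  "continuous_on ({..<ln R} \<times> UNIV) (\<lambda>(s, \<theta>). G1 s \<theta>)"
  "continuous_on ({..<ln R} \<times> UNIV) (\<lambda>(s, \<theta>). G2 s \<theta>)"
    unfolding split_beta G_def G1_def G2_def by (intro continuous_intros)+
qed

lemma G_cont':
  assumes "continuous_on A f" "continuous_on A g" "\<And>x. x \<in> A \<Longrightarrow> f x < ln R"
  shows "continuous_on A (\<lambda>x. G (f x) (g x))" "continuous_on A (\<lambda>x. G1 (f x) (g x))" "continuous_on A (\<lambda>x. G2 (f x) (g x))"
proof -
  have c: "continuous_on A (\<lambda>x. (f x, g x))" "(\<lambda>x. (f x, g x)) ` A \<subseteq> {..<ln R} \<times> UNIV"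
    using assms by (auto intro!: continuous_intros)
  show "continuous_on A (\<lambda>x. G (f x) (g x))" "continuous_on A (\<lambda>x. G1 (f x) (g x))" "continuous_on A (\<lambda>x. G2 (f x) (g x))"
    using continuous_on_compose2[OF G_cont(1) c] continuous_on_compose2[OF G_cont(2) c]
      continuous_on_compose2[OF G_cont(3) c] by auto
qed

end

text \<open>Abstract in \<open>h\<close> because it is needed for \<open>1 + ln (1 + t)\<close> and
  for its square, and abstract in \<open>W\<close> because \<open>le_M\<close> applies it to a
  second holomorphic function.\<close>

locale radial_mean = holomorphic_disc +
  fixes h h1 h2 :: "real \<Rightarrow> real"
  assumes h_deriv: "\<And>t. t \<ge> 0 \<Longrightarrow> (h has_real_derivative h1 t) (at t)"
    and h1_deriv: "\<And>t. t \<ge> 0 \<Longrightarrow> (h1 has_real_derivative h2 t) (at t)"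
    and h2_cont: "continuous_on {0..} h2"
begin

definition v :: "real \<Rightarrow> real \<Rightarrow> real" where "v s \<theta> = (cmod (G s \<theta>))\<^sup>2"

definition vs :: "real \<Rightarrow> real \<Rightarrow> real" where "vs s \<theta> = 2 * Re (cnj (G s \<theta>) * G1 s \<theta>)"

definition vt :: "real \<Rightarrow> real \<Rightarrow> real" where "vt s \<theta> = - 2 * Im (cnj (G s \<theta>) * G1 s \<theta>)"

definition phi_ss :: "real \<Rightarrow> real \<Rightarrow> real" where
  "phi_ss s \<theta> = h2 (v s \<theta>) * (vs s \<theta>)\<^sup>2 + h1 (v s \<theta>) * (2 * ((cmod (G1 s \<theta>))\<^sup>2 + Re (cnj (G s \<theta>) * G2 s \<theta>)))"

definition phi_tt :: "real \<Rightarrow> real \<Rightarrow> real" where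
  "phi_tt s \<theta> = h2 (v s \<theta>) * (vt s \<theta>)\<^sup>2 + h1 (v s \<theta>) * (2 * ((cmod (G1 s \<theta>))\<^sup>2 - Re (cnj (G s \<theta>) * G2 s \<theta>)))"

definition M :: "real \<Rightarrow> real" where
  "M s = integral period (\<lambda>\<theta>. h (v s \<theta>))"

definition M1 :: "real \<Rightarrow> real" where
  "M1 s = integral period (\<lambda>\<theta>. h1 (v s \<theta>) * vs s \<theta>)"

text \<open>\<open>lap\<close> is the Laplacian of \<open>h (|G|\<^sup>2)\<close> in the logarithmic polar coordinates \<open>(s, \<theta>)\<close>.\<close>

definition lap :: "real \<Rightarrow> real \<Rightarrow> real" where
  "lap s \<theta> = 4 * (h1 (v s \<theta>) + v s \<theta> * h2 (v s \<theta>)) * (cmod (G1 s \<theta>))\<^sup>2"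

definition D :: "real \<Rightarrow> real" where
  "D s = integral period (lap s)"

lemma v_nonneg: "0 \<le> v s \<theta>" by (simp add: v_def)

lemma Re_cnj_mult: "Re (cnj z * w) = Re z * Re w + Im z * Im w" "Im (cnj z * w) = Re z * Im w - Im z * Re w"
  by simp_all

lemma v_deriv:
  assumes "s < ln R"
  shows "((\<lambda>s. v s \<theta>) has_real_derivative vs s \<theta>) (at s within A)"
    and "((\<lambda>\<theta>. v s \<theta>) has_real_derivative vt s \<theta>) (at \<theta> within A)"
    and "((\<lambda>s. vs s \<theta>) has_real_derivative 2 * ((cmod (G1 s \<theta>))\<^sup>2 + Re (cnj (G s \<theta>) * G2 s \<theta>))) (at s within A)"
    and "((\<lambda>\<theta>. vt s \<theta>) has_real_derivative 2 * ((cmod (G1 s \<theta>))\<^sup>2 - Re (cnj (G s \<theta>) * G2 s \<theta>))) (at \<theta> within A)"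
proof -
  note d = G_deriv[OF assms, of \<theta> A]
  note [derivative_intros] = has_vd_Re_Im[OF d(1)] has_vd_Re_Im[OF d(2)] has_vd_Re_Im[OF d(3)] has_vd_Re_Im[OF d(4)]
  show "((\<lambda>s. v s \<theta>) has_real_derivative vs s \<theta>) (at s within A)"
    unfolding v_def vs_def cmod_power2 Re_cnj_mult
    by (auto intro!: derivative_eq_intros simp: algebra_simps)
  show "((\<lambda>\<theta>. v s \<theta>) has_real_derivative vt s \<theta>) (at \<theta> within A)"
    unfolding v_def vt_def cmod_power2 Re_cnj_mult
    by (auto intro!: derivative_eq_intros simp: algebra_simps)
  show "((\<lambda>s. vs s \<theta>) has_real_derivative 2 * ((cmod (G1 s \<theta>))\<^sup>2 + Re (cnj (G s \<theta>) * G2 s \<theta>))) (at s within A)"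
    unfolding vs_def cmod_power2 Re_cnj_mult
    by (auto intro!: derivative_eq_intros simp: algebra_simps power2_eq_square)
  show "((\<lambda>\<theta>. vt s \<theta>) has_real_derivative 2 * ((cmod (G1 s \<theta>))\<^sup>2 - Re (cnj (G s \<theta>) * G2 s \<theta>))) (at \<theta> within A)"
    unfolding vt_def cmod_power2 Re_cnj_mult
    by (auto intro!: derivative_eq_intros simp: algebra_simps power2_eq_square)
qed

lemma phi_deriv:
  assumes "s < ln R"
  shows "((\<lambda>s. h (v s \<theta>)) has_real_derivative h1 (v s \<theta>) * vs s \<theta>) (at s within A)"
    and "((\<lambda>s. h1 (v s \<theta>) * vs s \<theta>) has_real_derivative phi_ss s \<theta>) (at s within A)"
    and "((\<lambda>\<theta>. h1 (v s \<theta>) * vt s \<theta>) has_real_derivative phi_tt s \<theta>) (at \<theta> within A)"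
proof -
  note vd = v_deriv[OF assms, of \<theta> A]
  show "((\<lambda>s. h (v s \<theta>)) has_real_derivative h1 (v s \<theta>) * vs s \<theta>) (at s within A)"
    by (rule DERIV_chain2[OF h_deriv vd(1)]) (rule v_nonneg)
  have "((\<lambda>s. h1 (v s \<theta>)) has_real_derivative h2 (v s \<theta>) * vs s \<theta>) (at s within A)"
    by (rule DERIV_chain2[OF h1_deriv vd(1)]) (rule v_nonneg)
  from DERIV_mult[OF this vd(3)]
  show "((\<lambda>s. h1 (v s \<theta>) * vs s \<theta>) has_real_derivative phi_ss s \<theta>) (at s within A)"
    by (simp add: phi_ss_def power2_eq_square algebra_simps)
  have "((\<lambda>\<theta>. h1 (v s \<theta>)) has_real_derivative h2 (v s \<theta>) * vt s \<theta>) (at \<theta> within A)"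
    by (rule DERIV_chain2[OF h1_deriv vd(2)]) (rule v_nonneg)
  from DERIV_mult[OF this vd(4)]
  show "((\<lambda>\<theta>. h1 (v s \<theta>) * vt s \<theta>) has_real_derivative phi_tt s \<theta>) (at \<theta> within A)"
    by (simp add: phi_tt_def power2_eq_square algebra_simps)
qed

lemma h_cont: "continuous_on {0..} h" "continuous_on {0..} h1"
  by (rule DERIV_continuous_on[OF has_field_derivative_at_within[OF h_deriv]]
      DERIV_continuous_on[OF has_field_derivative_at_within[OF h1_deriv]], simp)+

lemma cont_all:
  assumes f: "continuous_on A f" and g: "continuous_on A g" and lt: "\<And>x. x \<in> A \<Longrightarrow> f x < ln R"
  shows "continuous_on A (\<lambda>x. h (v (f x) (g x)))"
    and "continuous_on A (\<lambda>x. h1 (v (f x) (g x)) * vs (f x) (g x))"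
    and "continuous_on A (\<lambda>x. phi_ss (f x) (g x))"
    and "continuous_on A (\<lambda>x. phi_tt (f x) (g x))"
    and "continuous_on A (\<lambda>x. lap (f x) (g x))"
proof -
  note g = G_cont'[OF assms]
  have re: "continuous_on A (\<lambda>x. Re (cnj (G (f x) (g x)) * k x))"
    and im: "continuous_on A (\<lambda>x. Im (cnj (G (f x) (g x)) * k x))" if "continuous_on A k" for k
    using that g(1) by (intro continuous_on_Re continuous_on_Im continuous_on_mult continuous_on_cnj; simp)+
  have n: "continuous_on A (\<lambda>x. (cmod (G1 (f x) (g x)))\<^sup>2)"
    by (intro continuous_on_power continuous_on_norm g)
  have cv: "continuous_on A (\<lambda>x. v (f x) (g x))"
    unfolding v_def by (intro continuous_on_power continuous_on_norm g)
  have cs: "continuous_on A (\<lambda>x. vs (f x) (g x))"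
    unfolding vs_def by (intro continuous_on_mult_const continuous_on_mult_left re g)
  have ct: "continuous_on A (\<lambda>x. vt (f x) (g x))"
    unfolding vt_def by (intro continuous_on_mult_left im g)
  have sub: "(\<lambda>x. v (f x) (g x)) ` A \<subseteq> {0..}"
    by (auto simp: v_nonneg)
  note c = continuous_on_compose2[OF h_cont(1) cv sub] continuous_on_compose2[OF h_cont(2) cv sub]
    continuous_on_compose2[OF h2_cont cv sub]
  show "continuous_on A (\<lambda>x. h (v (f x) (g x)))"
    by (rule c)
  show "continuous_on A (\<lambda>x. h1 (v (f x) (g x)) * vs (f x) (g x))"
    by (intro continuous_on_mult c cs)
  show "continuous_on A (\<lambda>x. phi_ss (f x) (g x))"
    unfolding phi_ss_def
    by (intro continuous_on_add continuous_on_mult continuous_on_power continuous_on_const c cs n re g)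
  show "continuous_on A (\<lambda>x. phi_tt (f x) (g x))"
    unfolding phi_tt_def
    by (intro continuous_on_add continuous_on_diff continuous_on_mult continuous_on_power continuous_on_const c ct n re g)
  show "continuous_on A (\<lambda>x. lap (f x) (g x))"
    unfolding lap_def by (intro continuous_on_add continuous_on_mult continuous_on_const c cv n)
qed

lemma cont_slice:
  assumes "s < ln R"
  shows "continuous_on A (\<lambda>\<theta>. h (v s \<theta>))" "continuous_on A (\<lambda>\<theta>. h1 (v s \<theta>) * vs s \<theta>)"
    "continuous_on A (phi_ss s)" "continuous_on A (phi_tt s)"
    "continuous_on A (lap s)"
  by (rule cont_all[of A "\<lambda>_. s" "\<lambda>\<theta>. \<theta>", OF continuous_on_const continuous_on_id], rule assms)+

lemma M_deriv:
  assumes "s < ln R"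
  shows "(M has_real_derivative M1 s) (at s)"
proof -
  have "((\<lambda>s. integral (cbox (-pi/4) (7*pi/4)) (\<lambda>\<theta>. h (v s \<theta>))) has_real_derivative
      integral (cbox (-pi/4) (7*pi/4)) (\<lambda>\<theta>. h1 (v s \<theta>) * vs s \<theta>)) (at s within {..<ln R})"
  proof (rule leibniz_rule_field_derivative)
    show "continuous_on ({..<ln R} \<times> cbox (-pi/4) (7*pi/4)) (\<lambda>(s, \<theta>). h1 (v s \<theta>) * vs s \<theta>)"
      unfolding split_beta by (rule cont_all(2)) (auto intro: continuous_on_fst continuous_on_snd continuous_on_id)
    show "(\<lambda>\<theta>. h (v s \<theta>)) integrable_on cbox (-pi/4) (7*pi/4)" if "s \<in> {..<ln R}" for s
      using that by (intro integrable_continuous cont_slice) auto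
  qed (use assms in \<open>auto intro: phi_deriv\<close>)
  then have "((\<lambda>s. integral (cbox (-pi/4) (7*pi/4)) (\<lambda>\<theta>. h (v s \<theta>))) has_real_derivative
      integral (cbox (-pi/4) (7*pi/4)) (\<lambda>\<theta>. h1 (v s \<theta>) * vs s \<theta>)) (at s)"
    using assms by (subst (asm) at_within_open) auto
  then show ?thesis
    by (simp add: M_def[abs_def] M1_def cbox_interval)
qed

text \<open>By periodicity the second angular derivative has integral zero, so it may be added under
  the integral. In the sum of the two second derivatives the terms with \<open>G2\<close> cancel and
  \<open>lap\<close> remains.\<close>

lemma M1_deriv:
  assumes "s < ln R"
  shows "(M1 has_real_derivative D s) (at s)"
proof -
  have "((\<lambda>s. integral (cbox (-pi/4) (7*pi/4)) (\<lambda>\<theta>. h1 (v s \<theta>) * vs s \<theta>)) has_real_derivative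
      integral (cbox (-pi/4) (7*pi/4)) (\<lambda>\<theta>. phi_ss s \<theta>)) (at s within {..<ln R})"
  proof (rule leibniz_rule_field_derivative)
    show "continuous_on ({..<ln R} \<times> cbox (-pi/4) (7*pi/4)) (\<lambda>(s, \<theta>). phi_ss s \<theta>)"
      unfolding split_beta by (rule cont_all(3)) (auto intro: continuous_on_fst continuous_on_snd continuous_on_id)
    show "(\<lambda>\<theta>. h1 (v s \<theta>) * vs s \<theta>) integrable_on cbox (-pi/4) (7*pi/4)" if "s \<in> {..<ln R}" for s
      using that by (intro integrable_continuous cont_slice) auto
  qed (use assms in \<open>auto intro: phi_deriv\<close>)
  then have "((\<lambda>s. integral (cbox (-pi/4) (7*pi/4)) (\<lambda>\<theta>. h1 (v s \<theta>) * vs s \<theta>)) has_real_derivative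
      integral (cbox (-pi/4) (7*pi/4)) (\<lambda>\<theta>. phi_ss s \<theta>)) (at s)"
    using assms by (subst (asm) at_within_open) auto
  then have 1: "(M1 has_real_derivative integral period (phi_ss s)) (at s)"
    by (simp add: M1_def[abs_def] cbox_interval)
  have int: "phi_ss s integrable_on period" "phi_tt s integrable_on period"
    using assms by (intro integrable_continuous_real cont_slice; simp)+
  have "(phi_tt s has_integral h1 (v s (7*pi/4)) * vt s (7*pi/4) - h1 (v s (-pi/4)) * vt s (-pi/4)) period"
    by (rule fundamental_theorem_of_calculus)
      (auto intro: phi_deriv assms simp flip: has_real_derivative_iff_has_vector_derivative)
  moreover have "v s (7*pi/4) = v s (-pi/4)" "vt s (7*pi/4) = vt s (-pi/4)"
    using G_periodic[of s "-pi/4"] by (simp_all add: v_def vt_def)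
  ultimately have "integral period (phi_tt s) = 0"
    by (simp add: integral_unique)
  then have "integral period (phi_ss s) = integral period (\<lambda>\<theta>. phi_ss s \<theta> + phi_tt s \<theta>)"
    using int by (subst integral_add) auto
  also have "\<dots> = D s"
  proof -
    have "phi_ss s \<theta> + phi_tt s \<theta> = lap s \<theta>" for \<theta>
    proof -
      have "(vs s \<theta>)\<^sup>2 + (vt s \<theta>)\<^sup>2 = 4 * (cmod (cnj (G s \<theta>) * G1 s \<theta>))\<^sup>2"
        unfolding vs_def vt_def cmod_power2 by (simp add: power2_eq_square algebra_simps)
      also have "\<dots> = 4 * v s \<theta> * (cmod (G1 s \<theta>))\<^sup>2"
        by (simp add: v_def norm_mult power_mult_distrib)
      finally have *: "(vs s \<theta>)\<^sup>2 + (vt s \<theta>)\<^sup>2 = 4 * v s \<theta> * (cmod (G1 s \<theta>))\<^sup>2" .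
      have "phi_ss s \<theta> + phi_tt s \<theta> = h2 (v s \<theta>) * ((vs s \<theta>)\<^sup>2 + (vt s \<theta>)\<^sup>2) + 4 * h1 (v s \<theta>) * (cmod (G1 s \<theta>))\<^sup>2"
        unfolding phi_ss_def phi_tt_def by (simp add: algebra_simps)
      then show ?thesis
        unfolding * lap_def by (simp add: algebra_simps)
    qed
    then show ?thesis by (simp add: D_def)
  qed
  finally show ?thesis using 1 by simp
qed

end

text \<open>The condition says that \<open>h (exp u)\<close> is convex in \<open>u\<close>. As
  \<open>ln (|W|^2)\<close> is harmonic off the zeros of \<open>W\<close>, this is what makes
  \<open>h (|W|^2)\<close> subharmonic.\<close>

locale subharmonic_mean = radial_mean +
  assumes h_sub: "\<And>t. t \<ge> 0 \<Longrightarrow> 0 \<le> h1 t + t * h2 t"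
begin

lemma D_nonneg: "s < ln R \<Longrightarrow> 0 \<le> D s"
  unfolding D_def
proof (intro integral_nonneg integrable_continuous_real cont_slice)
  show "0 \<le> lap s \<theta>" for \<theta>
    unfolding lap_def by (intro mult_nonneg_nonneg h_sub v_nonneg) auto
qed

lemma M1_mono: "s \<le> s' \<Longrightarrow> s' < ln R \<Longrightarrow> M1 s \<le> M1 s'"
  by (rule DERIV_nonneg_imp_nondecreasing) (auto intro!: exI M1_deriv D_nonneg)

text \<open>\<open>M1\<close> is nondecreasing, and it is at least a quantity that vanishes towards
  the centre, because \<open>G1\<close> carries a factor \<open>exp s\<close>.\<close>

lemma M1_nonneg:
  assumes "s < ln R"
  shows "0 \<le> M1 s"
proof -
  have c: "continuous_on (cball 0 (exp s)) (\<lambda>z. h1 ((cmod (W z))\<^sup>2) * cmod (W z) * cmod (deriv W z))"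
  proof -
    have sub: "cball 0 (exp s) \<subseteq> ball 0 R"
      using assms R_pos exp_less_cancel_iff[of s "ln R"] by auto
    have [continuous_intros]: "continuous_on (cball 0 (exp s)) W" "continuous_on (cball 0 (exp s)) (deriv W)"
      using sub hol holomorphic_deriv[OF hol open_ball]
      by (meson holomorphic_on_imp_continuous_on holomorphic_on_subset)+
    have "continuous_on (cball 0 (exp s)) (\<lambda>z. h1 ((cmod (W z))\<^sup>2))"
      by (rule continuous_on_compose2[OF h_cont(2)]) (auto intro!: continuous_intros)
    then show ?thesis by (intro continuous_intros)
  qed
  then obtain B where B: "\<And>z. z \<in> cball 0 (exp s) \<Longrightarrow> \<bar>h1 ((cmod (W z))\<^sup>2) * cmod (W z) * cmod (deriv W z)\<bar> \<le> B"
    using compact_continuous_image[OF c compact_cball] compact_imp_bounded bounded_iff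
    by (metis (no_types, lifting) image_eqI real_norm_def)
  have lb: "- (4 * pi * B) * exp s' \<le> M1 s" if "s' \<le> s" for s'
  proof -
    have le: "\<bar>h1 (v s' \<theta>) * vs s' \<theta>\<bar> \<le> 2 * B * exp s'" for \<theta>
    proof -
      let ?e = "exp (Complex s' \<theta>)"
      have "\<bar>vs s' \<theta>\<bar> \<le> 2 * (cmod (W ?e) * cmod (deriv W ?e) * exp s')"
        using abs_Re_le_cmod[of "cnj (G s' \<theta>) * G1 s' \<theta>"]
        by (simp add: vs_def G_def G1_def norm_mult abs_mult)
      then have "\<bar>h1 (v s' \<theta>) * vs s' \<theta>\<bar> \<le> \<bar>h1 (v s' \<theta>)\<bar> * (2 * (cmod (W ?e) * cmod (deriv W ?e) * exp s'))"
        unfolding abs_mult by (intro mult_left_mono) auto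
      also have "\<dots> = 2 * \<bar>h1 ((cmod (W ?e))\<^sup>2) * cmod (W ?e) * cmod (deriv W ?e)\<bar> * exp s'"
        by (simp add: v_def G_def abs_mult)
      also have "\<dots> \<le> 2 * B * exp s'"
        using that by (intro mult_right_mono mult_left_mono B) auto
      finally show ?thesis .
    qed
    have "norm (integral (cbox (-pi/4) (7*pi/4)) (\<lambda>\<theta>. h1 (v s' \<theta>) * vs s' \<theta>)) \<le> (2 * B * exp s') * measure lborel (cbox (-pi/4) (7*pi/4))"
    proof (rule Henstock_Kurzweil_Integration.integrable_bound)
      have "0 \<le> B" using B[of 0] by (intro order_trans[OF abs_ge_zero]) auto
      then show "0 \<le> 2 * B * exp s'" by simp
      show "(\<lambda>\<theta>. h1 (v s' \<theta>) * vs s' \<theta>) integrable_on cbox (-pi/4) (7*pi/4)"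
        using that assms by (intro integrable_continuous cont_slice) auto
    qed (use le in auto)
    then have "\<bar>M1 s'\<bar> \<le> 4 * pi * B * exp s'"
      by (simp add: M1_def cbox_interval mult_ac)
    then have "- (4 * pi * B) * exp s' \<le> M1 s'"
      unfolding mult_minus_left by (simp add: abs_le_iff)
    also have "M1 s' \<le> M1 s"
      by (rule M1_mono) (use that assms in auto)
    finally show ?thesis .
  qed
  have "((\<lambda>s'. - (4 * pi * B) * exp s') \<longlongrightarrow> - (4 * pi * B) * 0) at_bot"
    by (intro tendsto_intros exp_at_bot)
  then have "((\<lambda>s'. - (4 * pi * B) * exp s') \<longlongrightarrow> 0) at_bot" by simp
  then show ?thesis
  proof (rule tendsto_upperbound)
    show "\<forall>\<^sub>F s' in at_bot. - (4 * pi * B) * exp s' \<le> M1 s"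
      using eventually_le_at_bot[of s] by eventually_elim (rule lb)
  qed simp
qed

lemma M_mono: "s \<le> s' \<Longrightarrow> s' < ln R \<Longrightarrow> M s \<le> M s'"
  by (rule DERIV_nonneg_imp_nondecreasing) (auto intro!: exI M_deriv M1_nonneg)

text \<open>The means are nondecreasing in the radius, and by continuity those over very small
  circles are close to \<open>2 * pi\<close> times the central value.\<close>

lemma M_ge_center:
  assumes "s < ln R"
  shows "2 * pi * h ((cmod (W 0))\<^sup>2) \<le> M s"
proof -
  have cont: "isCont (\<lambda>z. h ((cmod (W z))\<^sup>2)) 0"
  proof -
    have "isCont W 0"
      using W_deriv[of 0] R_pos by (auto intro: DERIV_isCont)
    moreover have "isCont h ((cmod (W 0))\<^sup>2)"
      by (rule DERIV_isCont[OF h_deriv]) simp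
    ultimately show ?thesis
      by (intro isCont_o2[where f = "\<lambda>z. (cmod (W z))\<^sup>2" and g = h] continuous_intros)
  qed
  have le: "2 * pi * h ((cmod (W 0))\<^sup>2) - 2 * pi * e \<le> M s" if "e > 0" for e
  proof -
    obtain d where d: "d > 0" "\<And>z. norm z < d \<Longrightarrow> \<bar>h ((cmod (W z))\<^sup>2) - h ((cmod (W 0))\<^sup>2)\<bar> < e"
      using cont \<open>e > 0\<close> unfolding continuous_at_eps_delta by (auto simp: dist_norm)
    define s' where "s' = min s (ln (d/2))"
    have "exp s' \<le> exp (ln (d/2))"
      by (simp add: s'_def)
    then have "exp s' < d"
      using d(1) by simp
    have "integral period (\<lambda>\<theta>. h ((cmod (W 0))\<^sup>2) - e) \<le> M s'"
      unfolding M_def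
    proof (rule integral_le)
      show "(\<lambda>\<theta>. h (v s' \<theta>)) integrable_on period"
        using assms by (intro integrable_continuous_real cont_slice) (auto simp: s'_def)
      show "h ((cmod (W 0))\<^sup>2) - e \<le> h (v s' \<theta>)" for \<theta>
        using d(2)[of "exp (Complex s' \<theta>)"] \<open>exp s' < d\<close> by (simp add: v_def G_def)
    qed auto
    also have "M s' \<le> M s"
      by (rule M_mono) (use assms in \<open>auto simp: s'_def\<close>)
    finally show ?thesis
      by (simp add: algebra_simps)
  qed
  show ?thesis
  proof (rule field_le_epsilon)
    fix e :: real
    assume "e > 0"
    then show "2 * pi * h ((cmod (W 0))\<^sup>2) \<le> M s + e"
      using le[of "e / (2 * pi)"] by simp
  qed
qed

end

lemma integral_periodic:
  fixes f :: "real \<Rightarrow> real"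
  assumes cont: "continuous_on UNIV f" and per: "\<And>x. f (x + p) = f x" and "0 \<le> p"
  shows "integral {c..c + p} f = integral {a..a + p} f"
proof -
  have *: "integral {c..c + p} f = integral {a..a + p} f" if "a \<le> c" for a c
  proof -
    have int: "f integrable_on {x..y}" for x y
      by (rule integrable_continuous_real[OF continuous_on_subset[OF cont]]) auto
    have "integral {a..a + p} f + integral {a + p..c + p} f = integral {a..c + p} f"
      by (rule Henstock_Kurzweil_Integration.integral_combine[OF _ _ int]) (use that \<open>0 \<le> p\<close> in auto)
    moreover have "integral {a..c} f + integral {c..c + p} f = integral {a..c + p} f"
      by (rule Henstock_Kurzweil_Integration.integral_combine[OF _ _ int]) (use that \<open>0 \<le> p\<close> in auto)
    moreover have "integral {a + p..c + p} f = integral {a..c} (f \<circ> (\<lambda>x. x + p))"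
      by (rule integral_shift[symmetric]) (rule continuous_on_subset[OF cont], simp)
    moreover have "f \<circ> (\<lambda>x. x + p) = f"
      using per by auto
    ultimately show ?thesis by simp
  qed
  show ?thesis
    using *[of a c] *[of c a] by linarith
qed

context subharmonic_mean
begin

lemma M_shift:
  assumes "s < ln R"
  shows "integral {c..c + 2 * pi} (\<lambda>\<theta>. h (v s \<theta>)) = M s"
proof -
  have "integral {c..c + 2 * pi} (\<lambda>\<theta>. h (v s \<theta>)) = integral {-pi/4..-pi/4 + 2*pi} (\<lambda>\<theta>. h (v s \<theta>))"
    by (rule integral_periodic) (rule cont_slice[OF assms], simp_all add: v_def G_periodic)
  then show ?thesis
    by (simp add: M_def)
qed

text \<open>Submean inequality on a disc of radius \<open>\<sigma>\<close> in the
  \<open>(s, \<theta>)\<close> plane, applied to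
  \<open>W2 z = W (exp (Complex s \<theta> + z))\<close>. The disc lies in a square of side
  \<open>2 * \<sigma>\<close>. Because \<open>\<sigma> \<le> pi\<close>, each vertical line of the
  square covers at most one period and contributes at most \<open>M (s + \<sigma>)\<close>.\<close>

lemma le_M:
  assumes h_nonneg: "\<And>t. 0 \<le> t \<Longrightarrow> 0 \<le> h t" and \<sigma>: "0 < \<sigma>" "\<sigma> \<le> pi" and s: "s + \<sigma> < ln R"
  shows "h (v s \<theta>) \<le> M (s + \<sigma>) / \<sigma>"
proof -
  define W2 where "W2 = (\<lambda>z. W (exp (Complex s \<theta> + z)))"
  define r where "r = ln R - s"
  have r: "\<sigma> < r"
    using s by (simp add: r_def)
  have in_ball: "exp (Complex s \<theta> + z) \<in> ball 0 R" if "z \<in> ball 0 r" for z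
  proof -
    have "Re z < r"
      using that complex_Re_le_cmod[of z] by auto
    then have "exp (s + Re z) < exp (ln R)"
      by (simp only: exp_less_cancel_iff r_def)
    then show ?thesis
      using R_pos by simp
  qed
  have holW2: "W2 holomorphic_on ball 0 r"
    unfolding W2_def
  proof (rule holomorphic_on_compose_gen[where f = "\<lambda>z. exp (Complex s \<theta> + z)" and g = W, unfolded o_def])
    show "(\<lambda>z. exp (Complex s \<theta> + z)) ` ball 0 r \<subseteq> ball 0 R"
      using in_ball by blast
  qed (intro holomorphic_intros hol)+
  interpret W2: subharmonic_mean W2 r h h1 h2
    using holW2 r \<sigma>(1) h_deriv h1_deriv h2_cont h_sub by unfold_locales auto
  have W2_eq: "W2 (Complex x y) = G (s + x) (\<theta> + y)" for x y
    by (simp add: W2_def G_def flip: complex_add)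
  define f where "f = (\<lambda>z. ennreal (indicator (cball 0 \<sigma>) z *\<^sub>R h ((cmod (W2 z))\<^sup>2)))"
  have fm [measurable]: "f \<in> borel_measurable borel"
  proof -
    have "continuous_on (cball 0 \<sigma>) W2"
      using r by (intro continuous_on_subset[OF holomorphic_on_imp_continuous_on[OF holW2]]) auto
    then have "continuous_on (cball 0 \<sigma>) (\<lambda>z. h ((cmod (W2 z))\<^sup>2))"
      by (intro continuous_on_compose2[OF h_cont(1)] continuous_intros) auto
    then have "(\<lambda>z. indicator (cball 0 \<sigma>) z *\<^sub>R h ((cmod (W2 z))\<^sup>2)) \<in> borel_measurable borel"
      by (intro borel_measurable_continuous_on_indicator) auto
    then show ?thesis
      unfolding f_def by measurable
  qed
  \<comment> \<open>The polar formula needs a bounded range of logarithmic radii, so only radii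
    between \<open>\<sigma> / 2\<close> and \<open>\<sigma>\<close> are used. This keeps three
    quarters of the area of the disc.\<close>
  define a b where "a = ln (\<sigma> / 2)" and "b = ln \<sigma>"
  have ab: "a < b"
    using \<sigma> by (simp add: a_def b_def)
  have [measurable]: "(\<lambda>x. exp x) \<in> borel_measurable (borel :: complex measure)"
    by (intro borel_measurable_continuous_onI continuous_intros)
  have "ennreal (h (v s \<theta>)) * ennreal (3 * pi * \<sigma>\<^sup>2 / 4) =
      (\<integral>\<^sup>+t. ennreal (2 * pi * h (v s \<theta>)) * ennreal (indicator {a..b} t * exp (2 * t)) \<partial>lborel)"
  proof -
    have "((\<lambda>t. exp (2 * t)) has_integral exp (2 * b) / 2 - exp (2 * a) / 2) {a..b}"
      by (rule fundamental_theorem_of_calculus)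
        (use ab in \<open>auto intro!: derivative_eq_intros simp flip: has_real_derivative_iff_has_vector_derivative\<close>)
    then have "(\<integral>\<^sup>+t. ennreal (indicator {a..b} t * exp (2 * t)) \<partial>lborel) = ennreal (exp (2 * b) / 2 - exp (2 * a) / 2)"
      by (intro nn_integral_has_integral_lebesgue) auto
    also have "exp (2 * b) / 2 - exp (2 * a) / 2 = 3 * \<sigma>\<^sup>2 / 8"
      using \<sigma> unfolding a_def b_def exp_double by (simp add: power2_eq_square)
    finally show ?thesis
      using h_nonneg[OF v_nonneg, of s \<theta>]
      by (subst nn_integral_cmult) (auto simp: ennreal_mult[symmetric] field_simps)
  qed
  also have "\<dots> \<le> (\<integral>\<^sup>+t. \<integral>\<^sup>+\<alpha>. f (exp (Complex t \<alpha>)) * ennreal (exp (2 * t)) * indicator {a..b} t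
            * indicator period \<alpha> \<partial>lborel \<partial>lborel)"
  proof (rule nn_integral_mono)
    fix t :: real
    show "ennreal (2 * pi * h (v s \<theta>)) * ennreal (indicator {a..b} t * exp (2 * t))
       \<le> (\<integral>\<^sup>+\<alpha>. f (exp (Complex t \<alpha>)) * ennreal (exp (2 * t)) * indicator {a..b} t
            * indicator period \<alpha> \<partial>lborel)"
    proof (cases "t \<in> {a..b}")
      case True
      then have t: "t < ln r" "exp t \<le> \<sigma>"
        using r \<sigma> le_less_trans[of t "ln \<sigma>" "ln r"] by (simp_all add: b_def ln_ge_iff)
      have m: "(\<lambda>\<alpha>. h (W2.v t \<alpha>)) \<in> borel_measurable borel"
        by (rule borel_measurable_continuous_onI) (rule W2.cont_slice[OF t(1)])
      have "2 * pi * h (v s \<theta>) \<le> W2.M t"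
        using W2.M_ge_center[OF t(1)] by (simp add: v_def G_def W2_def)
      then have "ennreal (2 * pi * h (v s \<theta>)) * ennreal (exp (2 * t)) \<le> ennreal (W2.M t) * ennreal (exp (2 * t))"
        by (intro mult_right_mono ennreal_leI) auto
      also have "ennreal (W2.M t) = (\<integral>\<^sup>+\<alpha>. ennreal (indicator period \<alpha> * h (W2.v t \<alpha>)) \<partial>lborel)"
      proof (rule nn_integral_has_integral_lebesgue[symmetric])
        show "((\<lambda>\<alpha>. h (W2.v t \<alpha>)) has_integral W2.M t) period"
          unfolding W2.M_def using t(1)
          by (intro integrable_integral integrable_continuous_real W2.cont_slice) auto
      qed (use m h_nonneg W2.v_nonneg in auto)
      also have "\<dots> * ennreal (exp (2 * t)) = (\<integral>\<^sup>+\<alpha>. ennreal (indicator period \<alpha> * h (W2.v t \<alpha>)) * ennreal (exp (2 * t)) \<partial>lborel)"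
        by (rule nn_integral_multc[symmetric]) (use m in measurable)
      also have "\<dots> = (\<integral>\<^sup>+\<alpha>. f (exp (Complex t \<alpha>)) * ennreal (exp (2 * t)) * indicator {a..b} t
            * indicator period \<alpha> \<partial>lborel)"
        using True t(2) by (intro nn_integral_cong) (auto simp: f_def W2.v_def W2.G_def indicator_def)
      finally show ?thesis
        using True by simp
    qed auto
  qed
  also have "\<dots> = (\<integral>\<^sup>+\<alpha>. \<integral>\<^sup>+t. f (exp (Complex t \<alpha>)) * ennreal (exp (2 * t)) * indicator {a..b} t
            * indicator period \<alpha> \<partial>lborel \<partial>lborel)"
    by (rule lborel_pair.Fubini') measurable
  also have "\<dots> = (\<integral>\<^sup>+\<alpha>. (\<integral>\<^sup>+t. f (exp (Complex t \<alpha>)) * ennreal (exp (2 * t)) * indicator {a..b} t \<partial>lborel)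
            * indicator period \<alpha> \<partial>lborel)"
    by (intro nn_integral_cong nn_integral_multc) measurable
  also have "\<dots> \<le> (\<integral>\<^sup>+z. f z \<partial>lborel)"
    by (rule nn_integral_polar_le[OF fm ab])
  also have "\<dots> = (\<integral>\<^sup>+x. \<integral>\<^sup>+y. f (Complex x y) \<partial>lborel \<partial>lborel)"
    by (rule nn_integral_complex[OF fm])
  also have "\<dots> \<le> (\<integral>\<^sup>+x. ennreal (M (s + \<sigma>)) * indicator {-\<sigma>..\<sigma>} x \<partial>lborel)"
  proof (rule nn_integral_mono)
    fix x :: real
    show "(\<integral>\<^sup>+y. f (Complex x y) \<partial>lborel) \<le> ennreal (M (s + \<sigma>)) * indicator {-\<sigma>..\<sigma>} x"
    proof (cases "x \<in> {-\<sigma>..\<sigma>}")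
      case True
      then have sx: "s + x < ln R"
        using s by simp
      have cg: "continuous_on UNIV (\<lambda>\<beta>. h (v (s + x) \<beta>))"
        by (rule cont_slice[OF sx])
      have c: "continuous_on A (\<lambda>y. h (v (s + x) (\<theta> + y)))" for A
        by (rule continuous_on_compose2[OF cg]) (auto intro: continuous_intros)
      have "(\<integral>\<^sup>+y. f (Complex x y) \<partial>lborel) \<le> (\<integral>\<^sup>+y. ennreal (indicator {-\<sigma>..\<sigma>} y * h (v (s + x) (\<theta> + y))) \<partial>lborel)"
      proof (rule nn_integral_mono)
        fix y :: real
        have "\<bar>y\<bar> \<le> \<sigma>" if "cmod (Complex x y) \<le> \<sigma>"
          using that abs_Im_le_cmod[of "Complex x y"] by simp
        then show "f (Complex x y) \<le> ennreal (indicator {-\<sigma>..\<sigma>} y * h (v (s + x) (\<theta> + y)))"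
          by (auto simp: f_def W2_eq v_def indicator_def)
      qed
      also have "\<dots> = ennreal (integral {-\<sigma>..\<sigma>} (\<lambda>y. h (v (s + x) (\<theta> + y))))"
        by (rule nn_integral_has_integral_lebesgue)
          (use c h_nonneg v_nonneg in \<open>auto intro!: integrable_integral integrable_continuous_real borel_measurable_continuous_onI\<close>)
      also have "\<dots> \<le> ennreal (M (s + \<sigma>))"
      proof (rule ennreal_leI)
        have "integral {-\<sigma>..\<sigma>} (\<lambda>y. h (v (s + x) (\<theta> + y))) \<le> integral {-pi..-pi + 2*pi} (\<lambda>y. h (v (s + x) (\<theta> + y)))"
          using \<sigma> c h_nonneg v_nonneg by (intro integral_subset_le integrable_continuous_real) auto
        also have "\<dots> = integral {-pi - \<theta>..-pi - \<theta> + 2*pi} (\<lambda>y. h (v (s + x) (\<theta> + y)))"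
          by (rule integral_periodic[OF c]) (auto simp: v_def G_periodic add.assoc[symmetric])
        also have "\<dots> = integral {-pi - \<theta>..pi - \<theta>} ((\<lambda>\<beta>. h (v (s + x) \<beta>)) \<circ> (\<lambda>y. y + \<theta>))"
          by (simp add: o_def add.commute)
        also have "\<dots> = integral {-pi..-pi + 2 * pi} (\<lambda>\<beta>. h (v (s + x) \<beta>))"
          by (subst integral_shift) (auto intro: continuous_on_subset[OF cg])
        also have "\<dots> = M (s + x)"
          by (rule M_shift[OF sx])
        also have "\<dots> \<le> M (s + \<sigma>)"
          using True s by (intro M_mono) auto
        finally show "integral {-\<sigma>..\<sigma>} (\<lambda>y. h (v (s + x) (\<theta> + y))) \<le> M (s + \<sigma>)" .
      qed
      finally show ?thesis
        using True by simp
    next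
      case False
      have "f (Complex x y) = 0" for y
        using False abs_Re_le_cmod[of "Complex x y"] by (auto simp: f_def indicator_def)
      then show ?thesis by simp
    qed
  qed
  also have "\<dots> = ennreal (M (s + \<sigma>)) * ennreal (2 * \<sigma>)"
    using \<sigma> by (simp add: nn_integral_cmult_indicator)
  finally have main: "ennreal (h (v s \<theta>)) * ennreal (3 * pi * \<sigma>\<^sup>2 / 4) \<le> ennreal (M (s + \<sigma>)) * ennreal (2 * \<sigma>)" .
  have Mn: "0 \<le> M (s + \<sigma>)"
    unfolding M_def using s by (intro integral_nonneg integrable_continuous_real cont_slice h_nonneg v_nonneg) auto
  have "h (v s \<theta>) * (3 * pi * \<sigma>\<^sup>2 / 4) \<le> M (s + \<sigma>) * (2 * \<sigma>)"
    using main Mn h_nonneg[OF v_nonneg, of s \<theta>] \<sigma> by (simp add: ennreal_mult[symmetric])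
  then have 1: "h (v s \<theta>) * (3 * pi / 4) * \<sigma> \<le> M (s + \<sigma>) * 2"
    using \<sigma> by (simp add: power2_eq_square field_simps)
  \<comment> \<open>The factor 2 from the width of the square is absorbed by
    \<open>3 * pi / 4 \<ge> 2\<close>.\<close>
  have "h (v s \<theta>) * 2 * \<sigma> \<le> h (v s \<theta>) * (3 * pi / 4) * \<sigma>"
    using pi_gt3 h_nonneg[OF v_nonneg, of s \<theta>] \<sigma> by (intro mult_right_mono mult_left_mono) auto
  with 1 have "h (v s \<theta>) * \<sigma> \<le> M (s + \<sigma>)"
    by linarith
  then show ?thesis
    using \<sigma> by (simp add: field_simps)
qed

end

section \<open>Growth of the means and the area where the real part is small\<close>

lemma first_hit:
  fixes T :: "real \<Rightarrow> real"
  assumes cont: "continuous_on {p..q} T" and "T p \<le> y" and ex: "r \<in> {p..q}" "y \<le> T r"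
  obtains s where "s \<in> {p..r}" "T s = y" "\<And>u. p \<le> u \<Longrightarrow> u < s \<Longrightarrow> T u < y"
proof -
  define A where "A = {s \<in> {p..q}. y \<le> T s}"
  have "closed A"
    using continuous_closed_preimage[OF cont, of "{y..}"] by (simp add: A_def vimage_def Int_def)
  then have "compact A"
    by (intro compact_eq_bounded_closed[THEN iffD2] conjI bounded_subset[OF bounded_closed_interval[of p q]])
      (auto simp: A_def)
  moreover have "A \<noteq> {}" using ex by (auto simp: A_def)
  ultimately have "\<exists>s\<in>A. \<forall>u\<in>A. s \<le> u"
    by (rule compact_attains_inf)
  then obtain s where s: "s \<in> A" "\<And>u. u \<in> A \<Longrightarrow> s \<le> u"
    by auto
  have lt: "T u < y" if "p \<le> u" "u < s" for u
    using that s(1) s(2)[of u] by (force simp: A_def)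
  have "T s = y"
  proof (rule ccontr)
    assume "T s \<noteq> y"
    then have "y < T s" using s by (auto simp: A_def)
    have "p \<le> s" "s \<le> q" using s by (auto simp: A_def)
    have "\<exists>x\<ge>p. x \<le> s \<and> T x = y"
      using \<open>y < T s\<close> \<open>T p \<le> y\<close> \<open>p \<le> s\<close> \<open>s \<le> q\<close>
      by (intro IVT' continuous_on_subset[OF cont]) auto
    then obtain x where "p \<le> x" "x \<le> s" "T x = y" by blast
    with lt[of x] \<open>y < T s\<close> show False by (cases "x = s") auto
  qed
  moreover have "s \<in> {p..r}" using s ex by (auto simp: A_def)
  ultimately show ?thesis using lt that by blast
qed

text \<open>A continuously differentiable extension of \<open>1 + x\<close> from \<open>x \<ge> 0\<close> that stays comparable to \<open>1 + |x|\<close>.\<close>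

definition bend :: "real \<Rightarrow> real" where
  "bend x = (if 0 \<le> x then 1 + x else (1 + x\<^sup>2) / (1 - x))"

definition bend' :: "real \<Rightarrow> real" where
  "bend' x = (if 0 \<le> x then 1 else (1 + 2 * x - x\<^sup>2) / (1 - x)\<^sup>2)"

lemma bend_deriv: "(bend has_real_derivative bend' x) (at x)"
proof -
  consider "x > 0" | "x < 0" | "x = 0" by linarith
  then show ?thesis
  proof cases
    case 1
    have "((\<lambda>x. 1 + x) has_real_derivative 1) (at x)"
      by (auto intro!: derivative_eq_intros)
    then have "(bend has_real_derivative 1) (at x)"
      by (rule has_field_derivative_transform_within_open[where S = "{0<..}"]) (use 1 in \<open>auto simp: bend_def\<close>)
    then show ?thesis
      using 1 by (simp add: bend'_def)
  next
    case 2
    have "((\<lambda>x. (1 + x\<^sup>2) / (1 - x)) has_real_derivative (1 + 2 * x - x\<^sup>2) / (1 - x)\<^sup>2) (at x)"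
      using 2 by (auto intro!: derivative_eq_intros simp: power2_eq_square algebra_simps)
    then have "(bend has_real_derivative (1 + 2 * x - x\<^sup>2) / (1 - x)\<^sup>2) (at x)"
      by (rule has_field_derivative_transform_within_open[where S = "{..<0}"]) (use 2 in \<open>auto simp: bend_def\<close>)
    then show ?thesis
      using 2 by (simp add: bend'_def)
  next
    case 3
    \<comment> \<open>Both branches have slope 1 at 0: the deviation of the difference quotient from
      1 is \<open>2 * h / (1 - h)\<close> on the left and zero on the right.\<close>
    have "((\<lambda>h. (bend (0 + h) - bend 0) / h - 1) \<longlongrightarrow> 0) (at 0)"
    proof (rule Lim_null_comparison)
      show "\<forall>\<^sub>F h in at (0::real). norm ((bend (0 + h) - bend 0) / h - 1) \<le> 2 * \<bar>h\<bar>"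
      proof (rule eventually_at_filter[THEN iffD2], rule always_eventually, intro allI impI)
        fix h :: real
        assume "h \<noteq> 0"
        have "(1 + h\<^sup>2) / (1 - h) - 1 = h + 2 * h\<^sup>2 / (1 - h)" if "h < 0"
          using that by (simp add: field_simps power2_eq_square)
        then have "((1 + h\<^sup>2) / (1 - h) - 1) / h - 1 = 2 * h / (1 - h)" if "h < 0"
          using that by (simp add: field_simps power2_eq_square)
        moreover have "\<bar>2 * h / (1 - h)\<bar> \<le> 2 * \<bar>h\<bar>" if "h < 0"
        proof -
          have "2 * \<bar>h\<bar> / (1 - h) \<le> 2 * \<bar>h\<bar> / 1"
            using that by (intro divide_left_mono) auto
          then show ?thesis
            using that by (simp add: abs_divide abs_mult)
        qed
        ultimately show "norm ((bend (0 + h) - bend 0) / h - 1) \<le> 2 * \<bar>h\<bar>"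
          using \<open>h \<noteq> 0\<close> by (auto simp: bend_def)
      qed
      show "((\<lambda>h::real. 2 * \<bar>h\<bar>) \<longlongrightarrow> 0) (at 0)"
        by (auto intro!: tendsto_eq_intros)
    qed
    then have "((\<lambda>h. (bend (0 + h) - bend 0) / h) \<longlongrightarrow> 1) (at 0)"
      by (simp add: LIM_zero_iff)
    then show ?thesis
      using 3 by (simp add: DERIV_def bend'_def)
  qed
qed

lemma bend'_cont: "continuous_on UNIV bend'"
proof -
  have "continuous_on ({0..} \<union> {..0}) (\<lambda>x. if x \<in> {0..} then 1 else (1 + 2 * x - x\<^sup>2) / (1 - x)\<^sup>2 :: real)"
    by (rule continuous_on_If) (auto intro!: continuous_intros)
  moreover have "{0..} \<union> {..0::real} = UNIV" by auto
  ultimately show ?thesis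
    by (simp add: bend'_def[abs_def])
qed

lemma bend_cont: "continuous_on UNIV bend"
  by (rule DERIV_continuous_on[OF has_field_derivative_at_within[OF bend_deriv]])

lemma bend_ge: "(1 + \<bar>x\<bar>) / 2 \<le> bend x"
proof (cases "0 \<le> x")
  case False
  have "0 \<le> (1 + x)\<^sup>2 + 0" by simp
  then have "(1 - x) * (1 - x) \<le> 2 * (1 + x\<^sup>2)"
    by (simp add: power2_eq_square algebra_simps)
  then have "(1 - x) / 2 \<le> (1 + x\<^sup>2) / (1 - x)"
    using False by (subst pos_le_divide_eq) auto
  then show ?thesis
    using False by (simp add: bend_def)
qed (simp add: bend_def)

lemma bend_pos: "0 < bend x"
proof -
  have "0 < (1 + \<bar>x\<bar>) / 2"
    by (intro divide_pos_pos add_pos_nonneg) auto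
  then show ?thesis
    using bend_ge[of x] by (rule less_le_trans)
qed

lemma bend_le: "bend x \<le> 1 + \<bar>x\<bar>"
proof (cases "0 \<le> x")
  case False
  then have "1 + x\<^sup>2 \<le> (1 - x) * (1 - x)"
    by (simp add: power2_eq_square algebra_simps)
  then have "(1 + x\<^sup>2) / (1 - x) \<le> 1 - x"
    using False by (subst pos_divide_le_eq) auto
  then show ?thesis
    using False by (simp add: bend_def)
qed (simp add: bend_def)

lemma bend'_bound: "\<bar>bend' x - 1\<bar> \<le> 2" "0 \<le> x \<Longrightarrow> bend' x = 1"
proof -
  show "\<bar>bend' x - 1\<bar> \<le> 2"
  proof (cases "0 \<le> x")
    case False
    then have "bend' x - 1 = (4 * x - 2 * x\<^sup>2) / (1 - x)\<^sup>2"
    proof -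
      have "1 + 2 * x - x\<^sup>2 = (4 * x - 2 * x\<^sup>2) + (1 - x)\<^sup>2"
        by (simp add: power2_eq_square algebra_simps)
      then have "bend' x = ((4 * x - 2 * x\<^sup>2) + (1 - x)\<^sup>2) / (1 - x)\<^sup>2"
        using False by (simp only: bend'_def if_False)
      moreover have "(1 - x)\<^sup>2 \<noteq> 0"
        using False by simp
      ultimately show ?thesis
        by (simp only: add_divide_distrib divide_self if_False) simp
    qed
    moreover have "\<bar>4 * x - 2 * x\<^sup>2\<bar> \<le> 2 * (1 - x)\<^sup>2"
    proof -
      have "4 * x \<le> 0" "0 \<le> 2 * x\<^sup>2" "2 * (1 - x)\<^sup>2 = 2 - 4 * x + 2 * x\<^sup>2"
        using False by (simp_all add: power2_eq_square algebra_simps)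
      then show ?thesis by linarith
    qed
    moreover have "(1 - x)\<^sup>2 > 0"
      using False by simp
    ultimately show ?thesis
      by (simp add: abs_divide divide_le_eq)
  qed (simp add: bend'_def)
qed (simp add: bend'_def)

section \<open>The bent logarithm of a holomorphic function and its energy\<close>

context holomorphic_disc
begin

text \<open>\<open>psi\<close> is the real part, and the function differentiated in \<open>psi_deriv(2)\<close> the imaginary part, of
  \<open>ln (bend (X s \<theta>) + \<i> Im (G s \<theta>))\<close>, which is \<open>ln G\<close> as long as \<open>Re G \<ge> 1\<close>. Hence the derivative \<open>psi_s - eta_t\<close>
  of the means is supported where \<open>Re G < 1\<close>.\<close>

definition X :: "real \<Rightarrow> real \<Rightarrow> real" where "X s \<theta> = Re (G s \<theta>) - 1"

definition psi :: "real \<Rightarrow> real \<Rightarrow> real" where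
  "psi s \<theta> = ln ((bend (X s \<theta>))\<^sup>2 + (Im (G s \<theta>))\<^sup>2) / 2"

definition psi_s :: "real \<Rightarrow> real \<Rightarrow> real" where
  "psi_s s \<theta> = (bend (X s \<theta>) * bend' (X s \<theta>) * Re (G1 s \<theta>) + Im (G s \<theta>) * Im (G1 s \<theta>))
     / ((bend (X s \<theta>))\<^sup>2 + (Im (G s \<theta>))\<^sup>2)"

definition eta_t :: "real \<Rightarrow> real \<Rightarrow> real" where
  "eta_t s \<theta> = (bend (X s \<theta>) * Re (G1 s \<theta>) + Im (G s \<theta>) * bend' (X s \<theta>) * Im (G1 s \<theta>))
     / ((bend (X s \<theta>))\<^sup>2 + (Im (G s \<theta>))\<^sup>2)"

definition kern :: "real \<Rightarrow> real \<Rightarrow> real" where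
  "kern s \<theta> = (bend' (X s \<theta>) - 1) * (bend (X s \<theta>) * Re (G1 s \<theta>) - Im (G s \<theta>) * Im (G1 s \<theta>))
     / ((bend (X s \<theta>))\<^sup>2 + (Im (G s \<theta>))\<^sup>2)"

definition T :: "real \<Rightarrow> real" where
  "T s = integral period (psi s)"

lemma den_pos: "0 < (bend x)\<^sup>2 + y\<^sup>2"
  using bend_pos[of x] by (intro add_pos_nonneg) auto

lemma kern_eq: "kern s \<theta> = psi_s s \<theta> - eta_t s \<theta>"
  unfolding kern_def psi_s_def eta_t_def diff_divide_distrib[symmetric] by (simp add: algebra_simps)

lemma psi_deriv:
  assumes "s < ln R"
  shows "((\<lambda>s. psi s \<theta>) has_real_derivative psi_s s \<theta>) (at s within A)"
    and "((\<lambda>\<theta>. arctan (Im (G s \<theta>) / bend (X s \<theta>))) has_real_derivative eta_t s \<theta>) (at \<theta> within A)"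
proof -
  have d: "((\<lambda>s. Re (G s \<theta>)) has_real_derivative Re (G1 s \<theta>)) (at s within A)"
      "((\<lambda>s. Im (G s \<theta>)) has_real_derivative Im (G1 s \<theta>)) (at s within A)"
      "((\<lambda>\<theta>. Re (G s \<theta>)) has_real_derivative - Im (G1 s \<theta>)) (at \<theta> within A)"
      "((\<lambda>\<theta>. Im (G s \<theta>)) has_real_derivative Re (G1 s \<theta>)) (at \<theta> within A)"
    using has_vd_Re_Im[OF G_deriv(1)[OF assms, of \<theta> A]] has_vd_Re_Im[OF G_deriv(2)[OF assms, of \<theta> A]] by simp_all
  have b1: "((\<lambda>s. bend (X s \<theta>)) has_real_derivative bend' (X s \<theta>) * Re (G1 s \<theta>)) (at s within A)"
    unfolding X_def by (rule DERIV_chain2[OF bend_deriv DERIV_cong[OF DERIV_diff[OF d(1) DERIV_const]]]) simp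
  have b2: "((\<lambda>\<theta>. bend (X s \<theta>)) has_real_derivative bend' (X s \<theta>) * - Im (G1 s \<theta>)) (at \<theta> within A)"
    unfolding X_def by (rule DERIV_chain2[OF bend_deriv DERIV_cong[OF DERIV_diff[OF d(3) DERIV_const]]]) simp
  show "((\<lambda>s. psi s \<theta>) has_real_derivative psi_s s \<theta>) (at s within A)"
  proof -
    let ?b = "\<lambda>s. bend (X s \<theta>)" and ?y = "\<lambda>s. Im (G s \<theta>)"
    let ?N = "?b s * bend' (X s \<theta>) * Re (G1 s \<theta>) + ?y s * Im (G1 s \<theta>)"
    have D: "((\<lambda>s. (?b s)\<^sup>2 + (?y s)\<^sup>2) has_real_derivative 2 * ?N) (at s within A)"
      by (rule DERIV_cong[OF DERIV_add[OF DERIV_power[OF b1, of 2] DERIV_power[OF d(2), of 2]]])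
        (simp add: distrib_left)
    have "((\<lambda>s. ln ((?b s)\<^sup>2 + (?y s)\<^sup>2) / 2) has_real_derivative 1 / ((?b s)\<^sup>2 + (?y s)\<^sup>2) * (2 * ?N) / 2) (at s within A)"
      by (rule DERIV_cdivide[OF DERIV_chain2[OF DERIV_ln_divide[OF den_pos] D]])
    moreover have "1 / a * (2 * b) / 2 = b / a" for a b :: real by simp
    ultimately show ?thesis
      by (simp only: psi_def psi_s_def)
  qed
  have e: "inverse (1 + (y / b)\<^sup>2) * ((y' * b - y * b') / (b * b)) = (y' * b - y * b') / (b\<^sup>2 + y\<^sup>2)"
    if "b > 0" for y b y' b' :: real
  proof -
    have "1 + (y / b)\<^sup>2 = (b\<^sup>2 + y\<^sup>2) / b\<^sup>2"
      using that by (simp add: field_simps)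
    then show ?thesis
      using that by (simp add: power2_eq_square)
  qed
  have "((\<lambda>\<theta>. arctan (Im (G s \<theta>) / bend (X s \<theta>))) has_real_derivative
      inverse (1 + (Im (G s \<theta>) / bend (X s \<theta>))\<^sup>2) *
       ((Re (G1 s \<theta>) * bend (X s \<theta>) - Im (G s \<theta>) * (bend' (X s \<theta>) * - Im (G1 s \<theta>))) / (bend (X s \<theta>) * bend (X s \<theta>))))
      (at \<theta> within A)"
    by (rule DERIV_chain2[OF DERIV_arctan DERIV_divide[OF d(4) b2]]) (use bend_pos[of "X s \<theta>"] in simp)
  then show "((\<lambda>\<theta>. arctan (Im (G s \<theta>) / bend (X s \<theta>))) has_real_derivative eta_t s \<theta>) (at \<theta> within A)"
    unfolding e[OF bend_pos] by (simp add: eta_t_def algebra_simps)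
qed

lemma psi_cont:
  assumes f: "continuous_on A f" and g: "continuous_on A g" and lt: "\<And>x. x \<in> A \<Longrightarrow> f x < ln R"
  shows "continuous_on A (\<lambda>x. psi (f x) (g x))" "continuous_on A (\<lambda>x. psi_s (f x) (g x))"
    "continuous_on A (\<lambda>x. eta_t (f x) (g x))"
proof -
  note gc = G_cont'[OF assms]
  have re: "continuous_on A (\<lambda>x. Re (G1 (f x) (g x)))" "continuous_on A (\<lambda>x. Im (G1 (f x) (g x)))"
    "continuous_on A (\<lambda>x. Im (G (f x) (g x)))"
    using continuous_on_Re[OF gc(2)] continuous_on_Im[OF gc(2)] continuous_on_Im[OF gc(1)] by auto
  have cX: "continuous_on A (\<lambda>x. X (f x) (g x))"
    unfolding X_def by (intro continuous_on_diff continuous_on_Re continuous_on_const gc)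
  have b: "continuous_on A (\<lambda>x. bend (X (f x) (g x)))" "continuous_on A (\<lambda>x. bend' (X (f x) (g x)))"
    by (rule continuous_on_compose2[OF bend_cont cX] continuous_on_compose2[OF bend'_cont cX], simp)+
  have den: "continuous_on A (\<lambda>x. (bend (X (f x) (g x)))\<^sup>2 + (Im (G (f x) (g x)))\<^sup>2)"
    by (intro continuous_on_add continuous_on_power b re)
  have nz: "bend x \<noteq> 0" for x
    by (metis bend_pos less_irrefl)
  show "continuous_on A (\<lambda>x. psi (f x) (g x))"
    unfolding psi_def by (intro continuous_on_divide continuous_on_ln continuous_on_const den) (auto simp: nz)
  show "continuous_on A (\<lambda>x. psi_s (f x) (g x))"
    unfolding psi_s_def by (intro continuous_on_divide continuous_on_add continuous_on_mult b re den) (auto simp: nz)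
  show "continuous_on A (\<lambda>x. eta_t (f x) (g x))"
    unfolding eta_t_def by (intro continuous_on_divide continuous_on_add continuous_on_mult b re den) (auto simp: nz)
qed

lemma psi_slice:
  assumes "s < ln R"
  shows "continuous_on A (psi s)" "continuous_on A (psi_s s)" "continuous_on A (eta_t s)"
  by (rule psi_cont[of A "\<lambda>_. s" "\<lambda>\<theta>. \<theta>", OF continuous_on_const continuous_on_id], rule assms)+

lemma kern_slice:
  assumes "s < ln R"
  shows "continuous_on A (kern s)"
  using continuous_on_diff[OF psi_slice(2,3)[OF assms]] by (simp add: kern_eq[abs_def])

text \<open>Since \<open>bend\<close> is positive, the arctangent is a single-valued argument and
  \<open>eta_t\<close> integrates to zero over a period. Subtracting it turns the derivative of the
  mean into the integral of \<open>kern\<close>.\<close>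

lemma T_deriv:
  assumes "s < ln R"
  shows "(T has_real_derivative integral period (kern s)) (at s)"
proof -
  have "((\<lambda>s. integral (cbox (-pi/4) (7*pi/4)) (psi s)) has_real_derivative
      integral (cbox (-pi/4) (7*pi/4)) (psi_s s)) (at s within {..<ln R})"
  proof (rule leibniz_rule_field_derivative)
    show "continuous_on ({..<ln R} \<times> cbox (-pi/4) (7*pi/4)) (\<lambda>(s, \<theta>). psi_s s \<theta>)"
      unfolding split_beta by (rule psi_cont(2)) (auto intro: continuous_on_fst continuous_on_snd continuous_on_id)
    show "psi s integrable_on cbox (-pi/4) (7*pi/4)" if "s \<in> {..<ln R}" for s
      using that by (intro integrable_continuous psi_slice) auto
  qed (use assms in \<open>auto intro: psi_deriv\<close>)
  then have "((\<lambda>s. integral (cbox (-pi/4) (7*pi/4)) (psi s)) has_real_derivative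
      integral (cbox (-pi/4) (7*pi/4)) (psi_s s)) (at s)"
    using assms by (subst (asm) at_within_open) auto
  then have 1: "(T has_real_derivative integral period (psi_s s)) (at s)"
    by (simp add: T_def[abs_def] cbox_interval)
  have int: "psi_s s integrable_on period" "eta_t s integrable_on period"
    using assms by (intro integrable_continuous_real psi_slice; simp)+
  let ?\<eta> = "\<lambda>\<theta>. arctan (Im (G s \<theta>) / bend (X s \<theta>))"
  have "(eta_t s has_integral ?\<eta> (7*pi/4) - ?\<eta> (-pi/4)) period"
    by (rule fundamental_theorem_of_calculus)
      (auto intro: psi_deriv assms simp flip: has_real_derivative_iff_has_vector_derivative)
  moreover have "?\<eta> (7*pi/4) = ?\<eta> (-pi/4)"
    using G_periodic(1)[of s "-pi/4"] by (simp add: X_def)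
  ultimately have "integral period (eta_t s) = 0"
    by (simp add: integral_unique)
  then have "integral period (kern s) = integral period (psi_s s)"
    unfolding kern_eq[abs_def] using int by (subst integral_diff) auto
  then show ?thesis using 1 by simp
qed

lemma G_le_den: "1 + (cmod (G s \<theta>))\<^sup>2 \<le> 8 * ((bend (X s \<theta>))\<^sup>2 + (Im (G s \<theta>))\<^sup>2)"
proof -
  let ?x = "X s \<theta>" and ?y = "Im (G s \<theta>)"
  have "((1 + \<bar>?x\<bar>) / 2)\<^sup>2 \<le> (bend ?x)\<^sup>2"
    by (intro power_mono bend_ge) auto
  then have "(1 + \<bar>?x\<bar>)\<^sup>2 \<le> 4 * (bend ?x)\<^sup>2"
    by (simp add: power_divide)
  moreover have "(Re (G s \<theta>))\<^sup>2 \<le> (1 + \<bar>?x\<bar>)\<^sup>2"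
    unfolding X_def by (rule power2_le_iff_abs_le[THEN iffD2]) auto
  moreover have "1 \<le> (1 + \<bar>?x\<bar>)\<^sup>2"
    by (rule one_le_power) simp
  ultimately show ?thesis
    unfolding cmod_power2 by (smt (verit) zero_le_power2)
qed

text \<open>The factor \<open>bend' - 1\<close> vanishes where \<open>Re G \<ge> 1\<close>.
  Elsewhere \<open>kern^2 \<le> 4 * E\<close> with \<open>E = 8 * |G1|^2 / (1 + |G|^2)\<close>, and
  \<open>kern \<le> \<mu> + kern^2 / (4 * \<mu>)\<close>. The free weight \<open>\<mu>\<close> is
  Cauchy-Schwarz in a linear form, which can be integrated before \<open>\<mu>\<close> is
  chosen.\<close>

lemma kern_bound:
  assumes "0 < \<mu>"
  shows "kern s \<theta> \<le> \<mu> * indicator {\<theta>. Re (G s \<theta>) < 1} \<theta> + 8 * ((cmod (G1 s \<theta>))\<^sup>2 / (1 + (cmod (G s \<theta>))\<^sup>2)) / \<mu>"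
proof (cases "Re (G s \<theta>) < 1")
  case True
  let ?b = "bend (X s \<theta>)" and ?y = "Im (G s \<theta>)" and ?p = "Re (G1 s \<theta>)" and ?q = "Im (G1 s \<theta>)"
  let ?d = "?b\<^sup>2 + ?y\<^sup>2"
  have d: "0 < ?d" by (rule den_pos)
  have "(?b * ?p - ?y * ?q)\<^sup>2 \<le> ?d * (cmod (G1 s \<theta>))\<^sup>2"
  proof -
    have "?d * (cmod (G1 s \<theta>))\<^sup>2 - (?b * ?p - ?y * ?q)\<^sup>2 = (?b * ?q + ?y * ?p)\<^sup>2"
      unfolding cmod_power2 by (simp add: power2_eq_square algebra_simps)
    then show ?thesis by (smt (verit) zero_le_power2)
  qed
  moreover have "(bend' (X s \<theta>) - 1)\<^sup>2 \<le> 4"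
    using power_mono[OF bend'_bound(1)[of "X s \<theta>"], of 2] by simp
  ultimately have "((bend' (X s \<theta>) - 1) * (?b * ?p - ?y * ?q))\<^sup>2 \<le> 4 * (?d * (cmod (G1 s \<theta>))\<^sup>2)"
    unfolding power_mult_distrib by (intro mult_mono) auto
  then have "(kern s \<theta>)\<^sup>2 \<le> 4 * (?d * (cmod (G1 s \<theta>))\<^sup>2) / ?d\<^sup>2"
    unfolding kern_def power_divide by (rule divide_right_mono) simp
  also have "\<dots> = 4 * (cmod (G1 s \<theta>))\<^sup>2 / ?d"
    using d by (simp add: power2_eq_square)
  also have "\<dots> \<le> 4 * (cmod (G1 s \<theta>))\<^sup>2 / ((1 + (cmod (G s \<theta>))\<^sup>2) / 8)"
    using G_le_den[of s \<theta>] by (intro divide_left_mono) (auto intro!: mult_pos_pos d divide_pos_pos add_pos_nonneg)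
  finally have k2: "(kern s \<theta>)\<^sup>2 \<le> 4 * (8 * ((cmod (G1 s \<theta>))\<^sup>2 / (1 + (cmod (G s \<theta>))\<^sup>2)))"
    by simp
  have "0 \<le> (2 * \<mu> - kern s \<theta>)\<^sup>2" by simp
  then have "4 * \<mu> * kern s \<theta> \<le> 4 * \<mu> * \<mu> + (kern s \<theta>)\<^sup>2"
    by (simp add: power2_eq_square algebra_simps)
  also have "\<dots> \<le> 4 * \<mu> * (\<mu> + 8 * ((cmod (G1 s \<theta>))\<^sup>2 / (1 + (cmod (G s \<theta>))\<^sup>2)) / \<mu>)"
    using k2 assms by (simp add: distrib_left)
  finally have "kern s \<theta> \<le> \<mu> + 8 * ((cmod (G1 s \<theta>))\<^sup>2 / (1 + (cmod (G s \<theta>))\<^sup>2)) / \<mu>"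
    using assms by (simp only: mult_le_cancel_left_pos)
  then show ?thesis using True by simp
next
  case False
  then have "kern s \<theta> = 0"
    by (simp add: kern_def bend'_bound(2) X_def)
  moreover have "0 \<le> 8 * ((cmod (G1 s \<theta>))\<^sup>2 / (1 + (cmod (G s \<theta>))\<^sup>2)) / \<mu>"
    using assms by (intro divide_nonneg_pos mult_nonneg_nonneg divide_nonneg_nonneg add_nonneg_nonneg) auto
  ultimately show ?thesis
    using False by (simp only: indicator_def mem_Collect_eq of_bool_eq mult_zero_right add_0_left)
qed

text \<open>\<open>L.M\<close> measures the size of \<open>W\<close>: it bounds
  \<open>ln (1 + |W|^2)\<close> pointwise through \<open>le_M\<close>, and is itself at most
  \<open>2 * T + 25\<close>. The summand 1 keeps it positive even if \<open>W\<close> vanishes at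
  the centre.\<close>

sublocale L: subharmonic_mean W R "\<lambda>t. 1 + ln (1 + t)" "\<lambda>t. 1 / (1 + t)" "\<lambda>t. - 1 / (1 + t)\<^sup>2"
proof unfold_locales
  fix t :: real
  assume "t \<ge> 0"
  then show "((\<lambda>t. 1 + ln (1 + t)) has_real_derivative 1 / (1 + t)) (at t)"
    and "((\<lambda>t. 1 / (1 + t)) has_real_derivative - 1 / (1 + t)\<^sup>2) (at t)"
    by (auto intro!: derivative_eq_intros simp: power2_eq_square)
  have "t * (1 / (1 + t)\<^sup>2) \<le> 1 / (1 + t)"
    using \<open>t \<ge> 0\<close> by (simp add: divide_le_eq power2_eq_square)
  then show "0 \<le> 1 / (1 + t) + t * (- 1 / (1 + t)\<^sup>2)"
    by simp
qed (auto intro!: continuous_intros)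

text \<open>For \<open>ln (1 + t)\<close> itself the left-hand density would only be
  \<open>1 / (1 + t)^2\<close>. Squaring raises it to order \<open>1 / (1 + t)\<close>, the weight
  that \<open>kern_bound\<close> asks for, and the summand 1 keeps it away from zero near
  \<open>t = 0\<close>.\<close>

lemma Q_sub:
  fixes t :: real
  assumes "t \<ge> 0"
  shows "2 / (1 + t) \<le> 2 * (1 + ln (1 + t)) / (1 + t) + t * (2 / (1 + t)\<^sup>2 - 2 * (1 + ln (1 + t)) / (1 + t)\<^sup>2)"
proof -
  have l: "0 \<le> ln (1 + t)" using assms by simp
  have "a / c + t * (b / c\<^sup>2 - d / c\<^sup>2) = (a * c + t * (b - d)) / c\<^sup>2" if "c \<noteq> 0" for a b c d :: real
    using that by (simp add: power2_eq_square field_simps)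
  from this[of "1 + t" "2 * (1 + ln (1 + t))" 2 "2 * (1 + ln (1 + t))"]
  have "2 * (1 + ln (1 + t)) / (1 + t) + t * (2 / (1 + t)\<^sup>2 - 2 * (1 + ln (1 + t)) / (1 + t)\<^sup>2)
      = (2 * (1 + ln (1 + t)) * (1 + t) + t * (2 - 2 * (1 + ln (1 + t)))) / (1 + t)\<^sup>2"
    using assms by simp
  also have "2 * (1 + ln (1 + t)) * (1 + t) + t * (2 - 2 * (1 + ln (1 + t))) = 2 * (1 + t) + 2 * ln (1 + t)"
    by (simp add: algebra_simps)
  finally have "2 * (1 + ln (1 + t)) / (1 + t) + t * (2 / (1 + t)\<^sup>2 - 2 * (1 + ln (1 + t)) / (1 + t)\<^sup>2)
      = (2 * (1 + t) + 2 * ln (1 + t)) / (1 + t)\<^sup>2" .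
  moreover have "2 / (1 + t) = 2 * (1 + t) / (1 + t)\<^sup>2"
    unfolding power2_eq_square using assms by (intro nonzero_mult_divide_mult_cancel_right[symmetric]) auto
  ultimately show ?thesis
    using l by (simp add: divide_right_mono)
qed

sublocale Q: subharmonic_mean W R "\<lambda>t. (1 + ln (1 + t))\<^sup>2" "\<lambda>t. 2 * (1 + ln (1 + t)) / (1 + t)"
    "\<lambda>t. 2 / (1 + t)\<^sup>2 - 2 * (1 + ln (1 + t)) / (1 + t)\<^sup>2"
proof unfold_locales
  fix t :: real
  assume t: "t \<ge> 0"
  then show "((\<lambda>t. (1 + ln (1 + t))\<^sup>2) has_real_derivative 2 * (1 + ln (1 + t)) / (1 + t)) (at t)"
    by (auto intro!: derivative_eq_intros)
  have 1: "((\<lambda>t. 2 * (1 + ln (1 + t))) has_real_derivative 2 / (1 + t)) (at t)"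
    using t by (auto intro!: derivative_eq_intros)
  have 2: "((\<lambda>t. 1 + t) has_real_derivative 1) (at t)"
    by (auto intro!: derivative_eq_intros)
  have "2 / (1 + t) * (1 + t) = 2"
    unfolding times_divide_eq_left using t by (intro nonzero_mult_div_cancel_right) auto
  moreover have "1 + t \<noteq> 0"
    using t by simp
  ultimately show "((\<lambda>t. 2 * (1 + ln (1 + t)) / (1 + t)) has_real_derivative 2 / (1 + t)\<^sup>2 - 2 * (1 + ln (1 + t)) / (1 + t)\<^sup>2) (at t)"
    using DERIV_divide[OF 1 2] by (simp only: power2_eq_square diff_divide_distrib mult_1_right not_False_eq_True simp_thms)
  show "0 \<le> 2 * (1 + ln (1 + t)) / (1 + t) + t * (2 / (1 + t)\<^sup>2 - 2 * (1 + ln (1 + t)) / (1 + t)\<^sup>2)"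
    using t by (intro order_trans[OF _ Q_sub]) auto
qed (auto intro!: continuous_intros)

lemma v_eq: "L.v s \<theta> = (cmod (G s \<theta>))\<^sup>2" "Q.v s \<theta> = (cmod (G s \<theta>))\<^sup>2"
  by (simp_all add: L.v_def Q.v_def)

text \<open>\<open>G_le_den\<close> costs \<open>ln 8 \<le> 25/12\<close>, hence
  \<open>37/12 = 1 + 25/12\<close> pointwise, and a period is shorter than 8.\<close>

lemma L_le_T:
  assumes "s < ln R"
  shows "L.M s \<le> 2 * T s + 25"
proof -
  have "L.M s \<le> integral period (\<lambda>\<theta>. 2 * psi s \<theta> + 37/12)"
    unfolding L.M_def
  proof (rule integral_le)
    show "(\<lambda>\<theta>. 1 + ln (1 + L.v s \<theta>)) integrable_on period"
      using assms by (intro integrable_continuous_real L.cont_slice)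
    show "(\<lambda>\<theta>. 2 * psi s \<theta> + 37/12) integrable_on period"
      using assms by (intro integrable_continuous_real continuous_on_add continuous_on_mult continuous_on_const psi_slice)
    fix \<theta>
    let ?d = "(bend (X s \<theta>))\<^sup>2 + (Im (G s \<theta>))\<^sup>2"
    have "0 < 1 + (cmod (G s \<theta>))\<^sup>2"
      by (intro add_pos_nonneg) auto
    then have "ln (1 + (cmod (G s \<theta>))\<^sup>2) \<le> ln (8 * ?d)"
      using G_le_den[of s \<theta>] by (subst ln_le_cancel_iff) (auto intro!: mult_pos_pos den_pos)
    also have "\<dots> = ln 8 + ln ?d"
      using den_pos by (intro ln_mult_pos) auto
    also have "ln 8 = 3 * ln (2::real)"
      using ln_realpow[of 2 3] by simp
    also have "ln (2::real) \<le> 25/36"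
      by (rule ln2_le_25_over_36)
    finally show "1 + ln (1 + L.v s \<theta>) \<le> 2 * psi s \<theta> + 37/12"
      by (simp add: v_eq psi_def)
  qed
  also have "\<dots> = 2 * T s + 37/12 * (2 * pi)"
    using assms unfolding T_def
    by (subst integral_add) (auto intro!: integrable_continuous_real continuous_on_mult continuous_on_const psi_slice)
  also have "\<dots> \<le> 2 * T s + 25"
    using pi_less_4 by simp
  finally show ?thesis .
qed

lemma L_pos:
  assumes "s < ln R"
  shows "0 < L.M s"
proof -
  have "0 < 2 * pi * (1 + ln (1 + (cmod (W 0))\<^sup>2))"
    by (intro mult_pos_pos add_pos_nonneg ln_ge_zero) auto
  also have "\<dots> \<le> L.M s"
    by (rule L.M_ge_center[OF assms])
  finally show ?thesis .
qed

text \<open>Since \<open>Q.M1\<close> is nondecreasing, \<open>\<sigma> * Q.M1 b\<close> is at most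
  the growth of \<open>Q.M\<close> over a length \<open>\<sigma>\<close>. The mean of a square is at
  most supremum times mean, and a second length \<open>\<sigma>\<close> is spent on bounding the
  supremum by \<open>le_M\<close>.\<close>

lemma Q1_le:
  assumes \<sigma>: "0 < \<sigma>" "\<sigma> \<le> pi" and b: "b + 2 * \<sigma> < ln R"
  shows "Q.M1 b \<le> (L.M (b + 2 * \<sigma>))\<^sup>2 / \<sigma>\<^sup>2"
proof -
  let ?l = "\<lambda>\<theta>. 1 + ln (1 + (cmod (G (b + \<sigma>) \<theta>))\<^sup>2)"
  define c where "c = L.M (b + 2 * \<sigma>) / \<sigma>"
  have b1: "b + \<sigma> < ln R" "b < ln R"
    using \<sigma> b by auto
  have c: "?l \<theta> \<le> c" for \<theta>
    using L.le_M[of \<sigma> "b + \<sigma>" \<theta>] \<sigma> b by (simp add: c_def v_eq add.assoc)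
  have l0: "0 \<le> ?l \<theta>" for \<theta>
    by simp
  have "\<exists>z. b < z \<and> z < b + \<sigma> \<and> Q.M (b + \<sigma>) - Q.M b = (b + \<sigma> - b) * Q.M1 z"
    using \<sigma> b1 by (intro MVT2 Q.M_deriv) auto
  then obtain z where z: "b < z" "z < b + \<sigma>" "Q.M (b + \<sigma>) - Q.M b = \<sigma> * Q.M1 z"
    by auto
  have "0 \<le> Q.M b"
    unfolding Q.M_def using b1 by (intro integral_nonneg integrable_continuous_real Q.cont_slice) auto
  moreover have "\<sigma> * Q.M1 b \<le> \<sigma> * Q.M1 z"
    using z b1 \<sigma> by (intro mult_left_mono Q.M1_mono) auto
  ultimately have "\<sigma> * Q.M1 b \<le> Q.M (b + \<sigma>)"
    using z by linarith
  also have "Q.M (b + \<sigma>) \<le> integral period (\<lambda>\<theta>. c * ?l \<theta>)"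
    unfolding Q.M_def
  proof (rule integral_le)
    show "(\<lambda>\<theta>. (1 + ln (1 + Q.v (b + \<sigma>) \<theta>))\<^sup>2) integrable_on period"
      using b1 by (intro integrable_continuous_real Q.cont_slice)
    show "(\<lambda>\<theta>. c * ?l \<theta>) integrable_on period"
      using b1 L.cont_slice(1)[of "b + \<sigma>"]
      by (intro integrable_continuous_real continuous_on_mult continuous_on_const) (simp add: v_eq)
    show "(1 + ln (1 + Q.v (b + \<sigma>) \<theta>))\<^sup>2 \<le> c * ?l \<theta>" for \<theta>
      unfolding v_eq power2_eq_square[of "?l \<theta>"] by (rule mult_right_mono[OF c l0])
  qed
  also have "\<dots> = c * L.M (b + \<sigma>)"
    by (simp add: L.M_def v_eq)
  also have "\<dots> \<le> c * L.M (b + 2 * \<sigma>)"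
    using \<sigma> b L_pos[OF b] by (intro mult_left_mono L.M_mono) (auto simp: c_def)
  finally have "\<sigma> * Q.M1 b \<le> (L.M (b + 2 * \<sigma>))\<^sup>2 / \<sigma>"
    by (simp add: c_def power2_eq_square)
  then show ?thesis
    using \<sigma> by (simp add: field_simps power2_eq_square)
qed

section \<open>Area of the set \<open>Re W < 1\<close> in annuli\<close>

definition neg_region :: "real \<Rightarrow> real \<Rightarrow> complex set" where
  "neg_region a b = {z. exp a \<le> cmod z \<and> cmod z \<le> exp b \<and> Re (W z) < 1}"

lemma neg_region_borel:
  assumes "b < ln R"
  shows "neg_region a b \<in> fmeasurable lborel"
proof -
  have bR: "exp b < R"
    using assms R_pos exp_less_cancel_iff[of b "ln R"] by simp
  have "open (ball 0 R \<inter> (\<lambda>z. Re (W z)) -` {..<1})"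
    by (intro continuous_open_preimage continuous_on_Re holomorphic_on_imp_continuous_on[OF hol]) auto
  then have "(ball 0 R \<inter> (\<lambda>z. Re (W z)) -` {..<1}) \<inter> (cball 0 (exp b) - ball 0 (exp a)) \<in> sets borel"
    by auto
  also have "(ball 0 R \<inter> (\<lambda>z. Re (W z)) -` {..<1}) \<inter> (cball 0 (exp b) - ball 0 (exp a)) = neg_region a b"
    using bR by (auto simp: neg_region_def)
  finally have "neg_region a b \<in> sets lborel" by simp
  moreover have "emeasure lborel (neg_region a b) \<le> emeasure lborel (cball (0::complex) (exp b))"
    by (rule emeasure_mono) (auto simp: neg_region_def)
  ultimately show ?thesis
    using emeasure_lborel_cball_finite[of "0::complex" "exp b"] by (intro fmeasurableI) (auto intro: le_less_trans)
qed

definition low :: "real \<Rightarrow> real set" where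
  "low s = {\<theta>\<in>period. Re (G s \<theta>) < 1}"

lemma low_borel:
  assumes "s < ln R"
  shows "low s \<in> sets borel" "emeasure lborel (low s) < \<infinity>"
proof -
  have "continuous_on UNIV (G s)"
    using G_cont'(1)[of UNIV "\<lambda>_. s" "\<lambda>\<theta>. \<theta>"] assms by (simp add: continuous_on_id)
  then have "open {\<theta>. Re (G s \<theta>) < 1}"
    by (intro open_Collect_less continuous_on_Re continuous_on_const)
  then show "low s \<in> sets borel"
    unfolding low_def by (auto intro!: sets.sets_Collect_conj simp: Collect_conj_eq)
  show "emeasure lborel (low s) < \<infinity>"
    by (rule le_less_trans[OF emeasure_mono[of _ "period"]]) (auto simp: low_def)
qed

lemma kern_integral_le:
  assumes s: "s < ln R" and \<mu>: "0 < \<mu>"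
  shows "integral period (kern s)
      \<le> \<mu> * measure lborel (low s) + Q.D s / \<mu>"
proof -
  have "((\<lambda>\<theta>. if \<theta> \<in> low s then 1 else 0) has_integral measure lborel (low s)) period"
    using has_integral_measure_lborel[OF low_borel[OF s]] by (subst has_integral_restrict) (auto simp: low_def)
  then have 1: "((\<lambda>\<theta>. \<mu> * (if \<theta> \<in> low s then 1 else 0)) has_integral \<mu> * measure lborel (low s)) period"
    by (rule has_integral_mult_right)
  have 2: "((\<lambda>\<theta>. Q.lap s \<theta> / \<mu>) has_integral Q.D s / \<mu>) period"
    unfolding Q.D_def by (intro has_integral_divide integrable_integral integrable_continuous_real Q.cont_slice s)
  show ?thesis
  proof (rule has_integral_le[OF _ has_integral_add[OF 1 2]])
    show "(kern s has_integral integral period (kern s)) period"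
      using s by (intro integrable_integral integrable_continuous_real kern_slice)
    fix \<theta>
    assume \<theta>: "\<theta> \<in> period"
    let ?t = "(cmod (G s \<theta>))\<^sup>2"
    have "8 * ((cmod (G1 s \<theta>))\<^sup>2 / (1 + ?t)) = 4 * (2 / (1 + ?t)) * (cmod (G1 s \<theta>))\<^sup>2"
      by simp
    also have "\<dots> \<le> Q.lap s \<theta>"
      unfolding Q.lap_def v_eq by (intro mult_right_mono mult_left_mono Q_sub) auto
    finally have "8 * ((cmod (G1 s \<theta>))\<^sup>2 / (1 + ?t)) / \<mu> \<le> Q.lap s \<theta> / \<mu>"
      using \<mu> by (intro divide_right_mono) auto
    with kern_bound[OF \<mu>, of s \<theta>] \<theta>
    show "kern s \<theta> \<le> \<mu> * (if \<theta> \<in> low s then 1 else 0) + Q.lap s \<theta> / \<mu>"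
      by (auto simp: indicator_def low_def)
  qed
qed

text \<open>Fubini in polar coordinates, with the Jacobian \<open>exp (2 * s)\<close> bounded below
  by \<open>exp (2 * a)\<close>. The integral is obtained together with its existence, so that
  \<open>area_step\<close> can compare it with the integral of a derivative.\<close>

lemma section_integral:
  assumes ab: "a < b" "b < ln R"
  defines "N \<equiv> neg_region a b"
  obtains I where "((\<lambda>s. measure lborel (low s)) has_integral I) {a..b}"
    "exp (2 * a) * I \<le> measure lborel N"
proof -
  have N: "N \<in> sets borel" "emeasure lborel N < \<infinity>"
    unfolding N_def using neg_region_borel[OF ab(2)] by (auto simp: fmeasurable_def)
  note [measurable] = N(1)
  have [measurable]: "(\<lambda>x. exp x) \<in> borel_measurable (borel :: complex measure)"
    by (intro borel_measurable_continuous_onI continuous_intros)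
  define g where "g = (\<lambda>s. \<integral>\<^sup>+\<theta>. indicator N (exp (Complex s \<theta>)) * indicator period \<theta> \<partial>lborel)"
  have gm [measurable]: "g \<in> borel_measurable borel"
    unfolding g_def by measurable
  let ?m = "\<lambda>s. measure lborel (low s)"
  have gs: "g s = ennreal (?m s)" if "s \<in> {a..b}" for s
  proof -
    have s: "s < ln R" using that ab by auto
    have "g s = (\<integral>\<^sup>+\<theta>. indicator (low s) \<theta> \<partial>lborel)"
      unfolding g_def using that
      by (intro nn_integral_cong) (auto simp: N_def neg_region_def low_def G_def indicator_def)
    also have "\<dots> = emeasure lborel (low s)"
      using low_borel[OF s] by simp
    also have "\<dots> = ennreal (?m s)"
      using low_borel[OF s] by (intro emeasure_eq_ennreal_measure) auto
    finally show ?thesis .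
  qed
  have le: "ennreal (exp (2 * a)) * (\<integral>\<^sup>+s. g s * indicator {a..b} s \<partial>lborel) \<le> emeasure lborel N"
  proof -
    have "ennreal (exp (2 * a)) * (\<integral>\<^sup>+s. g s * indicator {a..b} s \<partial>lborel)
       = (\<integral>\<^sup>+s. ennreal (exp (2 * a)) * (g s * indicator {a..b} s) \<partial>lborel)"
      by (rule nn_integral_cmult[symmetric]) measurable
    also have "\<dots> \<le> (\<integral>\<^sup>+s. \<integral>\<^sup>+\<theta>. indicator N (exp (Complex s \<theta>)) * ennreal (exp (2 * s)) * indicator {a..b} s
          * indicator period \<theta> \<partial>lborel \<partial>lborel)"
    proof (rule nn_integral_mono)
      fix s :: real
      show "ennreal (exp (2 * a)) * (g s * indicator {a..b} s) \<le> (\<integral>\<^sup>+\<theta>. indicator N (exp (Complex s \<theta>)) * ennreal (exp (2 * s)) * indicator {a..b} s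
          * indicator period \<theta> \<partial>lborel)"
      proof (cases "s \<in> {a..b}")
        case True
        then have "ennreal (exp (2 * a)) * (g s * indicator {a..b} s) \<le> ennreal (exp (2 * s)) * g s"
          by (auto intro!: mult_right_mono ennreal_leI)
        also have "\<dots> = (\<integral>\<^sup>+\<theta>. ennreal (exp (2 * s)) * (indicator N (exp (Complex s \<theta>)) * indicator period \<theta>) \<partial>lborel)"
          unfolding g_def by (rule nn_integral_cmult[symmetric]) measurable
        also have "\<dots> = (\<integral>\<^sup>+\<theta>. indicator N (exp (Complex s \<theta>)) * ennreal (exp (2 * s)) * indicator {a..b} s
          * indicator period \<theta> \<partial>lborel)"
          using True by (intro nn_integral_cong) (simp add: mult_ac)
        finally show ?thesis .
      qed auto
    qed
    also have "\<dots> = (\<integral>\<^sup>+\<theta>. \<integral>\<^sup>+s. indicator N (exp (Complex s \<theta>)) * ennreal (exp (2 * s)) * indicator {a..b} s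
          * indicator period \<theta> \<partial>lborel \<partial>lborel)"
      by (rule lborel_pair.Fubini') measurable
    also have "\<dots> = (\<integral>\<^sup>+\<theta>. (\<integral>\<^sup>+s. indicator N (exp (Complex s \<theta>)) * ennreal (exp (2 * s)) * indicator {a..b} s \<partial>lborel)
          * indicator period \<theta> \<partial>lborel)"
      by (intro nn_integral_cong nn_integral_multc) measurable
    also have "\<dots> \<le> (\<integral>\<^sup>+z. indicator N z \<partial>lborel)"
      by (rule nn_integral_polar_le[OF _ ab(1)]) measurable
    finally show ?thesis by simp
  qed
  let ?J = "\<integral>\<^sup>+s. g s * indicator {a..b} s \<partial>lborel"
  have Jfin: "?J < \<infinity>"
  proof (rule ccontr)
    assume "\<not> ?J < \<infinity>"
    then have "?J = \<infinity>" by (simp flip: less_top)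
    then have "ennreal (exp (2 * a)) * ?J = \<infinity>"
      by (simp add: ennreal_mult_top)
    with le N(2) show False by simp
  qed
  define I where "I = enn2real ?J"
  have I: "?J = ennreal I" "0 \<le> I"
    using Jfin by (simp_all add: I_def less_top)
  have "((\<lambda>s. enn2real (g s * indicator {a..b} s)) has_integral I) UNIV"
  proof (rule nn_integral_has_integral)
    have "(\<integral>\<^sup>+s. ennreal (enn2real (g s * indicator {a..b} s)) \<partial>lborel) = ?J"
      by (intro nn_integral_cong) (auto simp: indicator_def gs)
    then show "(\<integral>\<^sup>+s. ennreal (enn2real (g s * indicator {a..b} s)) \<partial>lborel) = ennreal I"
      by (simp add: I)
  qed (use I in auto)
  moreover have "enn2real (g s * indicator {a..b} s) = (if s \<in> {a..b} then ?m s else 0)" for s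
    by (auto simp: gs)
  ultimately have "(?m has_integral I) {a..b}"
    by (simp only: has_integral_restrict_UNIV)
  moreover have "exp (2 * a) * I \<le> measure lborel N"
  proof -
    have "ennreal (exp (2 * a) * I) \<le> ennreal (measure lborel N)"
      using le N(2) I by (simp add: emeasure_eq_ennreal_measure ennreal_mult)
    then show ?thesis by simp
  qed
  ultimately show ?thesis
    by (rule that)
qed

text \<open>Integrating \<open>T' \<le> \<mu> * measure lborel (low s) + Q.D s / \<mu>\<close> over
  \<open>[a, b]\<close> gives \<open>T b - T a \<le> \<mu> * I + Q.M1 b / \<mu>\<close>, because
  \<open>Q.D\<close> is the derivative of the nonnegative \<open>Q.M1\<close>. The two lengths
  \<open>\<sigma>\<close> beyond \<open>b\<close> are those of \<open>Q1_le\<close>.\<close>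

lemma area_step:
  assumes ab: "a < b" and \<sigma>: "0 < \<sigma>" "\<sigma> \<le> pi" and b: "b + 2 * \<sigma> < ln R"
    and T: "T a < T b"
  shows "exp (2 * a) * \<sigma>\<^sup>2 * (T b - T a)\<^sup>2 / (4 * (2 * T (b + 2 * \<sigma>) + 25)\<^sup>2)
      \<le> measure lborel (neg_region a b)"
proof -
  have bR: "b < ln R" using \<sigma> b by simp
  obtain I where I: "((\<lambda>s. measure lborel (low s)) has_integral I) {a..b}"
    "exp (2 * a) * I \<le> measure lborel (neg_region a b)"
    using section_integral[OF ab bR] by blast
  define l where "l = L.M (b + 2 * \<sigma>)"
  have l: "0 < l" "l \<le> 2 * T (b + 2 * \<sigma>) + 25"
    using L_pos[OF b] L_le_T[OF b] by (auto simp: l_def)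
  define d where "d = T b - T a"
  have d: "0 < d" using T by (simp add: d_def)
  \<comment> \<open>With \<open>Q.M1 b \<le> l^2 / \<sigma>^2\<close> this makes the energy term at
    most \<open>d / 2\<close>; the other half of the growth has to come from the area.\<close>
  define \<mu> where "\<mu> = 2 * l\<^sup>2 / (\<sigma>\<^sup>2 * d)"
  have \<mu>: "0 < \<mu>" using l \<sigma> d by (simp add: \<mu>_def)
  have "((\<lambda>s. integral period (kern s) - Q.D s / \<mu>) has_integral
      (T b - Q.M1 b / \<mu>) - (T a - Q.M1 a / \<mu>)) {a..b}"
  proof (rule fundamental_theorem_of_calculus)
    fix s assume "s \<in> {a..b}"
    then have s: "s < ln R" using bR by auto
    have "((\<lambda>s. T s - Q.M1 s / \<mu>) has_real_derivative integral period (kern s) - Q.D s / \<mu>) (at s within {a..b})"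
      by (intro has_field_derivative_at_within[OF DERIV_diff[OF T_deriv DERIV_cdivide[OF Q.M1_deriv]]] s)
    then show "((\<lambda>s. T s - Q.M1 s / \<mu>) has_vector_derivative integral period (kern s) - Q.D s / \<mu>) (at s within {a..b})"
      by (simp add: has_real_derivative_iff_has_vector_derivative)
  qed (use ab in auto)
  then have "(T b - Q.M1 b / \<mu>) - (T a - Q.M1 a / \<mu>) \<le> \<mu> * I"
  proof (rule has_integral_le[OF _ has_integral_mult_right[OF I(1), of \<mu>]])
    fix s assume "s \<in> {a..b}"
    then have s: "s < ln R" using bR by auto
    show "integral period (kern s) - Q.D s / \<mu> \<le> \<mu> * measure lborel (low s)"
      using kern_integral_le[OF s \<mu>] by simp
  qed
  moreover have "0 \<le> Q.M1 a / \<mu>"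
    using \<mu> Q.M1_nonneg[of a] ab bR by simp
  ultimately have "d \<le> \<mu> * I + Q.M1 b / \<mu>"
    unfolding d_def by linarith
  also have "Q.M1 b / \<mu> \<le> (l\<^sup>2 / \<sigma>\<^sup>2) / \<mu>"
    using Q1_le[OF \<sigma> b] \<mu> by (intro divide_right_mono) (auto simp: l_def)
  also have "\<dots> = d / 2"
    using l \<sigma> d by (simp add: \<mu>_def field_simps)
  finally have "d / 2 \<le> \<mu> * I" by simp
  also have "\<dots> = 2 * l\<^sup>2 * I / (\<sigma>\<^sup>2 * d)"
    by (simp add: \<mu>_def)
  finally have "d / 2 * (\<sigma>\<^sup>2 * d) \<le> 2 * l\<^sup>2 * I"
    using \<sigma> d by (simp add: pos_le_divide_eq)
  then have "\<sigma>\<^sup>2 * d\<^sup>2 \<le> 4 * l\<^sup>2 * I"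
    by (simp add: power2_eq_square mult_ac)
  then have 1: "\<sigma>\<^sup>2 * d\<^sup>2 / (4 * l\<^sup>2) \<le> I"
    using l by (simp add: pos_divide_le_eq mult_ac)
  have "\<sigma>\<^sup>2 * d\<^sup>2 / (4 * (2 * T (b + 2 * \<sigma>) + 25)\<^sup>2) \<le> \<sigma>\<^sup>2 * d\<^sup>2 / (4 * l\<^sup>2)"
    using l by (intro divide_left_mono mult_left_mono power_mono) auto
  with 1 have "\<sigma>\<^sup>2 * d\<^sup>2 / (4 * (2 * T (b + 2 * \<sigma>) + 25)\<^sup>2) \<le> I"
    by linarith
  then have "exp (2 * a) * (\<sigma>\<^sup>2 * d\<^sup>2 / (4 * (2 * T (b + 2 * \<sigma>) + 25)\<^sup>2)) \<le> exp (2 * a) * I"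
    by (intro mult_left_mono) auto
  with I(2) show ?thesis
    unfolding d_def by (simp add: mult.assoc)
qed

text \<open>Adjacent closed annuli meet in a circle, which is a null set.\<close>

lemma neg_region_add:
  assumes "a \<le> b" "b \<le> c" "c < ln R"
  shows "measure lborel (neg_region a b) + measure lborel (neg_region b c) \<le> measure lborel (neg_region a c)"
proof -
  have m: "neg_region a b \<in> fmeasurable lborel" "neg_region b c \<in> fmeasurable lborel" "neg_region a c \<in> fmeasurable lborel"
    using assms by (auto intro!: neg_region_borel)
  have "measure lborel (neg_region a b \<inter> neg_region b c) \<le> measure lborel (sphere (0::complex) (exp b))"
  proof (rule measure_mono_fmeasurable)
    show "sphere (0::complex) (exp b) \<in> fmeasurable lborel"
      by (rule fmeasurableI_null_sets) (use negligible_sphere in \<open>auto simp: negligible_iff_null_sets null_sets_completion_iff\<close>)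
    show "neg_region a b \<inter> neg_region b c \<in> sets lborel"
      using m[THEN fmeasurableD] by (intro sets.Int) auto
    show "neg_region a b \<inter> neg_region b c \<subseteq> sphere 0 (exp b)"
      by (auto simp: neg_region_def)
  qed
  also have "\<dots> = 0"
    using negligible_imp_measure0[OF negligible_sphere, of "0::complex" "exp b"] by simp
  finally have "measure lborel (neg_region a b \<inter> neg_region b c) \<le> 0" .
  moreover have "measure lborel (neg_region a b \<union> neg_region b c) \<le> measure lborel (neg_region a c)"
  proof (rule measure_mono_fmeasurable)
    show "neg_region a b \<union> neg_region b c \<subseteq> neg_region a c"
    proof -
      have "exp a \<le> exp b" "exp b \<le> exp c" using assms by simp_all
      then show ?thesis
        by (auto simp: neg_region_def simp del: exp_le_cancel_iff intro: order_trans)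
    qed
    show "neg_region a b \<union> neg_region b c \<in> sets lborel"
      using m[THEN fmeasurableD] by (intro sets.Un) auto
  qed (use m in auto)
  moreover have "measure lborel (neg_region a b \<union> neg_region b c)
      = measure lborel (neg_region a b) + measure lborel (neg_region b c) - measure lborel (neg_region a b \<inter> neg_region b c)"
    by (rule measure_Un3) (use m in auto)
  ultimately show ?thesis by linarith
qed

text \<open>\<open>S j\<close> is the first time at which \<open>T\<close> reaches
  \<open>8 * 2 ^ j\<close>. From \<open>S j\<close> to \<open>S (j + 1)\<close> the means double,
  and up to \<open>S (j + 2)\<close> they stay below twice that, so \<open>area_step\<close> bounds
  the area in the first annulus by the squared length of the second interval. These fewer than
  \<open>K\<close> lengths add up to at least \<open>q - r\<close>, because
  \<open>S 1 \<le> r\<close>.\<close>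

lemma neg_region_ge:
  assumes q: "q < ln R" "q - p \<le> 60" and r: "p \<le> r" "r \<le> q"
    and Tp: "T p \<le> 8" and Tr: "16 \<le> T r"
    and Tle: "\<And>s. p \<le> s \<Longrightarrow> s \<le> q \<Longrightarrow> T s < 8 * 2 ^ K"
  shows "exp (2 * p) * (q - r)\<^sup>2 / 800000 \<le> K * measure lborel (neg_region p q)"
proof -
  have cont: "continuous_on {p..q} T"
    using q(1) by (intro DERIV_continuous_on[OF has_field_derivative_at_within[OF T_deriv]]) auto
  define P where "P = (\<lambda>j s. s \<in> {p..q} \<and> T s = 8 * 2 ^ j \<and> (\<forall>u. p \<le> u \<and> u < s \<longrightarrow> T u < 8 * 2 ^ j))"
  \<comment> \<open>The last level reached. It is at least 1 since \<open>T r \<ge> 16\<close>, and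
    less than \<open>K\<close> by the upper bound on \<open>T\<close>.\<close>
  define m where "m = Max {j. \<exists>s\<in>{p..q}. 8 * 2 ^ j \<le> T s}"
  have le_K: "j < K" if "\<exists>s\<in>{p..q}. 8 * 2 ^ j \<le> T s" for j
  proof -
    from that obtain s where "p \<le> s" "s \<le> q" "8 * 2 ^ j \<le> T s" by auto
    then have "(8::real) * 2 ^ j < 8 * 2 ^ K"
      using Tle by (meson le_less_trans)
    then show ?thesis by simp
  qed
  then have "{j. \<exists>s\<in>{p..q}. 8 * 2 ^ j \<le> T s} \<subseteq> {..<K}"
    by blast
  then have fin: "finite {j. \<exists>s\<in>{p..q}. 8 * 2 ^ j \<le> T s}"
    by (rule finite_subset) simp
  have ne: "1 \<in> {j. \<exists>s\<in>{p..q}. 8 * 2 ^ j \<le> T s}"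
    by (intro CollectI bexI[of _ r]) (use Tr r in simp_all)
  have "{j. \<exists>s\<in>{p..q}. 8 * 2 ^ j \<le> T s} \<noteq> {}"
    using ne by blast
  then have m: "m \<in> {j. \<exists>s\<in>{p..q}. 8 * 2 ^ j \<le> T s}" "1 \<le> m"
    unfolding m_def by (rule Max_in[OF fin]) (rule Max_ge[OF fin ne])
  have mK: "m < K" using m(1) le_K by blast
  have up: "T s < 8 * 2 ^ Suc m" if "s \<in> {p..q}" for s
  proof (rule ccontr)
    assume "\<not> T s < 8 * 2 ^ Suc m"
    then have "Suc m \<in> {j. \<exists>s\<in>{p..q}. 8 * 2 ^ j \<le> T s}"
      using that by (intro CollectI bexI[of _ s]) auto
    from Max_ge[OF fin this] show False by (simp add: m_def)
  qed
  have exP: "\<exists>s. P j s" if "j \<le> m" for j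
  proof -
    obtain w where w: "w \<in> {p..q}" "8 * 2 ^ m \<le> T w" using m by auto
    have "(8::real) * 2 ^ j \<le> 8 * 2 ^ m" using that by simp
    then have "8 * 2 ^ j \<le> T w" using w(2) by linarith
    moreover have "T p \<le> 8 * 2 ^ j" using Tp one_le_power[of "2::real" j] by linarith
    ultimately obtain s where "s \<in> {p..w}" "T s = 8 * 2 ^ j" "\<And>u. p \<le> u \<Longrightarrow> u < s \<Longrightarrow> T u < 8 * 2 ^ j"
      using first_hit[OF cont _ w(1)] by metis
    then show ?thesis using w by (intro exI[of _ s]) (auto simp: P_def)
  qed
  \<comment> \<open>After the last level the sequence is continued by \<open>q\<close>, so that the
    final interval, on which \<open>T\<close> need not double, also counts.\<close>
  define S where "S = (\<lambda>j. if j \<le> m then (SOME s. P j s) else q)"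
  have S: "P j (S j)" if "j \<le> m" for j
    using someI_ex[OF exP[OF that]] that by (simp add: S_def)
  have Sm: "S (Suc m) = q" by (simp add: S_def)
  have Spq: "S j \<in> {p..q}" for j
    using S[of j] r by (cases "j \<le> m") (auto simp: P_def S_def)
  have inc: "S j < S (Suc j)" if "Suc j \<le> m" for j
  proof (rule ccontr)
    assume "\<not> S j < S (Suc j)"
    then consider "S (Suc j) < S j" | "S (Suc j) = S j" by linarith
    then have "T (S (Suc j)) \<le> 8 * 2 ^ j"
      using S[of j] S[of "Suc j"] that by cases (auto simp: P_def intro: less_imp_le)
    then show False
      using S[OF that] by (simp add: P_def)
  qed
  have inc': "S j \<le> S (Suc j)" for j
    using inc[of j] Spq[of j] by (cases "Suc j \<le> m") (auto simp: S_def)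
  have step: "exp (2 * p) * (S (j + 2) - S (j + 1))\<^sup>2 / 800000 \<le> measure lborel (neg_region (S j) (S (Suc j)))"
    if "j < m" for j
  proof (cases "S (j + 1) < S (j + 2)")
    case True
    \<comment> \<open>The divisor 40 serves two conditions: \<open>S (j + 1) + 2 * \<sigma>\<close>
      stays before \<open>S (j + 2)\<close>, and
      \<open>\<sigma> \<le> 60 / 40 \<le> pi\<close>.\<close>
    define \<sigma> where "\<sigma> = (S (j + 2) - S (j + 1)) / 40"
    have \<sigma>: "0 < \<sigma>" "\<sigma> \<le> pi"
      using True Spq[of "j + 1"] Spq[of "j + 2"] q(2) pi_gt3 by (auto simp: \<sigma>_def)
    define c where "c = S (Suc j) + 2 * \<sigma>"
    have c: "c < S (j + 2)" using True by (simp add: c_def \<sigma>_def field_simps)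
    have cR: "c < ln R" using c Spq[of "j + 2"] q by auto
    have cpq: "c \<in> {p..q}" using c Spq[of "j + 2"] Spq[of "Suc j"] \<sigma> by (auto simp: c_def)
    have "T c < 8 * 2 ^ (j + 2)"
    proof (cases "j + 2 \<le> m")
      case True
      then show ?thesis using S[OF True] c cpq by (auto simp: P_def)
    next
      case False
      then have "Suc m = j + 2" using that by simp
      then show ?thesis using up[OF cpq] by simp
    qed
    then have "T c < 32 * 2 ^ j"
      by (simp add: power_add)
    then have Tc: "2 * T c + 25 \<le> 89 * 2 ^ j"
      using one_le_power[of "2::real" j] by linarith
    have "0 < 2 * T c + 25"
      using L_pos[OF cR] L_le_T[OF cR] by linarith
    then have sq: "(2 * T c + 25)\<^sup>2 \<le> (89 * 2 ^ j)\<^sup>2"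
      using Tc by (intro power_mono) auto
    have TS: "T (S j) = 8 * 2 ^ j" "T (S (Suc j)) = 8 * 2 ^ Suc j"
      using S[of j] S[of "Suc j"] that by (auto simp: P_def)
    have "exp (2 * p) * (S (j + 2) - S (j + 1))\<^sup>2 / 800000 \<le> exp (2 * S j) * \<sigma>\<^sup>2 * (1/500)"
    proof -
      have "exp (2 * p) * (\<sigma>\<^sup>2 * (1/500)) \<le> exp (2 * S j) * (\<sigma>\<^sup>2 * (1/500))"
        using Spq[of j] by (intro mult_right_mono) auto
      then show ?thesis by (simp add: \<sigma>_def power_divide)
    qed
    also have "\<dots> \<le> exp (2 * S j) * \<sigma>\<^sup>2 * ((T (S (Suc j)) - T (S j))\<^sup>2 / (4 * (2 * T c + 25)\<^sup>2))"
    proof (intro mult_left_mono)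
      \<comment> \<open>\<open>T c < 32 * 2 ^ j\<close> gives the 89 as \<open>64 + 25\<close>, and
        \<open>8^2 / (4 * 89^2) \<ge> 1/500\<close>. Together with the 40 in \<open>\<sigma>\<close>
        this yields \<open>40^2 * 500 = 800000\<close>.\<close>
      have "1/500 \<le> (8 * 2 ^ j)\<^sup>2 / (4 * (89 * 2 ^ j)\<^sup>2 :: real)"
        by (simp add: power_mult_distrib)
      also have "\<dots> \<le> (8 * 2 ^ j)\<^sup>2 / (4 * (2 * T c + 25)\<^sup>2)"
        using sq \<open>0 < 2 * T c + 25\<close> by (intro divide_left_mono mult_left_mono) auto
      finally show "1/500 \<le> (T (S (Suc j)) - T (S j))\<^sup>2 / (4 * (2 * T c + 25)\<^sup>2)"
        by (simp add: TS)
    qed auto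
    also have "\<dots> \<le> measure lborel (neg_region (S j) (S (Suc j)))"
      using area_step[of "S j" "S (Suc j)" \<sigma>] inc[of j] that \<sigma> cR TS
      unfolding c_def times_divide_eq_right by simp
    finally show ?thesis .
  next
    case False
    then show ?thesis using inc'[of "j + 1"] by simp
  qed
  have tele: "(\<Sum>j<k. measure lborel (neg_region (S j) (S (Suc j)))) \<le> measure lborel (neg_region p (S k))" for k
  proof (induction k)
    case (Suc k)
    have "(\<Sum>j<Suc k. measure lborel (neg_region (S j) (S (Suc j))))
        \<le> measure lborel (neg_region p (S k)) + measure lborel (neg_region (S k) (S (Suc k)))"
      using Suc by simp
    also have "\<dots> \<le> measure lborel (neg_region p (S (Suc k)))"
      using Spq[of k] Spq[of "Suc k"] inc'[of k] q by (intro neg_region_add) auto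
    finally show ?case .
  qed simp
  have S1: "S 1 \<le> r"
  proof (rule ccontr)
    assume "\<not> S 1 \<le> r"
    then have "T r < 8 * 2 ^ 1"
      using S[OF m(2)] r unfolding P_def by (metis not_le)
    with Tr show False by simp
  qed
  have "(q - r)\<^sup>2 \<le> (q - S 1)\<^sup>2"
    using S1 r by (intro power_mono) auto
  also have "q - S 1 = (\<Sum>j<m. S (j + 2) - S (j + 1))"
    using sum_lessThan_telescope[of "\<lambda>j. S (Suc j)" m] Sm by (simp add: numeral_2_eq_2)
  also have "(\<dots>)\<^sup>2 \<le> (\<Sum>j<m. (S (j + 2) - S (j + 1))\<^sup>2) * card {..<m}"
    by (rule sum_squared_le_sum_of_squares)
  finally have "(q - r)\<^sup>2 \<le> (\<Sum>j<m. (S (j + 2) - S (j + 1))\<^sup>2) * m" by simp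
  then have "exp (2 * p) * (q - r)\<^sup>2 / 800000 \<le> exp (2 * p) * ((\<Sum>j<m. (S (j + 2) - S (j + 1))\<^sup>2) * m) / 800000"
    by (intro divide_right_mono mult_left_mono) auto
  also have "\<dots> = m * (\<Sum>j<m. exp (2 * p) * (S (j + 2) - S (j + 1))\<^sup>2 / 800000)"
    by (simp add: sum_distrib_left sum_distrib_right sum_divide_distrib mult_ac)
  also have "\<dots> \<le> m * (\<Sum>j<m. measure lborel (neg_region (S j) (S (Suc j))))"
    using step by (intro mult_left_mono sum_mono) auto
  also have "\<dots> \<le> m * measure lborel (neg_region p (S m))"
    using tele by (intro mult_left_mono) auto
  also have "\<dots> \<le> m * measure lborel (neg_region p q)"
  proof (intro mult_left_mono measure_mono_fmeasurable neg_region_borel q)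
    show "neg_region p (S m) \<subseteq> neg_region p q"
    proof -
      have "exp (S m) \<le> exp q" using Spq[of m] by simp
      then show ?thesis
        by (auto simp: neg_region_def simp del: exp_le_cancel_iff intro: order_trans)
    qed
    show "neg_region p (S m) \<in> sets lborel"
      using neg_region_borel[of "S m" p] Spq[of m] q by (auto simp: fmeasurableD)
  qed auto
  also have "\<dots> \<le> K * measure lborel (neg_region p q)"
    using mK by (intro mult_right_mono) auto
  finally show ?thesis .
qed

text \<open>The squared modulus is at most \<open>5 * exp (2 * x)\<close>, and
  \<open>5 \<le> exp 2\<close>; the 8 again bounds the length of a period. With \<open>x = 0\<close>
  it gives the starting level 8, with larger \<open>x\<close> the number of doublings.\<close>

lemma T_le:
  assumes s: "s < ln R" and x: "0 \<le> x" and B: "\<And>z. cmod z = exp s \<Longrightarrow> cmod (W z - 1) \<le> exp x"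
  shows "T s \<le> 8 * (1 + x)"
proof -
  have "T s \<le> integral period (\<lambda>_. 1 + x)"
    unfolding T_def
  proof (rule integral_le)
    show "psi s integrable_on period"
      using s by (intro integrable_continuous_real psi_slice)
    fix \<theta>
    have w: "cmod (G s \<theta> - 1) \<le> exp x"
      unfolding G_def by (rule B) simp
    have "\<bar>X s \<theta>\<bar> \<le> exp x" "\<bar>Im (G s \<theta>)\<bar> \<le> exp x"
      using w abs_Re_le_cmod[of "G s \<theta> - 1"] abs_Im_le_cmod[of "G s \<theta> - 1"] by (auto simp: X_def)
    moreover have "1 \<le> exp x" using x by simp
    ultimately have "bend (X s \<theta>) \<le> 2 * exp x" "\<bar>Im (G s \<theta>)\<bar> \<le> exp x"
      using bend_le[of "X s \<theta>"] by linarith+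
    then have "(bend (X s \<theta>))\<^sup>2 \<le> (2 * exp x)\<^sup>2" "(Im (G s \<theta>))\<^sup>2 \<le> (exp x)\<^sup>2"
      using bend_pos[of "X s \<theta>"] power_mono[of "bend (X s \<theta>)" "2 * exp x" 2] power_mono[of "\<bar>Im (G s \<theta>)\<bar>" "exp x" 2]
      by simp_all
    then have "(bend (X s \<theta>))\<^sup>2 + (Im (G s \<theta>))\<^sup>2 \<le> 5 * (exp x)\<^sup>2"
      by (simp add: power_mult_distrib)
    also have "\<dots> \<le> (exp 1)\<^sup>2 * (exp x)\<^sup>2"
    proof (intro mult_right_mono)
      have "(5/2)\<^sup>2 \<le> (exp 1 :: real)\<^sup>2"
        using exp_lower_Taylor_quadratic[of "1::real"] by (intro power_mono) auto
      then show "5 \<le> (exp 1 :: real)\<^sup>2" by (simp add: power2_eq_square)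
    qed auto
    also have "\<dots> = exp (2 * (1 + x))"
      by (simp add: exp_double[symmetric] exp_add[symmetric] algebra_simps)
    finally have "ln ((bend (X s \<theta>))\<^sup>2 + (Im (G s \<theta>))\<^sup>2) \<le> 2 * (1 + x)"
      using den_pos[of "X s \<theta>" "Im (G s \<theta>)"] by (metis exp_gt_zero ln_exp ln_le_cancel_iff)
    then show "psi s \<theta> \<le> 1 + x"
      by (simp add: psi_def)
  qed (rule integrable_continuous_real, rule continuous_on_const)
  also have "\<dots> = 2 * pi * (1 + x)"
    by simp
  also have "\<dots> \<le> 8 * (1 + x)"
    using pi_less_4 x by (intro mult_right_mono) auto
  finally show ?thesis .
qed

end

section \<open>Lemniscates of polynomials with zeros on the circle\<close>

text \<open>For \<open>W = 1 + A * g\<close> with \<open>A > 0\<close> the set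
  \<open>Re W < 1\<close> is \<open>Re g < 0\<close> whatever the size of \<open>A\<close>, so
  \<open>A\<close> is free for normalization. The number \<open>x\<close> limits the total growth
  between the radii \<open>exp (-60)\<close> and \<open>3/4\<close>, hence the number of doublings
  of \<open>T\<close>.\<close>

lemma negative_area_ge:
  fixes g :: "complex \<Rightarrow> complex"
  assumes hol: "g holomorphic_on ball 0 1" and g0: "g 0 = 0"
    and z1: "cmod z1 \<le> exp (-60)" "exp (- x) \<le> cmod (g z1)"
    and ub: "\<And>z. cmod z \<le> 3/4 \<Longrightarrow> cmod (g z) \<le> exp x"
    and x: "0 \<le> x" and K: "1 + 2 * x < 2 ^ K"
  shows "\<exists>N \<subseteq> {z. cmod z \<le> 3/4 \<and> Re (g z) < 0}. N \<in> sets borel \<and> exp (-120) / 7200000 \<le> K * measure lborel N"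
proof -
  have small: "exp (-60) < (1/32 :: real)"
  proof -
    have "(32::real) < exp 60"
      using exp_ge_add_one_self[of "60::real"] by simp
    then show ?thesis
      by (simp add: exp_minus field_simps)
  qed
  have cont: "continuous_on (cball 0 (exp (-60))) (\<lambda>z. cmod (g z))"
    using small
    by (intro continuous_on_norm continuous_on_subset[OF holomorphic_on_imp_continuous_on[OF hol]]) auto
  have "\<exists>z0\<in>cball 0 (exp (-60)). \<forall>z\<in>cball 0 (exp (-60)). cmod (g z) \<le> cmod (g z0)"
    by (rule continuous_attains_sup[OF compact_cball _ cont]) auto
  then obtain z0 where z0: "cmod z0 \<le> exp (-60)" "\<And>z. cmod z \<le> exp (-60) \<Longrightarrow> cmod (g z) \<le> cmod (g z0)"
    by auto
  have m0: "exp (- x) \<le> cmod (g z0)"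
    using z0(2)[OF z1(1)] z1(2) by linarith
  then have m0': "0 < cmod (g z0)" using exp_gt_zero[of "-x"] by linarith
  \<comment> \<open>This makes \<open>|W - 1| \<le> 1\<close> on the small disc, so
    \<open>T (-60) \<le> 8\<close>. The value of \<open>g\<close> at \<open>z1\<close> prevents
    \<open>A\<close> from exceeding \<open>exp x\<close>.\<close>
  define A where "A = 1 / cmod (g z0)"
  have A: "0 < A" "A \<le> exp x"
  proof -
    have "A \<le> 1 / exp (- x)"
      unfolding A_def using m0 m0' by (intro divide_left_mono) auto
    then show "A \<le> exp x" by (simp add: exp_minus field_simps)
  qed (use m0' in \<open>simp add: A_def\<close>)
  define W where "W = (\<lambda>z. 1 + of_real A * g z)"
  have W1: "cmod (W z - 1) = A * cmod (g z)" for z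
    using A by (simp add: W_def norm_mult)
  interpret holomorphic_disc W 1
    unfolding W_def by unfold_locales (auto intro!: holomorphic_intros hol)
  let ?q = "ln (3/4) :: real" and ?r = "ln (1/2) :: real"
  have q0: "?q < 0" by simp
  have qe: "1/3 \<le> ?q - ?r"
  proof -
    have "?q = ln (3/2) + ?r" by (subst ln_mult_pos[symmetric]) simp_all
    then have "?q - ?r = ln (3/2)" by simp
    moreover have "ln (2/3 :: real) \<le> 2/3 - 1" by (rule ln_le_minus_one) simp
    moreover have "ln (3/2 :: real) = - ln (2/3)" by (subst ln_inverse[symmetric]) auto
    ultimately show ?thesis by simp
  qed
  have pr: "-60 \<le> ?r"
  proof -
    have "exp (-60) \<le> (1/2 :: real)" using small by simp
    then show ?thesis by (simp add: ln_ge_iff)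
  qed
  have T1: "T (-60) \<le> 8 * (1 + 0)"
  proof (rule T_le)
    show "cmod (W z - 1) \<le> exp 0" if "cmod z = exp (- 60)" for z
      using z0(2)[of z] that m0' by (simp add: W1 A_def divide_le_eq)
  qed auto
  have Tub: "T s < 8 * 2 ^ K" if "-60 \<le> s" "s \<le> ?q" for s
  proof -
    have "T s \<le> 8 * (1 + 2 * x)"
    proof (rule T_le)
      show "s < ln 1" using le_less_trans[OF that(2) q0] by simp
      show "cmod (W z - 1) \<le> exp (2 * x)" if z: "cmod z = exp s" for z
      proof -
        have "exp s \<le> exp ?q" using \<open>s \<le> ?q\<close> by (simp only: exp_le_cancel_iff)
        then have "cmod (g z) \<le> exp x" using z by (intro ub) simp
        then have "A * cmod (g z) \<le> exp x * exp x"
          using A by (intro mult_mono) auto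
        then show ?thesis by (simp add: W1 mult_exp_exp)
      qed
    qed (use x in simp)
    then show ?thesis using K by simp
  qed
  have Tr: "16 \<le> T ?r"
  proof -
    \<comment> \<open>Otherwise the rescaled function maps the unit disc into itself and fixes 0.
      The Schwarz lemma would bound it by \<open>4 / exp 60\<close> at \<open>4 * z0\<close>, where
      its modulus is \<open>8 / exp 60\<close>.\<close>
    have "\<exists>z2. cmod z2 < 1/4 \<and> exp 60 / 8 \<le> A * cmod (g z2)"
    proof (rule ccontr)
      assume "\<not> ?thesis"
      then have lt: "A * cmod (g z) < exp 60 / 8" if "cmod z < 1/4" for z
        using that by force
      define f where "f = (\<lambda>\<xi>. of_real (A * 8 / exp 60) * g (\<xi> / 4))"
      have nf: "cmod (f \<xi>) = A * cmod (g (\<xi> / 4)) * (8 / exp 60)" for \<xi>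
        using A by (simp add: f_def norm_mult norm_divide)
      have "cmod (f (4 * z0)) \<le> cmod (4 * z0)"
      proof (rule Schwarz_Lemma(1))
        have "(\<lambda>\<xi>. g (\<xi> / 4)) holomorphic_on ball 0 1"
          by (rule holomorphic_on_compose_gen[where g = g and t = "ball 0 1", unfolded o_def])
            (auto intro!: holomorphic_intros assms(1) simp: norm_divide)
        then show "f holomorphic_on ball 0 1"
          unfolding f_def by (intro holomorphic_intros)
        show "f 0 = 0" by (simp add: f_def g0)
        show "cmod (f \<xi>) < 1" if "cmod \<xi> < 1" for \<xi>
        proof -
          have "A * cmod (g (\<xi> / 4)) < exp 60 / 8"
            using that by (intro lt) (simp add: norm_divide)
          then show ?thesis unfolding nf by (simp add: field_simps)
        qed
        show "cmod (4 * z0) < 1" using z0(1) small by (simp add: norm_mult)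
      qed
      moreover have "cmod (f (4 * z0)) = 8 / exp 60"
        unfolding nf using m0' by (simp add: A_def)
      moreover have "cmod (4 * z0) \<le> 4 / exp 60"
        using z0(1) by (simp add: norm_mult exp_minus field_simps)
      ultimately have "8 / exp 60 \<le> 4 / (exp 60 :: real)" by linarith
      then show False by (simp add: field_simps)
    qed
    then obtain z2 where z2: "cmod z2 < 1/4" "exp 60 / 8 \<le> A * cmod (g z2)" by blast
    have z2n: "z2 \<noteq> 0"
      using z2(2) g0 by (auto simp: field_simps)
    define s2 where "s2 = ln (cmod z2)"
    have z2e: "exp (Complex s2 (Arg z2)) = z2"
      using z2n by (simp add: s2_def exp_eq_polar rcis_cmod_Arg[unfolded rcis_def])
    have s2: "s2 + ln 2 \<le> ?r"
    proof -
      have "s2 + ln 2 = ln (cmod z2 * 2)"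
        using z2n by (simp add: s2_def ln_mult_pos)
      also have "\<dots> \<le> ?r"
        using z2(1) z2n by (subst ln_le_cancel_iff) auto
      finally show ?thesis .
    qed
    \<comment> \<open>\<open>exp 60 / 8 \<ge> exp 57\<close> because \<open>exp 3 \<ge> 8\<close>.
      Then \<open>ln (1 + |W|^2) \<ge> 114 - 2 * ln 2 \<ge> 112\<close> at \<open>z2\<close>, and
      \<open>113 * ln 2 \<le> 2 * T + 25\<close> at radius 1/2 gives more than 16. The exponent 60
      provides this margin.\<close>
    define a :: real where "a = exp 57"
    have a2: "2 \<le> a"
      using exp_ge_add_one_self[of "57::real"] by (simp add: a_def)
    have "a \<le> exp 60 / 8"
    proof -
      have "(8::real) \<le> exp 3"
      proof -
        have "(2::real) ^ 3 \<le> exp 1 ^ 3"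
          using exp_ge_add_one_self[of "1::real"] by (intro power_mono) auto
        then show ?thesis by (simp flip: exp_of_nat_mult)
      qed
      then have "a * 8 \<le> exp 57 * exp 3" by (simp add: a_def)
      then show ?thesis by (simp add: mult_exp_exp)
    qed
    then have "a \<le> cmod (W z2 - 1)" using z2(2) by (simp add: W1)
    also have "\<dots> \<le> cmod (W z2) + 1"
      using norm_triangle_ineq4[of "W z2" 1] by simp
    finally have "a / 2 \<le> cmod (W z2)" using a2 by simp
    then have "(a / 2)\<^sup>2 \<le> (cmod (W z2))\<^sup>2" using a2 by (intro power_mono) auto
    then have "a\<^sup>2 / 4 \<le> 1 + (cmod (W z2))\<^sup>2" by (simp add: power_divide)
    then have "ln (a\<^sup>2 / 4) \<le> ln (1 + (cmod (W z2))\<^sup>2)"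
      using a2 by (subst ln_le_cancel_iff) (auto intro: add_pos_nonneg)
    moreover have "ln (a\<^sup>2 / 4) = 114 - 2 * ln 2"
      using a2 ln_realpow[of 2 2] by (simp add: ln_div ln_realpow a_def)
    ultimately have "112 \<le> ln (1 + (cmod (W z2))\<^sup>2)"
      using ln_2_less_1 by linarith
    moreover have "1 + ln (1 + (cmod (W z2))\<^sup>2) \<le> L.M (s2 + ln 2) / ln 2"
    proof -
      have "s2 + ln 2 < 0" using s2 by (rule le_less_trans) simp
      then show ?thesis
        using L.le_M[of "ln 2" s2 "Arg z2"] ln_2_less_1 pi_gt3 by (simp add: v_eq G_def z2e)
    qed
    ultimately have "113 \<le> L.M (s2 + ln 2) / ln 2" by linarith
    then have "113 * ln 2 \<le> L.M (s2 + ln 2)"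
      by (simp add: pos_le_divide_eq)
    also have "\<dots> \<le> L.M ?r"
      using s2 by (intro L.M_mono) auto
    also have "\<dots> \<le> 2 * T ?r + 25"
      by (rule L_le_T) simp
    finally show ?thesis
      using ln2_ge_two_thirds by linarith
  qed
  have ge: "exp (2 * (-60)) * (?q - ?r)\<^sup>2 / 800000 \<le> K * measure lborel (neg_region (-60) ?q)"
  proof (rule neg_region_ge)
    show "?q - - 60 \<le> 60" using q0 by linarith
  qed (use q0 pr Tub Tr T1 in auto)
  \<comment> \<open>The radii 1/2 and 3/4 are at logarithmic distance at least 1/3, and
    \<open>9 * 800000 = 7200000\<close>.\<close>
  have "exp (-120) / 7200000 \<le> exp (2 * (-60)) * (?q - ?r)\<^sup>2 / 800000"
  proof -
    have "(1/3)\<^sup>2 \<le> (?q - ?r)\<^sup>2" using qe by (intro power_mono) auto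
    then have "exp (-120) * (1/9) \<le> exp (-120) * (?q - ?r)\<^sup>2"
      by (intro mult_left_mono) (auto simp: power2_eq_square)
    then show ?thesis by simp
  qed
  from order_trans[OF this ge] have "exp (-120) / 7200000 \<le> K * measure lborel (neg_region (-60) ?q)" .
  moreover have "neg_region (-60) ?q \<subseteq> {z. cmod z \<le> 3/4 \<and> Re (g z) < 0}"
  proof
    fix z
    assume "z \<in> neg_region (-60) ?q"
    then have "cmod z \<le> 3/4" "Re (W z) < 1"
      by (auto simp: neg_region_def)
    then show "z \<in> {z. cmod z \<le> 3/4 \<and> Re (g z) < 0}"
      using A by (simp add: W_def mult_less_0_iff)
  qed
  moreover have "neg_region (-60) ?q \<in> sets borel"
    using neg_region_borel[of ?q "-60"] q0 by (auto simp: fmeasurableD)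
  ultimately show ?thesis
    by (intro exI[of _ "neg_region (-60) ?q"] conjI)
qed

section \<open>Bounds for monic polynomials from their zeros\<close>

lemma monic_roots:
  fixes p :: "complex poly"
  assumes "lead_coeff p = 1"
  obtains A where "p = (\<Prod>a\<in>#A. [:-a, 1:])" "size A = degree p" "\<And>a. a \<in># A \<Longrightarrow> poly p a = 0"
proof -
  have e: "p = (\<Prod>a\<in>#proots p. [:-a, 1:])"
    using complex_poly_decompose_multiset[of p] assms by simp
  have r: "poly (\<Prod>a\<in>#B. [:-a, 1:]) a = 0" if "a \<in># B" for a :: complex and B
    using that by (induction B) auto
  show ?thesis
    by (rule that[OF e size_proots_complex]) (subst e, rule r)
qed

lemma norm_poly_roots:
  "cmod (poly (\<Prod>a\<in>#A. [:-a, 1:]) z) = (\<Prod>a\<in>#A. cmod (z - a))"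
proof (induction A)
  case (add a A)
  have "poly ([:-a, 1:] * q) z = (z - a) * poly q z" for q
    by (simp add: algebra_simps)
  with add show ?case
    by (simp add: norm_mult del: poly_mult mult_pCons_left)
qed simp

lemma prod_mset_ge:
  fixes f :: "'a \<Rightarrow> real"
  assumes "\<And>a. a \<in># A \<Longrightarrow> c \<le> f a" "0 \<le> c"
  shows "c ^ size A \<le> (\<Prod>a\<in>#A. f a)"
  using assms
proof (induction A)
  case (add a A)
  have "c \<le> f a" "c ^ size A \<le> (\<Prod>a\<in>#A. f a)"
    using add by auto
  moreover from this have "0 \<le> f a"
    using add.prems(2) by linarith
  ultimately have "c * c ^ size A \<le> f a * (\<Prod>a\<in>#A. f a)"
    using add.prems(2) by (intro mult_mono) auto
  then show ?case by simp
qed simp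

lemma prod_mset_le:
  fixes f :: "'a \<Rightarrow> real"
  assumes "\<And>a. a \<in># A \<Longrightarrow> 0 \<le> f a \<and> f a \<le> c"
  shows "0 \<le> (\<Prod>a\<in>#A. f a) \<and> (\<Prod>a\<in>#A. f a) \<le> c ^ size A"
  using assms
proof (induction A)
  case (add a A)
  then have "0 \<le> f a" "f a \<le> c" "0 \<le> (\<Prod>a\<in>#A. f a)" "(\<Prod>a\<in>#A. f a) \<le> c ^ size A"
    by auto
  then show ?case
    using mult_mono[of "f a" c "\<Prod>a\<in>#A. f a" "c ^ size A"] by simp
qed simp

lemma prod_mset_gt:
  fixes f :: "'a \<Rightarrow> real"
  assumes "\<And>a. a \<in># A \<Longrightarrow> c < f a" "A \<noteq> {#}" "0 \<le> c"
  shows "c ^ size A < (\<Prod>a\<in>#A. f a)"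
  using assms
proof (induction A)
  case (add a A)
  show ?case
  proof (cases "A = {#}")
    case False
    then have "c ^ size A < (\<Prod>a\<in>#A. f a)" using add by auto
    moreover have "c < f a" using add.prems(1) by simp
    ultimately have "c * c ^ size A < f a * (\<Prod>a\<in>#A. f a)"
      using add.prems(3) by (intro mult_strict_mono') auto
    then show ?thesis by simp
  qed (use add in simp)
qed simp

lemma filled_lemniscate_subset:
  assumes p: "p \<in> monic_polys_zeros_in n (cball 0 1)" and "1 \<le> n"
  shows "filled_lemniscate p 1 \<subseteq> cball 0 2"
proof
  fix z
  assume z: "z \<in> filled_lemniscate p 1"
  obtain A where A: "p = (\<Prod>a\<in>#A. [:-a, 1:])" "size A = degree p" "\<And>a. a \<in># A \<Longrightarrow> poly p a = 0"
    using p monic_roots[of p] unfolding monic_polys_zeros_in_def by blast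
  show "z \<in> cball 0 2"
  proof (rule ccontr)
    assume n: "z \<notin> cball 0 2"
    have "1 < cmod (z - a)" if "a \<in># A" for a
    proof -
      have "a \<in> cball 0 1" using A(3)[OF that] p unfolding monic_polys_zeros_in_def by blast
      then have "cmod a \<le> 1" by simp
      then show ?thesis using n norm_triangle_ineq2[of z a] unfolding mem_cball dist_0_norm by linarith
    qed
    moreover have "size A = n" using A(2) p unfolding monic_polys_zeros_in_def by simp
    then have "A \<noteq> {#}" using \<open>1 \<le> n\<close> by auto
    ultimately have "1 < cmod (poly p z)"
      unfolding A(1) norm_poly_roots using prod_mset_gt[of A 1 "\<lambda>a. cmod (z - a)"] by simp
    moreover have "cmod (poly p z) \<le> 1"
      using z unfolding filled_lemniscate_def by blast
    ultimately show False by linarith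
  qed
qed

lemma filled_lemniscate_closed: "closed (filled_lemniscate p t)"
  unfolding filled_lemniscate_def by (intro closed_Collect_le continuous_intros)

lemma filled_lemniscate_lmeasurable:
  assumes "p \<in> monic_polys_zeros_in n (cball 0 1)" "1 \<le> n"
  shows "filled_lemniscate p 1 \<in> lmeasurable"
proof (rule lmeasurable_compact)
  show "compact (filled_lemniscate p 1)"
    unfolding compact_eq_bounded_closed
    by (intro conjI bounded_subset[OF bounded_cball filled_lemniscate_subset[OF assms]] filled_lemniscate_closed)
qed

text \<open>Maximum modulus for the reflected polynomial, whose value at 0 is the leading
  coefficient of \<open>q\<close>.\<close>

lemma monic_sup_circle:
  fixes q :: "complex poly"
  assumes q: "lead_coeff q = 1" and r: "0 < r"
  shows "\<exists>z. cmod z = r \<and> r ^ degree q \<le> cmod (poly q z)"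
proof (rule ccontr)
  assume "\<not> ?thesis"
  then have lt: "cmod (poly q z) < r ^ degree q" if "cmod z = r" for z
    using that by force
  let ?h = "reflect_poly q"
  let ?C = "sphere (0::complex) (1 / r)"
  have "?C \<noteq> {}" using r by simp
  have "\<exists>w0\<in>?C. \<forall>w\<in>?C. cmod (poly ?h w) \<le> cmod (poly ?h w0)"
    by (rule continuous_attains_sup) (use r in \<open>auto intro!: continuous_intros\<close>)
  then obtain w0 where w0: "cmod w0 = 1 / r" "\<And>w. cmod w = 1 / r \<Longrightarrow> cmod (poly ?h w) \<le> cmod (poly ?h w0)"
    by auto
  have "w0 \<noteq> 0" using w0 r by auto
  have "cmod (poly ?h 0) \<le> cmod (poly ?h w0)"
  proof (rule maximum_modulus_frontier[where S = "cball 0 (1 / r)" and f = "poly ?h"])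
    show "poly ?h holomorphic_on interior (cball 0 (1 / r))"
      by (intro holomorphic_intros)
    show "cmod (poly ?h z) \<le> cmod (poly ?h w0)" if "z \<in> frontier (cball 0 (1 / r))" for z
      using that r by (intro w0) simp
  qed (use r in \<open>auto intro!: continuous_intros\<close>)
  then have "1 \<le> cmod (poly ?h w0)" using q by simp
  also have "\<dots> = (1 / r) ^ degree q * cmod (poly q (inverse w0))"
    using \<open>w0 \<noteq> 0\<close> w0 by (simp add: poly_reflect_poly_nz norm_mult norm_power)
  also have "\<dots> < (1 / r) ^ degree q * r ^ degree q"
    using r w0 \<open>w0 \<noteq> 0\<close> by (intro mult_strict_left_mono lt) (auto simp: norm_inverse)
  also have "\<dots> = 1" using r by (simp flip: power_mult_distrib)
  finally show False by simp
qed

text \<open>All zeros have modulus 1, so \<open>|P(0)| = 1\<close>, and \<open>Re g < 0\<close>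
  means \<open>Re (P(0) / P) > 1\<close>, which forces \<open>|P| < 1\<close>. The bounds on
  \<open>g\<close> are exponential in \<open>n\<close>, hence \<open>K\<close> is of order
  \<open>ln n\<close>.\<close>

lemma lemniscate_area_ge:
  assumes P: "P \<in> monic_polys_zeros_in n (sphere 0 1)" and n: "2 \<le> n"
  shows "exp (-120) / 108000000 / ln n \<le> measure lebesgue (filled_lemniscate P 1)"
proof -
  have P': "degree P = n" "lead_coeff P = 1" "\<And>z. poly P z = 0 \<Longrightarrow> cmod z = 1"
    using P by (auto simp: monic_polys_zeros_in_def)
  obtain A where A: "P = (\<Prod>a\<in>#A. [:-a, 1:])" "size A = n" "\<And>a. a \<in># A \<Longrightarrow> cmod a = 1"
    using monic_roots[OF P'(2)] P' by metis
  define g where "g = (\<lambda>z. 1 - poly P 0 / poly P z)"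
  have P0: "cmod (poly P 0) = 1"
  proof -
    have "(\<Prod>a\<in>#A. cmod (0 - a)) = (\<Prod>a\<in>#A. 1)"
      using A(3) by (intro arg_cong[where f = prod_mset] image_mset_cong) simp
    then show ?thesis unfolding A(1) norm_poly_roots by simp
  qed
  have lo: "(1/4) ^ n \<le> cmod (poly P z)" if "cmod z \<le> 3/4" for z
  proof -
    have "1/4 \<le> cmod (z - a)" if "a \<in># A" for a
      using \<open>cmod z \<le> 3/4\<close> A(3)[OF that] norm_triangle_ineq2[of a z] by (simp add: norm_minus_commute)
    then show ?thesis
      unfolding A(1) norm_poly_roots A(2)[symmetric] by (rule prod_mset_ge) auto
  qed
  have hi: "cmod (poly P z) \<le> 2 ^ n" if "cmod z \<le> 1" for z
  proof -
    have "0 \<le> cmod (z - a) \<and> cmod (z - a) \<le> 2" if "a \<in># A" for a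
      using \<open>cmod z \<le> 1\<close> A(3)[OF that] norm_triangle_ineq4[of z a] by simp
    then show ?thesis
      unfolding A(1) norm_poly_roots A(2)[symmetric] using prod_mset_le[of A "\<lambda>a. cmod (z - a)" 2] by blast
  qed
  have nz: "poly P z \<noteq> 0" if "cmod z < 1" for z
    using P'(3)[of z] that by auto
  \<comment> \<open>\<open>1 + 122 * n \<le> 123 * n\<close>, and the added 1 makes the inequality
    with \<open>2 ^ K\<close> strict.\<close>
  define K where "K = nat \<lceil>log 2 (123 * n)\<rceil> + 1"
  have K: "1 + 2 * (61 * real n) < 2 ^ K"
  proof -
    have "123 * real n = 2 powr (log 2 (123 * n))" using n by simp
    also have "\<dots> \<le> 2 powr (nat \<lceil>log 2 (123 * n)\<rceil>)" by (intro powr_mono) linarith+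
    also have "\<dots> = 2 ^ nat \<lceil>log 2 (123 * n)\<rceil>" by (simp add: powr_realpow)
    finally have "2 * (123 * real n) \<le> 2 ^ K" by (simp add: K_def)
    then show ?thesis using n by simp
  qed
  \<comment> \<open>\<open>P - P(0)\<close> is still monic of degree \<open>n\<close>, so it reaches
    \<open>exp (-60) ^ n\<close> on the circle. Dividing by
    \<open>|P| \<le> 2 ^ n \<le> exp n\<close> turns 60 into 61.\<close>
  obtain z1 where z1: "cmod z1 = exp (-60)" "exp (-60) ^ n \<le> cmod (poly P z1 - poly P 0)"
  proof -
    let ?q = "P - [:poly P 0:]"
    have d: "degree ?q = n"
    proof -
      have "degree (P + - [:poly P 0:]) = degree P"
        using P' n by (intro degree_add_eq_left) simp
      then show ?thesis using P' by (simp only: add_uminus_conv_diff)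
    qed
    moreover have "lead_coeff ?q = 1" unfolding d using P' n by (simp add: coeff_pCons split: nat.split)
    ultimately show ?thesis using monic_sup_circle[of ?q "exp (-60)"] that by auto
  qed
  have "\<exists>N \<subseteq> {z. cmod z \<le> 3/4 \<and> Re (g z) < 0}. N \<in> sets borel \<and> exp (-120) / 7200000 \<le> K * measure lborel N"
  proof (rule negative_area_ge)
    show "g holomorphic_on ball 0 1"
      unfolding g_def using nz by (intro holomorphic_intros) auto
    show "g 0 = 0" using P0 by (auto simp: g_def)
    show "cmod z1 \<le> exp (- 60)" using z1 by simp
    have z1': "cmod z1 < 1" using z1 by simp
    show "exp (- (61 * real n)) \<le> cmod (g z1)"
    proof -
      have "exp (- (61 * real n)) = exp (-60) ^ n / exp 1 ^ n"
        by (simp add: exp_minus exp_add[symmetric] field_simps flip: exp_of_nat_mult)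
      also have "\<dots> \<le> exp (-60) ^ n / 2 ^ n"
        using exp_ge_add_one_self[of "1::real"] by (intro divide_left_mono power_mono) auto
      also have "\<dots> \<le> cmod (poly P z1 - poly P 0) / cmod (poly P z1)"
        using z1 z1' hi[of z1] nz[of z1] by (intro frac_le) auto
      also have "\<dots> = cmod (g z1)"
        using nz[OF z1'] by (simp add: g_def diff_divide_distrib flip: norm_divide)
      finally show ?thesis .
    qed
    show "cmod (g z) \<le> exp (61 * real n)" if "cmod z \<le> 3/4" for z
    proof -
      have "cmod (g z) \<le> 1 + 1 / cmod (poly P z)"
        unfolding g_def using norm_triangle_ineq4[of 1 "poly P 0 / poly P z"] P0 by (simp add: norm_divide)
      also have "\<dots> \<le> 1 + 1 / (1/4) ^ n"
      proof -
        have "0 < cmod (poly P z)" using nz[of z] that by simp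
        then show ?thesis using lo[OF that] by (intro add_left_mono divide_left_mono) auto
      qed
      also have "\<dots> = 1 + 4 ^ n" by (simp add: power_divide)
      also have "\<dots> \<le> 2 ^ n * 4 ^ n"
      proof -
        have "(2::real) ^ 1 \<le> 2 ^ n" using n by (intro power_increasing) auto
        then have "2 * (4::real) ^ n \<le> 2 ^ n * 4 ^ n" by (intro mult_right_mono) auto
        moreover have "(1::real) \<le> 4 ^ n" by simp
        ultimately show ?thesis by linarith
      qed
      also have "\<dots> = 8 ^ n" by (simp flip: power_mult_distrib)
      also have "\<dots> \<le> exp 61 ^ n"
        using exp_ge_add_one_self[of "61::real"] by (intro power_mono) auto
      also have "\<dots> = exp (61 * real n)" by (simp flip: exp_of_nat_mult add: mult.commute)
      finally show ?thesis .
    qed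
    show "1 + 2 * (61 * real n) < 2 ^ K" by (rule K)
  qed simp
  then obtain N where N: "N \<subseteq> {z. cmod z \<le> 3/4 \<and> Re (g z) < 0}" "N \<in> sets borel"
    "exp (-120) / 7200000 \<le> K * measure lborel N" by blast
  have sub: "N \<subseteq> filled_lemniscate P 1"
  proof
    fix z assume "z \<in> N"
    then have z: "cmod z \<le> 3/4" "Re (g z) < 0" using N by auto
    then have "1 < Re (poly P 0 / poly P z)" by (simp add: g_def)
    also have "\<dots> \<le> cmod (poly P 0 / poly P z)" by (rule complex_Re_le_cmod)
    also have "\<dots> = 1 / cmod (poly P z)" using P0 by (simp add: norm_divide)
    finally have "cmod (poly P z) < 1" using nz[of z] z by (simp add: field_simps)
    then show "z \<in> filled_lemniscate P 1" by (simp add: filled_lemniscate_def)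
  qed
  have lm: "filled_lemniscate P 1 \<in> lmeasurable"
    using P n by (intro filled_lemniscate_lmeasurable[of P n]) (auto simp: monic_polys_zeros_in_def)
  have "measure lborel N = measure lebesgue N"
    using N(2) by simp
  also have "\<dots> \<le> measure lebesgue (filled_lemniscate P 1)"
    using sub lm N(2) by (intro measure_mono_fmeasurable) auto
  finally have le: "measure lborel N \<le> measure lebesgue (filled_lemniscate P 1)" .
  have lnn: "2/3 \<le> ln (real n)"
  proof -
    have "ln 2 \<le> ln (real n)" using n by simp
    then show ?thesis using ln2_ge_two_thirds by linarith
  qed
  \<comment> \<open>As \<open>ln n \<ge> 2/3\<close>, the rounding in \<open>K\<close> is absorbed:
    \<open>12 * ln n + 2 \<le> 15 * ln n\<close>. The final constant is
    \<open>15 * 7200000 = 108000000\<close>.\<close>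
  have K15: "real K \<le> 15 * ln n"
  proof -
    have "ln (123 * real n) \<le> ln (2 ^ 7 * real n)"
      using n by (intro ln_mono) auto
    also have "\<dots> = 7 * ln 2 + ln n"
      using n by (simp add: ln_mult_pos ln_realpow del: power_numeral)
    also have "\<dots> \<le> 8 * ln n"
      using n by simp
    finally have "ln (123 * real n) \<le> 8 * ln n" .
    then have "log 2 (123 * n) \<le> 8 * ln n / ln 2"
      by (simp add: log_def divide_right_mono)
    also have "\<dots> \<le> 8 * ln n / (2/3)"
      using ln2_ge_two_thirds lnn by (intro divide_left_mono) auto
    finally have "log 2 (123 * n) \<le> 12 * ln n" by simp
    moreover have "0 \<le> log 2 (real (123 * n))" using n by simp
    moreover have "real (nat \<lceil>y\<rceil>) \<le> y + 1" if "0 \<le> y" for y :: real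
      using that by linarith
    ultimately have "real (nat \<lceil>log 2 (real (123 * n))\<rceil>) \<le> 12 * ln n + 1"
      by (meson add_right_mono order_trans)
    then have "real K \<le> 12 * ln n + 2"
      by (simp add: K_def)
    also have "\<dots> \<le> 15 * ln n" using lnn by simp
    finally show ?thesis .
  qed
  have "exp (-120) / 7200000 \<le> 15 * ln n * measure lebesgue (filled_lemniscate P 1)"
    using N(3) by (rule order_trans) (intro mult_mono K15 le, use lnn in auto)
  then show ?thesis
    using lnn by (simp add: field_simps)
qed

section \<open>Reflected polynomials\<close>

text \<open>The reflection in the unit circle, with \<open>z ^ d * cnj (p (1 / cnj z))\<close> as
  its value off 0. Reversing and conjugating the coefficients makes it a polynomial at 0 as
  well.\<close>

definition refl_poly :: "complex poly \<Rightarrow> complex poly" where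
  "refl_poly p = map_poly cnj (reflect_poly p)"

lemma poly_refl_nz:
  assumes "z \<noteq> 0"
  shows "poly (refl_poly p) z = z ^ degree p * cnj (poly p (inverse (cnj z)))"
  using assms by (simp add: refl_poly_def poly_reflect_poly_nz)

lemma poly_refl_roots:
  "poly (refl_poly (\<Prod>a\<in>#A. [:-a, 1:])) z = (\<Prod>a\<in>#A. 1 - cnj a * z)"
proof -
  have "poly (reflect_poly (\<Prod>a\<in>#A. [:-a, 1:])) w = (\<Prod>a\<in>#A. 1 - a * w)" for w
  proof (induction A)
    case (add a A)
    have "reflect_poly [:-a, 1:] = [:1, -a:]"
      by (simp add: reflect_poly_def)
    then have "poly (reflect_poly ([:-a, 1:] * q)) w = (1 - a * w) * poly (reflect_poly q) w" for q
      by (simp only: reflect_poly_mult poly_mult) simp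
    with add show ?case by (simp del: mult_pCons_left)
  qed simp
  then have "poly (refl_poly (\<Prod>a\<in>#A. [:-a, 1:])) z = cnj (\<Prod>a\<in>#A. 1 - a * cnj z)"
    by (simp add: refl_poly_def)
  also have "\<dots> = (\<Prod>a\<in>#A. 1 - cnj a * z)"
    by (induction A) auto
  finally show ?thesis .
qed

text \<open>For \<open>|a| \<le> 1\<close> the sign is that of \<open>1 - |z|^2\<close> (or the
  difference vanishes), which settles both sides of the circle in \<open>refl_poly_bounds\<close>
  factor by factor.\<close>

lemma blaschke_factor:
  "(cmod (1 - cnj a * z))\<^sup>2 - (cmod (z - a))\<^sup>2 = (1 - (cmod z)\<^sup>2) * (1 - (cmod a)\<^sup>2)"
  unfolding cmod_power2 by (simp add: power2_eq_square algebra_simps)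

lemma norm_prod_mset: "cmod (\<Prod>a\<in>#A. f a) = (\<Prod>a\<in>#A. cmod (f a))"
  by (induction A) (auto simp: norm_mult)

lemma prod_mset_mono_real:
  fixes f g :: "'a \<Rightarrow> real"
  assumes "\<And>a. a \<in># A \<Longrightarrow> 0 \<le> f a \<and> f a \<le> g a"
  shows "0 \<le> (\<Prod>a\<in>#A. f a) \<and> (\<Prod>a\<in>#A. f a) \<le> (\<Prod>a\<in>#A. g a)"
  using assms
proof (induction A)
  case (add a A)
  then have "0 \<le> f a" "f a \<le> g a" "0 \<le> (\<Prod>a\<in>#A. f a)" "(\<Prod>a\<in>#A. f a) \<le> (\<Prod>a\<in>#A. g a)"
    by auto
  then show ?case
    using mult_mono[of "f a" "g a" "\<Prod>a\<in>#A. f a" "\<Prod>a\<in>#A. g a"] by simp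
qed simp

lemma refl_poly_bounds:
  assumes p: "p \<in> monic_polys_zeros_in n (cball 0 1)"
  shows "cmod z \<le> 1 \<Longrightarrow> cmod (poly p z) \<le> cmod (poly (refl_poly p) z)"
    and "1 \<le> cmod z \<Longrightarrow> cmod (poly (refl_poly p) z) \<le> cmod (poly p z)"
    and "cmod z < 1 \<Longrightarrow> poly (refl_poly p) z \<noteq> 0"
proof -
  have l: "lead_coeff p = 1" and zb: "poly p a = 0 \<Longrightarrow> cmod a \<le> 1" for a
    using p unfolding monic_polys_zeros_in_def by (blast, fastforce)
  obtain A where A: "p = (\<Prod>a\<in>#A. [:-a, 1:])" "\<And>a. a \<in># A \<Longrightarrow> poly p a = 0"
    using monic_roots[OF l] by blast
  have a1: "cmod a \<le> 1" if "a \<in># A" for a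
    using zb[OF A(2)[OF that]] .
  have a2: "0 \<le> 1 - (cmod a)\<^sup>2" if "a \<in># A" for a
    using power_mono[OF a1[OF that], of 2] by simp
  have p1: "cmod (poly p z) = (\<Prod>a\<in>#A. cmod (z - a))"
    by (subst A(1)) (rule norm_poly_roots)
  have p2: "cmod (poly (refl_poly p) z) = (\<Prod>a\<in>#A. cmod (1 - cnj a * z))"
    by (subst A(1)) (simp only: poly_refl_roots norm_prod_mset)
  show "cmod (poly p z) \<le> cmod (poly (refl_poly p) z)" if z: "cmod z \<le> 1"
    unfolding p1 p2
  proof (rule prod_mset_mono_real[THEN conjunct2], intro conjI)
    fix a assume a: "a \<in># A"
    have "0 \<le> 1 - (cmod z)\<^sup>2" using power_mono[OF z, of 2] by simp
    then have "0 \<le> (1 - (cmod z)\<^sup>2) * (1 - (cmod a)\<^sup>2)"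
      using a2[OF a] by (rule mult_nonneg_nonneg)
    then have "(cmod (z - a))\<^sup>2 \<le> (cmod (1 - cnj a * z))\<^sup>2"
      using blaschke_factor[of a z] by linarith
    then show "cmod (z - a) \<le> cmod (1 - cnj a * z)"
      by (rule power2_le_imp_le) simp
  qed simp
  show "cmod (poly (refl_poly p) z) \<le> cmod (poly p z)" if z: "1 \<le> cmod z"
    unfolding p1 p2
  proof (rule prod_mset_mono_real[THEN conjunct2], intro conjI)
    fix a assume a: "a \<in># A"
    have "1 - (cmod z)\<^sup>2 \<le> 0" using power_mono[OF z, of 2] by simp
    then have "(1 - (cmod z)\<^sup>2) * (1 - (cmod a)\<^sup>2) \<le> 0"
      using a2[OF a] by (rule mult_nonpos_nonneg)
    then have "(cmod (1 - cnj a * z))\<^sup>2 \<le> (cmod (z - a))\<^sup>2"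
      using blaschke_factor[of a z] by linarith
    then show "cmod (1 - cnj a * z) \<le> cmod (z - a)"
      by (rule power2_le_imp_le) simp
  qed simp
  show "poly (refl_poly p) z \<noteq> 0" if z: "cmod z < 1"
  proof -
    have "cmod (cnj a * z) < 1" if "a \<in># A" for a
    proof -
      have "cmod (cnj a * z) \<le> 1 * cmod z"
        unfolding norm_mult complex_mod_cnj using a1[OF that] by (intro mult_right_mono) auto
      then show ?thesis using z by simp
    qed
    then have "1 - cnj a * z \<noteq> 0" if "a \<in># A" for a
      using that by (metis norm_one eq_iff_diff_eq_0 less_irrefl)
    then have "(\<Prod>a\<in>#A. 1 - cnj a * z) \<noteq> 0"
      by (induction A) auto
    then show ?thesis by (subst A(1)) (simp only: poly_refl_roots not_False_eq_True)
  qed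
qed

lemma degree_refl_le: "degree (refl_poly p) \<le> degree p"
  unfolding refl_poly_def by (subst degree_map_poly) (auto intro: degree_reflect_poly_le)

text \<open>Inside the circle \<open>refl_poly p\<close> dominates and \<open>z ^ N\<close> damps
  the other term; outside the roles are exchanged. For \<open>N \<ge> 1\<close> the domination is
  strict off the circle, so no zeros lie there, and the leading term comes from
  \<open>z ^ N * p\<close>.\<close>

lemma balayage:
  assumes p: "p \<in> monic_polys_zeros_in n (cball 0 1)" and N: "1 \<le> N"
  defines "q \<equiv> monom 1 N * p + refl_poly p"
  shows "q \<in> monic_polys_zeros_in (N + n) (sphere 0 1)"
    and "cmod z \<le> 1 \<Longrightarrow> cmod (poly (refl_poly p) z) * (1 - cmod z ^ N) \<le> cmod (poly q z)"
    and "1 \<le> cmod z \<Longrightarrow> cmod (poly p z) * (cmod z ^ N - 1) \<le> cmod (poly q z)"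
proof -
  note b = refl_poly_bounds[OF p]
  have d: "degree p = n" and l: "lead_coeff p = 1" and zb: "poly p a = 0 \<Longrightarrow> cmod a \<le> 1" for a
    using p unfolding monic_polys_zeros_in_def by (blast, blast, fastforce)
  have qz: "poly q z = z ^ N * poly p z + poly (refl_poly p) z" for z
    by (simp add: q_def poly_monom)
  show in1: "cmod (poly (refl_poly p) z) * (1 - cmod z ^ N) \<le> cmod (poly q z)" if "cmod z \<le> 1" for z
  proof -
    have "cmod z ^ N * cmod (poly p z) \<le> cmod z ^ N * cmod (poly (refl_poly p) z)"
      using b(1)[OF that] by (intro mult_left_mono) auto
    moreover have "cmod (poly (refl_poly p) z) - cmod z ^ N * cmod (poly p z) \<le> cmod (poly q z)"
      using norm_diff_ineq[of "poly (refl_poly p) z" "z ^ N * poly p z"]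
      by (simp add: qz norm_mult norm_power add.commute)
    ultimately show ?thesis by (simp add: algebra_simps)
  qed
  show out1: "cmod (poly p z) * (cmod z ^ N - 1) \<le> cmod (poly q z)" if "1 \<le> cmod z" for z
  proof -
    have "cmod z ^ N * cmod (poly p z) - cmod (poly (refl_poly p) z) \<le> cmod (poly q z)"
      using norm_diff_ineq[of "z ^ N * poly p z" "poly (refl_poly p) z"]
      by (simp add: qz norm_mult norm_power)
    with b(2)[OF that] show ?thesis by (simp add: algebra_simps)
  qed
  have dm: "degree (monom 1 N * p) = N + n"
    using l d by (subst degree_mult_eq) (auto simp: degree_monom_eq)
  have dq: "degree q = N + n"
    unfolding q_def dm[symmetric]
    by (rule degree_add_eq_left) (use dm degree_refl_le[of p] d N in linarith)
  have lq: "lead_coeff q = 1"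
  proof -
    have "coeff (refl_poly p) (N + n) = 0"
      using degree_refl_le[of p] d N by (intro coeff_eq_0) linarith
    moreover have "coeff (monom 1 N * p) (N + n) = 1"
      using l d by (simp add: coeff_monom_mult)
    ultimately show ?thesis
      unfolding dq by (simp add: q_def)
  qed
  have "cmod z = 1" if "poly q z = 0" for z
  proof (rule ccontr)
    assume "cmod z \<noteq> 1"
    then consider "cmod z < 1" | "1 < cmod z" by linarith
    then show False
    proof cases
      case 1
      then have "cmod z ^ N < 1" using N by (intro power_less_one_iff[THEN iffD2]) auto
      then have "0 < cmod (poly (refl_poly p) z) * (1 - cmod z ^ N)"
        using b(3)[OF 1] by (intro mult_pos_pos) auto
      with in1[of z] 1 that show False by simp
    next
      case 2
      then have "1 < cmod z ^ N" using N by (intro one_less_power) auto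
      moreover have "poly p z \<noteq> 0" using zb[of z] 2 by auto
      ultimately have "0 < cmod (poly p z) * (cmod z ^ N - 1)"
        by (intro mult_pos_pos) auto
      with out1[of z] 2 that show False by simp
    qed
  qed
  with dq lq show "q \<in> monic_polys_zeros_in (N + n) (sphere 0 1)"
    unfolding monic_polys_zeros_in_def by auto
qed

section \<open>Thin sets around the level curve \<open>|p| = 1\<close>\<close>

lemma card_set_mset_le_size: "card (set_mset A) \<le> size A"
proof (induction A)
  case (add a A)
  then show ?case
    using card_insert_le_m1[of "Suc (size A)" "set_mset A" a] by simp
qed simp

text \<open>A product of \<open>d\<close> distances is at most \<open>e ^ d\<close> only if some
  distance is at most \<open>e\<close>, so \<open>d\<close> intervals of length \<open>2 * e\<close>
  cover the set.\<close>

lemma real_sublevel_measure: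
  fixes p :: "complex poly"
  assumes "lead_coeff p = 1" "degree p = d" "1 \<le> d" "0 \<le> e"
  shows "emeasure lborel {x::real. cmod (poly p (of_real x)) \<le> e ^ d} \<le> ennreal (2 * real d * e)"
proof -
  obtain A where A: "p = (\<Prod>a\<in>#A. [:-a, 1:])" "size A = degree p"
    using monic_roots[OF assms(1)] by blast
  have sub: "{x::real. cmod (poly p (of_real x)) \<le> e ^ d} \<subseteq> (\<Union>a\<in>set_mset A. {Re a - e..Re a + e})"
  proof
    fix x :: real
    assume "x \<in> {x. cmod (poly p (of_real x)) \<le> e ^ d}"
    then have le: "(\<Prod>a\<in>#A. cmod (of_real x - a)) \<le> e ^ d"
      unfolding A(1) norm_poly_roots by simp
    have "\<exists>a\<in>#A. cmod (of_real x - a) \<le> e"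
    proof (rule ccontr)
      assume "\<not> ?thesis"
      then have gt: "e < cmod (of_real x - a)" if "a \<in># A" for a
        using that by force
      moreover have "A \<noteq> {#}" using A(2) assms by auto
      ultimately have "e ^ size A < (\<Prod>a\<in>#A. cmod (of_real x - a))"
        by (intro prod_mset_gt assms(4)) auto
      then have "e ^ d < (\<Prod>a\<in>#A. cmod (of_real x - a))"
        using A(2) assms(2) by simp
      with le show False by simp
    qed
    then obtain a where a: "a \<in># A" "cmod (of_real x - a) \<le> e" by blast
    then have "\<bar>x - Re a\<bar> \<le> e"
      using abs_Re_le_cmod[of "of_real x - a"] by simp
    then have "x \<in> {Re a - e..Re a + e}" by auto
    then show "x \<in> (\<Union>a\<in>set_mset A. {Re a - e..Re a + e})"
      using a(1) by blast
  qed
  have "emeasure lborel {x::real. cmod (poly p (of_real x)) \<le> e ^ d}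
      \<le> emeasure lborel (\<Union>a\<in>set_mset A. {Re a - e..Re a + e})"
    by (rule emeasure_mono[OF sub]) auto
  also have "\<dots> \<le> (\<Sum>a\<in>set_mset A. emeasure lborel {Re a - e..Re a + e})"
    by (rule emeasure_subadditive_finite) auto
  also have "\<dots> = (\<Sum>a\<in>set_mset A. ennreal (2 * e))"
    using assms(4) by simp
  also have "\<dots> = of_nat (card (set_mset A)) * ennreal (2 * e)"
    by simp
  also have "\<dots> \<le> of_nat d * ennreal (2 * e)"
  proof -
    have "card (set_mset A) \<le> d"
      using A(2) assms(2) card_set_mset_le_size[of A] by simp
    then show ?thesis by (intro mult_right_mono) auto
  qed
  also have "\<dots> = ennreal (2 * real d * e)"
    using assms(4) by (simp add: ennreal_mult ennreal_of_nat_eq_real_of_nat mult_ac)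
  finally show ?thesis .
qed

text \<open>On a vertical line conjugation is polynomial: \<open>|p (x + \<i> y)|^2 - 1\<close> is a
  polynomial in \<open>y\<close> with leading coefficient \<open>\<i> ^ n * (-\<i>) ^ n = 1\<close>
  and degree \<open>2 * n\<close>. Its sublevel set has length at most \<open>4 * n * e\<close>, and
  \<open>x\<close> ranges over an interval of length 2.\<close>

lemma shell_measure:
  fixes p :: "complex poly"
  assumes p: "lead_coeff p = 1" "degree p = n" "1 \<le> n" and e: "0 \<le> e"
  shows "emeasure lborel {z. \<bar>Re z\<bar> \<le> 1 \<and> \<bar>(cmod (poly p z))\<^sup>2 - 1\<bar> \<le> e ^ (2 * n)} \<le> ennreal (8 * real n * e)"
proof -
  let ?S = "{z. \<bar>Re z\<bar> \<le> 1 \<and> \<bar>(cmod (poly p z))\<^sup>2 - 1\<bar> \<le> e ^ (2 * n)}"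
  have "closed ?S"
    by (intro closed_Collect_conj closed_Collect_le continuous_intros)
  then have [measurable]: "?S \<in> sets borel" by simp
  have line: "emeasure lborel {y. \<bar>(cmod (poly p (Complex x y)))\<^sup>2 - 1\<bar> \<le> e ^ (2 * n)} \<le> ennreal (4 * real n * e)" for x
  proof -
    let ?a = "p \<circ>\<^sub>p [:of_real x, \<i>:]" and ?b = "map_poly cnj p \<circ>\<^sub>p [:of_real x, -\<i>:]"
    let ?r = "?a * ?b - 1"
    have da: "degree ?a = n" "lead_coeff ?a = \<i> ^ n"
      using p lead_coeff_comp[of "[:of_real x, \<i>:]" p] by (simp_all add: degree_pcompose)
    have db': "degree (map_poly cnj p) = n" "lead_coeff (map_poly cnj p) = 1"
      using p by (simp_all add: degree_map_poly coeff_map_poly)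
    have db: "degree ?b = n" "lead_coeff ?b = (-\<i>) ^ n"
      using db' lead_coeff_comp[of "[:of_real x, -\<i>:]" "map_poly cnj p"] by (simp_all add: degree_pcompose)
    have lab: "lead_coeff (?a * ?b) = 1"
    proof -
      have "lead_coeff (?a * ?b) = \<i> ^ n * (-\<i>) ^ n"
        by (simp only: lead_coeff_mult da(2) db(2))
      then show ?thesis
        by (simp only: power_mult_distrib[symmetric]) simp
    qed
    have nz: "?a \<noteq> 0" "?b \<noteq> 0"
      using da db p(3) by (metis degree_0 not_one_le_zero)+
    have dab: "degree (?a * ?b) = 2 * n"
      using nz da(1) db(1) by (simp add: degree_mult_eq)
    have dr: "degree ?r = 2 * n" "lead_coeff ?r = 1"
    proof -
      have "degree (?a * ?b + - 1) = degree (?a * ?b)"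
        by (rule degree_add_eq_left) (use dab p in simp)
      then show 1: "degree ?r = 2 * n" using dab by (simp only: add_uminus_conv_diff)
      show "lead_coeff ?r = 1"
      proof -
        have "coeff 1 (2 * n) = (0 :: complex)"
          using p(3) by (intro coeff_eq_0) simp
        moreover have "coeff (?a * ?b) (2 * n) = 1"
          using lab by (simp only: dab)
        ultimately show ?thesis
          by (simp only: 1 coeff_diff) simp
      qed
    qed
    have val: "poly ?r (of_real y) = of_real ((cmod (poly p (Complex x y)))\<^sup>2 - 1)" for y
    proof -
      have "poly ?r (of_real y) = poly p (Complex x y) * cnj (poly p (Complex x y)) - 1"
        by (simp add: poly_pcompose Complex_eq mult.commute)
      then show ?thesis by (simp only: complex_norm_square[symmetric]) simp
    qed
    have "emeasure lborel {y::real. cmod (poly ?r (of_real y)) \<le> e ^ (2 * n)} \<le> ennreal (2 * (2 * n) * e)"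
      using real_sublevel_measure[OF dr(2,1), of e] p(3) e by simp
    then show ?thesis
      unfolding val norm_of_real by simp
  qed
  have "emeasure lborel ?S = (\<integral>\<^sup>+z. indicator ?S z \<partial>lborel)"
    by simp
  also have "\<dots> = (\<integral>\<^sup>+x. \<integral>\<^sup>+y. indicator ?S (Complex x y) \<partial>lborel \<partial>lborel)"
    by (rule nn_integral_complex) measurable
  also have "\<dots> \<le> (\<integral>\<^sup>+x. ennreal (4 * real n * e) * indicator {-1..1::real} x \<partial>lborel)"
  proof (rule nn_integral_mono)
    fix x :: real
    let ?L = "{y. \<bar>(cmod (poly p (Complex x y)))\<^sup>2 - 1\<bar> \<le> e ^ (2 * n)}"
    show "(\<integral>\<^sup>+y. indicator ?S (Complex x y) \<partial>lborel) \<le> ennreal (4 * real n * e) * indicator {-1..1} x"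
    proof (cases "\<bar>x\<bar> \<le> 1")
      case True
      have "closed ?L"
        unfolding Complex_eq by (intro closed_Collect_le continuous_intros)
      then have [measurable]: "?L \<in> sets borel" by simp
      have "(\<integral>\<^sup>+y. indicator ?S (Complex x y) \<partial>lborel) = (\<integral>\<^sup>+y. indicator ?L y \<partial>lborel)"
        using True by (intro nn_integral_cong) (simp add: indicator_def)
      also have "\<dots> = emeasure lborel ?L" by simp
      also note line[of x]
      finally show ?thesis using True by (simp add: indicator_def abs_le_iff)
    qed (simp add: indicator_def)
  qed
  also have "\<dots> = ennreal (4 * real n * e) * 2"
    by (simp add: nn_integral_cmult_indicator)
  also have "\<dots> = ennreal (8 * real n * e)"
  proof -
    have "ennreal (4 * real n * e * 2) = ennreal (4 * real n * e) * ennreal 2"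
      by (rule ennreal_mult) (use e in auto)
    moreover have "4 * real n * e * 2 = 8 * real n * e" by simp
    ultimately show ?thesis by (metis ennreal_numeral)
  qed
  finally show ?thesis .
qed

section \<open>Comparison of the minimal areas for the disc and the circle\<close>

lemma monic_polys_nonempty:
  assumes "w \<in> K"
  shows "monic_polys_zeros_in n K \<noteq> {}"
proof -
  have "[:-w, 1:] ^ n \<in> monic_polys_zeros_in n K"
    using assms by (auto simp: monic_polys_zeros_in_def degree_linear_power coeff_linear_power poly_power)
  then show ?thesis by blast
qed

lemma min_area_le:
  assumes "p \<in> monic_polys_zeros_in n K"
  shows "min_area n K t \<le> measure lebesgue (filled_lemniscate p t)"
  unfolding min_area_def
  by (rule cINF_lower[OF _ assms]) (auto intro!: bdd_belowI2[where m = 0])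

lemma min_area_ge:
  assumes "w \<in> K" "\<And>p. p \<in> monic_polys_zeros_in n K \<Longrightarrow> x \<le> measure lebesgue (filled_lemniscate p t)"
  shows "x \<le> min_area n K t"
  unfolding min_area_def by (rule cINF_greatest[OF monic_polys_nonempty[OF assms(1)] assms(2)])

lemma min_area_mono:
  assumes "w \<in> K" "K \<subseteq> K'"
  shows "min_area n K' t \<le> min_area n K t"
proof (rule min_area_ge[OF assms(1)])
  fix p assume "p \<in> monic_polys_zeros_in n K"
  then have "p \<in> monic_polys_zeros_in n K'"
    using assms(2) unfolding monic_polys_zeros_in_def by blast
  then show "min_area n K' t \<le> measure lebesgue (filled_lemniscate p t)"
    by (rule min_area_le)
qed

text \<open>The outer width is twice the inner one because
  \<open>(1 + 2 * d) * (1 - d) \<ge> 1\<close> for \<open>d \<le> 1/2\<close>; then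
  \<open>(1 - d) ^ N \<le> 1/2\<close> yields \<open>(1 + 2 * d) ^ N \<ge> 2\<close>.\<close>

lemma annulus_measure:
  fixes d :: real
  assumes "0 < d" "d \<le> 1/2"
  shows "cball 0 (1 + 2 * d) - ball (0::complex) (1 - d) \<in> lmeasurable"
    and "measure lebesgue (cball 0 (1 + 2 * d) - ball (0::complex) (1 - d)) \<le> 32 * d"
proof -
  show "cball 0 (1 + 2 * d) - ball (0::complex) (1 - d) \<in> lmeasurable"
    by (intro fmeasurable.Diff lmeasurable_cball lmeasurable_ball)
  have "measure lebesgue (cball 0 (1 + 2 * d) - ball (0::complex) (1 - d))
     = measure lebesgue (cball 0 (1 + 2 * d) :: complex set) - measure lebesgue (ball (0::complex) (1 - d))"
    by (rule measurable_measure_Diff) (use assms in \<open>auto intro!: lmeasurable_ball\<close>)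
  also have "\<dots> = pi * (1 + 2 * d)\<^sup>2 - pi * (1 - d)\<^sup>2"
    using assms content_cball[of "1 + 2 * d" "0::complex"] content_ball[of "1 - d" "0::complex"]
    by (simp add: unit_ball_vol_2)
  also have "\<dots> = pi * (6 * d + 3 * d * d)"
    by (simp add: power2_eq_square algebra_simps)
  also have "\<dots> \<le> 4 * (8 * d)"
  proof (rule mult_mono)
    have "3 * d * d \<le> 2 * d" using assms by simp
    then show "6 * d + 3 * d * d \<le> 8 * d" by simp
  qed (use pi_less_4 assms in auto)
  finally show "measure lebesgue (cball 0 (1 + 2 * d) - ball (0::complex) (1 - d)) \<le> 32 * d" by simp
qed

text \<open>Off the annulus, \<open>|q| \<le> 1\<close> implies \<open>|p| \<le> 1\<close> outside
  the disc and \<open>|p| \<le> 1 + 2 * k\<close> with \<open>k = (1 - d) ^ N\<close> inside. In the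
  latter case \<open>|p| > 1\<close> is possible only in the shell, as
  \<open>(1 + 2 * k)^2 \<le> 1 + 6 * k\<close>.\<close>

lemma min_area_sphere_le:
  assumes p: "p \<in> monic_polys_zeros_in n (cball 0 1)" and n: "1 \<le> n" and N: "1 \<le> N"
    and d: "0 < d" "d \<le> 1/2" and k: "(1 - d) ^ N \<le> 1/2" and e: "0 \<le> e" "6 * (1 - d) ^ N \<le> e ^ (2 * n)"
  shows "min_area (N + n) (sphere 0 1) 1 \<le> measure lebesgue (filled_lemniscate p 1) + 8 * real n * e + 32 * d"
proof -
  define q where "q = monom 1 N * p + refl_poly p"
  note q = balayage[OF p N, folded q_def]
  define k where "k = (1 - d) ^ N"
  have k0: "0 \<le> k" "k \<le> 1/2" using k d by (auto simp: k_def)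
  define S where "S = {z. \<bar>Re z\<bar> \<le> 1 \<and> \<bar>(cmod (poly p z))\<^sup>2 - 1\<bar> \<le> e ^ (2 * n)}"
  define A where "A = cball 0 (1 + 2 * d) - ball (0::complex) (1 - d)"
  have pl: "lead_coeff p = 1" "degree p = n"
    using p unfolding monic_polys_zeros_in_def by blast+
  have "closed S"
    unfolding S_def by (intro closed_Collect_conj closed_Collect_le continuous_intros)
  then have Sb: "S \<in> sets borel" by simp
  have Se: "emeasure lborel S \<le> ennreal (8 * real n * e)"
    unfolding S_def by (rule shell_measure[OF pl n e(1)])
  have Sl: "S \<in> lmeasurable"
    using Sb Se by (intro fmeasurableI) (auto simp: le_less_trans[OF _ ennreal_less_top])
  have Sm: "measure lebesgue S \<le> 8 * real n * e"
  proof -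
    have "measure lborel S \<le> 8 * real n * e"
      unfolding measure_def using Se e(1) by (intro enn2real_leI) auto
    then show ?thesis using Sb by simp
  qed
  have sub: "filled_lemniscate q 1 \<subseteq> filled_lemniscate p 1 \<union> S \<union> A"
  proof
    fix z assume "z \<in> filled_lemniscate q 1"
    then have z: "cmod (poly q z) \<le> 1" by (simp add: filled_lemniscate_def)
    consider "cmod z < 1 - d" | "1 + 2 * d < cmod z" | "z \<in> A"
      by (auto simp: A_def) linarith
    then show "z \<in> filled_lemniscate p 1 \<union> S \<union> A"
    proof cases
      case 1
      then have z1: "cmod z \<le> 1" using d by linarith
      have "cmod z ^ N \<le> k" unfolding k_def using 1 by (intro power_mono) auto
      then have "cmod (poly p z) * (1 - k) \<le> cmod (poly (refl_poly p) z) * (1 - cmod z ^ N)"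
        using k0 by (intro mult_mono refl_poly_bounds(1)[OF p z1]) auto
      also have "\<dots> \<le> 1" using q(2)[OF z1] z by linarith
      finally have "cmod (poly p z) * (1 - k) \<le> (1 + 2 * k) * (1 - k)"
      proof (rule order_trans)
        have "0 \<le> k * (1 - 2 * k)" using k0 by (intro mult_nonneg_nonneg) auto
        then show "1 \<le> (1 + 2 * k) * (1 - k)" by (simp add: algebra_simps)
      qed
      then have le: "cmod (poly p z) \<le> 1 + 2 * k" using k0 by (simp add: mult_le_cancel_right)
      show ?thesis
      proof (cases "cmod (poly p z) \<le> 1")
        case False
        then have "1\<^sup>2 \<le> (cmod (poly p z))\<^sup>2" by (intro power_mono) auto
        moreover have "(cmod (poly p z))\<^sup>2 \<le> (1 + 2 * k)\<^sup>2" using le by (intro power_mono) auto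
        moreover have "(1 + 2 * k)\<^sup>2 \<le> 1 + 6 * k"
        proof -
          have "4 * (k * k) \<le> 4 * (k * (1/2))" using k0 by (intro mult_left_mono) auto
          then show ?thesis by (simp add: power2_eq_square algebra_simps)
        qed
        ultimately have "\<bar>(cmod (poly p z))\<^sup>2 - 1\<bar> \<le> e ^ (2 * n)"
          using e(2) by (simp add: k_def)
        moreover have "\<bar>Re z\<bar> \<le> 1" using z1 abs_Re_le_cmod[of z] by linarith
        ultimately show ?thesis by (simp add: S_def)
      qed (simp add: filled_lemniscate_def)
    next
      case 2
      then have z1: "1 \<le> cmod z" using d by linarith
      have "1 ^ N \<le> ((1 + 2 * d) * (1 - d)) ^ N"
      proof (rule power_mono)
        have "0 \<le> d * (1 - 2 * d)" using d by (intro mult_nonneg_nonneg) auto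
        then show "1 \<le> (1 + 2 * d) * (1 - d)" by (simp add: algebra_simps)
      qed simp
      also have "\<dots> = (1 + 2 * d) ^ N * k" by (simp add: power_mult_distrib k_def)
      also have "\<dots> \<le> (1 + 2 * d) ^ N * (1/2)" using k0 d by (intro mult_left_mono) auto
      finally have "2 \<le> (1 + 2 * d) ^ N" by simp
      also have "\<dots> \<le> cmod z ^ N" using 2 d by (intro power_mono) auto
      finally have "cmod (poly p z) * 1 \<le> cmod (poly p z) * (cmod z ^ N - 1)"
        by (intro mult_left_mono) auto
      also have "\<dots> \<le> 1" using q(3)[OF z1] z by linarith
      finally show ?thesis by (simp add: filled_lemniscate_def)
    qed blast
  qed
  have Pl: "filled_lemniscate p 1 \<in> lmeasurable"
    by (rule filled_lemniscate_lmeasurable[OF p n])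
  note Al = annulus_measure[OF d, folded A_def]
  have "min_area (N + n) (sphere 0 1) 1 \<le> measure lebesgue (filled_lemniscate q 1)"
    by (rule min_area_le[OF q(1)])
  also have "\<dots> \<le> measure lebesgue (filled_lemniscate p 1 \<union> S \<union> A)"
    using sub filled_lemniscate_closed[of q 1] Pl Sl Al(1)
    by (intro measure_mono_fmeasurable) (auto intro!: fmeasurable.Un)
  also have "\<dots> \<le> measure lebesgue (filled_lemniscate p 1 \<union> S) + measure lebesgue A"
    using Pl Sl Al(1) by (intro measure_Un_le) (auto intro!: fmeasurableD fmeasurable.Un)
  also have "measure lebesgue (filled_lemniscate p 1 \<union> S) \<le> measure lebesgue (filled_lemniscate p 1) + measure lebesgue S"
    using Pl Sl by (intro measure_Un_le) (auto intro!: fmeasurableD)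
  finally show ?thesis using Sm Al(2) by linarith
qed

lemma min_area_sphere_ge:
  assumes "2 \<le> n"
  shows "exp (-120) / 108000000 / ln n \<le> min_area n (sphere 0 1) 1"
  using assms by (intro min_area_ge[of 1] lemniscate_area_ge) auto

text \<open>Write \<open>l = ln n\<close>. The annulus with \<open>d = 1 / l^2\<close> costs
  \<open>32 / l^2\<close>. Since \<open>N\<close> is about \<open>n * l^4\<close>,
  \<open>(1 - d) ^ N \<le> exp (- n * l^2 / 2)\<close>, which permits
  \<open>e = exp (- l^2 / 8)\<close> and a shell of area at most \<open>1 / l^2\<close>. The total
  \<open>33 / l^2\<close> is at most two thirds of the minimal area on the circle, which is at least
  \<open>c / (2 * l)\<close>.\<close>

lemma min_area_cball_ge:
  fixes c :: real
  assumes c: "0 < c" and lower: "\<And>n. 2 \<le> n \<Longrightarrow> c / ln (real n) \<le> min_area n (sphere 0 1) 1"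
  shows "\<forall>\<^sub>F n in sequentially. c / 6 / ln (real n) \<le> (1/3) * min_area (n * nat \<lfloor>(ln (real n)) ^ 4\<rfloor>) (sphere 0 1) 1 \<and>
     (1/3) * min_area (n * nat \<lfloor>(ln (real n)) ^ 4\<rfloor>) (sphere 0 1) 1 \<le> min_area n (cball 0 1) 1"
proof -
  have "\<forall>\<^sub>F n in sequentially. 3 \<le> ln (real n)" by real_asymp
  \<comment> \<open>This is \<open>33 / l^2 \<le> 2/3 * (c / (2 * l))\<close> solved for
    \<open>l\<close>.\<close>
  moreover have "\<forall>\<^sub>F n in sequentially. 99 / c \<le> ln (real n)"
    using c by real_asymp
  moreover have "\<forall>\<^sub>F n in sequentially. ln (real n * (ln (real n)) ^ 4) \<le> 2 * ln (real n)" by real_asymp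
  moreover have "\<forall>\<^sub>F n in sequentially. 8 * real n * exp (- (ln (real n))\<^sup>2 / 8) \<le> 1 / (ln (real n))\<^sup>2" by real_asymp
  moreover have "\<forall>\<^sub>F n in sequentially. 6 * exp (- real n * (ln (real n))\<^sup>2 / 2) \<le> exp (- real n * (ln (real n))\<^sup>2 / 4)" by real_asymp
  moreover have "\<forall>\<^sub>F n in sequentially. 2 \<le> n" by (rule eventually_ge_at_top)
  ultimately show ?thesis
  proof eventually_elim
    fix n :: nat
    assume l3: "3 \<le> ln (real n)" and lc: "99 / c \<le> ln (real n)"
      and l2: "ln (real n * (ln (real n)) ^ 4) \<le> 2 * ln (real n)"
      and e8: "8 * real n * exp (- (ln (real n))\<^sup>2 / 8) \<le> 1 / (ln (real n))\<^sup>2"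
      and e6: "6 * exp (- real n * (ln (real n))\<^sup>2 / 2) \<le> exp (- real n * (ln (real n))\<^sup>2 / 4)"
      and n2: "2 \<le> n"
    define l where "l = ln (real n)"
    define L where "L = nat \<lfloor>l ^ 4\<rfloor>"
    \<comment> \<open>One unit less than \<open>L\<close>, since balayage adds \<open>N\<close> to
      the degree \<open>n\<close> and the sum has to be \<open>n * L\<close>.\<close>
    define N where "N = n * (L - 1)"
    define d where "d = 1 / l\<^sup>2"
    define e where "e = exp (- l\<^sup>2 / 8)"
    have l: "3 \<le> l" using l3 by (simp add: l_def)
    have l2': "9 \<le> l\<^sup>2" using power_mono[OF l, of 2] by simp
    have l4: "l ^ 4 = l\<^sup>2 * l\<^sup>2" by (simp flip: power_add)
    have L_le: "real L \<le> l ^ 4" unfolding L_def using l by (simp add: of_nat_nat)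
    have L_ge: "l ^ 4 - 1 \<le> real L" unfolding L_def by linarith
    have l481: "81 \<le> l ^ 4" unfolding l4 using mult_mono[OF l2' l2'] by simp
    then have L2: "2 \<le> L" using L_ge by linarith
    have NL: "N + n = n * L" using L2 unfolding N_def by (cases L) auto
    have N1: "1 \<le> N" using L2 n2 unfolding N_def by simp
    have "d \<le> 1 / 9" unfolding d_def by (rule frac_le) (use l2' in auto)
    then have d: "0 < d" "d \<le> 1/2" using l by (auto simp: d_def)
    have kexp: "(1 - d) ^ N \<le> exp (- real n * l\<^sup>2 / 2)"
    proof -
      have "(1 - d) ^ N \<le> exp (- d) ^ N"
        using d exp_ge_add_one_self[of "-d"] by (intro power_mono) auto
      also have "\<dots> = exp (- (d * N))" by (simp add: mult.commute flip: exp_of_nat_mult)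
      also have "\<dots> \<le> exp (- real n * l\<^sup>2 / 2)"
      proof -
        have "l ^ 4 / 2 \<le> real L - 1" using L_ge l481 by linarith
        then have "d * (real n * (l ^ 4 / 2)) \<le> d * (real n * (real L - 1))"
          using d by (intro mult_left_mono) auto
        moreover have "d * (real n * (l ^ 4 / 2)) = real n * l\<^sup>2 / 2"
        proof -
          have "1 / x * (x * x) = x" if "x \<noteq> 0" for x :: real
            using that by simp
          from this[of "l\<^sup>2"] have "d * l ^ 4 = l\<^sup>2"
            unfolding d_def l4 using l2' by linarith
          moreover have "d * (real n * (l ^ 4 / 2)) = real n * (d * l ^ 4) / 2"
            by simp
          ultimately show ?thesis by (simp only:)
        qed
        moreover have "real N = real n * (real L - 1)"
          using L2 by (simp add: N_def of_nat_diff)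
        ultimately have "real n * l\<^sup>2 / 2 \<le> d * real N"
          by (simp only:)
        then show ?thesis
          unfolding exp_le_cancel_iff by simp
      qed
      finally show ?thesis .
    qed
    have k6: "6 * (1 - d) ^ N \<le> e ^ (2 * n)"
    proof -
      have "6 * (1 - d) ^ N \<le> 6 * exp (- real n * l\<^sup>2 / 2)" using kexp by simp
      also have "\<dots> \<le> exp (- real n * l\<^sup>2 / 4)" using e6 by (simp add: l_def)
      also have "\<dots> = e ^ (2 * n)"
        unfolding e_def exp_of_nat_mult[symmetric] by simp
      finally show ?thesis .
    qed
    have k12: "(1 - d) ^ N \<le> 1/2"
    proof -
      have "e ^ (2 * n) \<le> 1" by (rule power_le_one) (auto simp: e_def)
      then show ?thesis using k6 by linarith
    qed
    have n_L2: "2 \<le> n * L" using n2 L2 by (metis le_trans mult_le_mono1 mult_2 le_add1)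
    have lnL: "0 < ln (real (n * L))" "ln (real (n * L)) \<le> 2 * l"
    proof -
      have "real 2 \<le> real (n * L)"
        using n_L2 by (rule of_nat_mono)
      then have "1 < real (n * L)"
        by (rule less_le_trans[rotated]) simp
      then show "0 < ln (real (n * L))" by (rule ln_gt_zero)
      have "ln (real (n * L)) \<le> ln (real n * l ^ 4)"
        using n2 L2 L_le by (intro ln_mono) (auto intro!: mult_left_mono)
      then show "ln (real (n * L)) \<le> 2 * l" using l2 by (simp add: l_def)
    qed
    define m where "m = min_area (n * L) (sphere 0 1) 1"
    have m: "c / (2 * l) \<le> m"
    proof -
      have "c / (2 * l) \<le> c / ln (real (n * L))"
        using c lnL by (intro divide_left_mono) auto
      also have "\<dots> \<le> m" unfolding m_def by (rule lower[OF n_L2])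
      finally show ?thesis .
    qed
    have err: "8 * real n * e + 32 * d \<le> 2/3 * m"
    proof -
      have "8 * real n * e + 32 * d \<le> 33 / l\<^sup>2"
        using e8 by (simp add: e_def d_def l_def)
      also have "\<dots> = (33 / l) / l" by (simp add: power2_eq_square)
      also have "\<dots> \<le> (c / 3) / l"
        using lc l c by (intro divide_right_mono) (auto simp: l_def field_simps)
      also have "\<dots> = 2/3 * (c / (2 * l))" by simp
      also have "\<dots> \<le> 2/3 * m" using m by simp
      finally show ?thesis .
    qed
    have "(1/3) * m \<le> min_area n (cball 0 1) 1"
    proof (rule min_area_ge[of 0])
      fix p assume p: "p \<in> monic_polys_zeros_in n (cball 0 1)"
      have "m \<le> measure lebesgue (filled_lemniscate p 1) + 8 * real n * e + 32 * d"
        unfolding m_def NL[symmetric]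
        by (rule min_area_sphere_le[OF p _ N1 d k12 _ k6]) (use n2 in \<open>auto simp: e_def\<close>)
      with err show "(1/3) * m \<le> measure lebesgue (filled_lemniscate p 1)" by linarith
    qed simp
    moreover have "c / 6 / l \<le> (1/3) * m"
    proof -
      have "c / 6 / l = (1/3) * (c / (2 * l))" by simp
      then show ?thesis using m by simp
    qed
    ultimately show "c / 6 / ln (real n) \<le> (1/3) * min_area (n * nat \<lfloor>(ln (real n)) ^ 4\<rfloor>) (sphere 0 1) 1 \<and>
     (1/3) * min_area (n * nat \<lfloor>(ln (real n)) ^ 4\<rfloor>) (sphere 0 1) 1 \<le> min_area n (cball 0 1) 1"
      by (simp only: m_def L_def l_def)
  qed
qed

section \<open>Pole pushing\<close>

text \<open>Partial sum of the power series of \<open>w / (1 + w)\<close>, the map that sends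
  \<open>1 / W\<close> to \<open>1 / (W + 1)\<close>.\<close>

definition shift_poly :: "nat \<Rightarrow> complex poly" where
  "shift_poly k = [:0, 1:] * (\<Sum>i<k. monom ((-1) ^ i) i)"

primrec shift_iter :: "nat \<Rightarrow> complex poly \<Rightarrow> nat \<Rightarrow> complex poly" where
  "shift_iter k p 0 = p"
| "shift_iter k p (Suc i) = shift_poly k \<circ>\<^sub>p shift_iter k p i"

lemma poly_shift_poly: "poly (shift_poly k) w = w * (\<Sum>i<k. (- w) ^ i)"
proof -
  have "(-1) ^ i * w ^ i = (- w) ^ i" for i
    by (simp flip: power_mult_distrib)
  then show ?thesis
    by (simp add: shift_poly_def poly_sum poly_monom)
qed

lemma degree_shift_poly: "degree (shift_poly k) \<le> k"
proof (cases k)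
  case 0
  then show ?thesis by (simp add: shift_poly_def)
next
  case (Suc k')
  have "degree (\<Sum>i<k. monom ((-1) ^ i) i :: complex poly) \<le> k'"
    using Suc by (intro degree_sum_le) (auto intro: order_trans[OF degree_monom_le])
  moreover have "degree (shift_poly k) \<le> degree [:0, 1 :: complex:] + degree (\<Sum>i<k. monom ((-1) ^ i) i :: complex poly)"
    unfolding shift_poly_def by (rule degree_mult_le)
  ultimately show ?thesis using Suc by simp
qed

lemma degree_shift_iter: "degree (shift_iter k p i) \<le> k ^ i * degree p"
proof (induction i)
  case (Suc i)
  have "degree (shift_iter k p (Suc i)) \<le> degree (shift_poly k) * degree (shift_iter k p i)"
    by (simp add: degree_pcompose)
  also have "\<dots> \<le> k * (k ^ i * degree p)"
    using Suc degree_shift_poly by (intro mult_mono) auto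
  finally show ?case by (simp add: mult.assoc)
qed simp

text \<open>Each step turns a bound \<open>M \<ge> 1\<close> into \<open>k * M ^ k\<close>. This
  crude estimate covers the points near the path of the pole, where the comparison with a
  translation fails.\<close>

lemma norm_shift_iter_le:
  assumes "cmod (poly p z) \<le> 1" "1 \<le> k"
  shows "cmod (poly (shift_iter k p i) z) \<le> real k ^ ((k + 1) ^ i)"
proof (induction i)
  case 0
  then show ?case using assms by simp
next
  case (Suc i)
  let ?w = "poly (shift_iter k p i) z" and ?M = "real k ^ ((k + 1) ^ i)"
  have M: "1 \<le> ?M" using assms(2) by (intro one_le_power) simp
  have "cmod (poly (shift_iter k p (Suc i)) z) = cmod ?w * cmod (\<Sum>j<k. (- ?w) ^ j)"
    by (simp add: poly_pcompose poly_shift_poly norm_mult)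
  also have "\<dots> = cmod (\<Sum>j<k. ?w * (- ?w) ^ j)"
    by (simp add: norm_mult sum_distrib_left[symmetric])
  also have "\<dots> \<le> (\<Sum>j<k. ?M ^ k)"
  proof (rule sum_norm_le)
    fix j assume j: "j \<in> {..<k}"
    have "cmod (?w * (- ?w) ^ j) = cmod ?w ^ Suc j"
      by (simp add: norm_mult norm_power)
    also have "\<dots> \<le> ?M ^ Suc j" using Suc by (intro power_mono) auto
    also have "\<dots> \<le> ?M ^ k" using j M by (intro power_increasing) auto
    finally show "cmod (?w * (- ?w) ^ j) \<le> ?M ^ k" .
  qed
  also have "\<dots> = real k ^ (1 + (k + 1) ^ i * k)"
    by (simp add: power_mult)
  also have "\<dots> \<le> real k ^ ((k + 1) ^ Suc i)"
    using assms(2) by (intro power_increasing) auto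
  finally show ?case .
qed

text \<open>In the coordinate \<open>W = 1 / w\<close> the map \<open>w \<mapsto> w (1 - (-w)^k) / (1 + w)\<close> is a small perturbation of
  the translation \<open>W \<mapsto> W + 1\<close>, whatever the size of \<open>W\<close> bounded away from the origin; iterating it moves
  a pole step by step along the positive axis.\<close>

lemma shift_step:
  assumes W: "4 \<le> cmod W" "cmod W \<le> M" and k: "1 \<le> k"
  defines "V \<equiv> inverse (poly (shift_poly k) (inverse W))"
  shows "poly (shift_poly k) (inverse W) \<noteq> 0" "cmod (V - (W + 1)) \<le> 2 * (M + 1) / 4 ^ k"
proof -
  define s where "s = (- inverse W) ^ k"
  have W0: "W \<noteq> 0" using W by auto
  have W1: "W + 1 \<noteq> 0"
  proof
    assume "W + 1 = 0"
    then have "W = -1" by (simp add: eq_neg_iff_add_eq_0)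
    then show False using W by simp
  qed
  have "cmod s = inverse (cmod W) ^ k" by (simp add: s_def norm_power norm_inverse)
  also have "\<dots> \<le> inverse 4 ^ k" using W by (intro power_mono le_imp_inverse_le) auto
  finally have s: "cmod s \<le> 1 / 4 ^ k" by (simp add: inverse_eq_divide power_one_over)
  have "(4::real) ^ 1 \<le> 4 ^ k" using k by (intro power_increasing) auto
  then have "1 / 4 ^ k \<le> (1/4 :: real)" by (simp add: field_simps)
  with s have s4: "cmod s \<le> 1/4" by linarith
  then have s1: "1 - s \<noteq> 0" by auto
  have s2: "1/2 \<le> cmod (1 - s)" using norm_triangle_ineq2[of 1 s] s4 by simp
  have "(1 + inverse W) * (\<Sum>i<k. (- inverse W) ^ i) = 1 - s"
    using one_diff_power_eq[of "- inverse W" k] by (simp add: s_def)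
  moreover have iw: "1 + inverse W \<noteq> 0" using W0 W1 by (simp add: field_simps add.commute)
  ultimately have "(\<Sum>i<k. (- inverse W) ^ i) = (1 - s) / (1 + inverse W)"
    by (simp add: eq_divide_eq mult.commute)
  then have v: "poly (shift_poly k) (inverse W) = (1 - s) / (W + 1)"
    unfolding poly_shift_poly using W0 W1 iw by (simp add: field_simps)
  then show "poly (shift_poly k) (inverse W) \<noteq> 0" using s1 W1 by simp
  have "V = (W + 1) / (1 - s)" by (simp add: V_def v)
  then have "V - (W + 1) = (W + 1) * s / (1 - s)" using s1 by (simp add: field_simps)
  then have "cmod (V - (W + 1)) = cmod (W + 1) * cmod s / cmod (1 - s)"
    by (simp add: norm_mult norm_divide)
  also have "\<dots> \<le> (M + 1) * (1 / 4 ^ k) / (1/2)"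
  proof (intro frac_le mult_mono s s2)
    show "cmod (W + 1) \<le> M + 1" using norm_triangle_ineq[of W 1] W by simp
    then show "0 \<le> (M + 1) * (1 / 4 ^ k)" using W by simp
  qed (use W in auto)
  also have "\<dots> = 2 * (M + 1) / 4 ^ k" by (simp add: mult.commute)
  finally show "cmod (V - (W + 1)) \<le> 2 * (M + 1) / 4 ^ k" .
qed

text \<open>Every step adds an error of at most \<open>2 * (M + 1) / 4 ^ k\<close> while the inverse
  of the iterate has modulus between 4 and \<open>M\<close>. The total error stays below 1 and the
  exact translates have modulus between 5 and \<open>M - 1\<close>, so the iterates never leave this
  range.\<close>

lemma shift_iter_close:
  assumes Y: "\<And>i. i \<le> m \<Longrightarrow> 5 \<le> cmod (Y + of_nat i) \<and> cmod (Y + of_nat i) + 1 \<le> M"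
    and p: "poly p z \<noteq> 0" "cmod (inverse (poly p z) - Y) \<le> 1/2" and k: "1 \<le> k"
    and e: "m * (2 * (M + 1) / 4 ^ k) \<le> 1/2" and im: "i \<le> m"
  shows "poly (shift_iter k p i) z \<noteq> 0 \<and>
     cmod (inverse (poly (shift_iter k p i) z) - (Y + of_nat i)) \<le> 1/2 + i * (2 * (M + 1) / 4 ^ k)"
  using im
proof (induction i)
  case 0
  then show ?case using p by simp
next
  case (Suc i)
  define W where "W = inverse (poly (shift_iter k p i) z)"
  let ?e = "2 * (M + 1) / 4 ^ k"
  have IH: "poly (shift_iter k p i) z \<noteq> 0" "cmod (W - (Y + of_nat i)) \<le> 1/2 + i * ?e"
    using Suc by (auto simp: W_def)
  have Yi: "5 \<le> cmod (Y + of_nat i)" "cmod (Y + of_nat i) + 1 \<le> M"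
    using Y[of i] Suc by auto
  then have e0: "0 \<le> ?e" by simp
  have "real i * ?e \<le> real m * ?e" using Suc e0 by (intro mult_right_mono) auto
  then have d1: "cmod (W - (Y + of_nat i)) \<le> 1" using IH(2) e by linarith
  have "cmod (Y + of_nat i) - cmod (W - (Y + of_nat i)) \<le> cmod W"
    using norm_triangle_ineq4[of W "W - (Y + of_nat i)"] by simp
  then have W4: "4 \<le> cmod W" using d1 Yi by linarith
  have "cmod W \<le> cmod (Y + of_nat i) + cmod (W - (Y + of_nat i))"
    using norm_triangle_ineq[of "Y + of_nat i" "W - (Y + of_nat i)"] by simp
  then have WM: "cmod W \<le> M" using d1 Yi by linarith
  have iW: "inverse W = poly (shift_iter k p i) z" by (simp add: W_def)
  note st = shift_step[OF W4 WM k]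
  have nz: "poly (shift_iter k p (Suc i)) z \<noteq> 0"
    using st(1) by (simp add: poly_pcompose iW)
  have a: "cmod (inverse (poly (shift_iter k p (Suc i)) z) - (W + 1)) \<le> ?e"
    using st(2) by (simp add: poly_pcompose iW)
  have eq: "inverse (poly (shift_iter k p (Suc i)) z) - (Y + of_nat (Suc i))
     = (inverse (poly (shift_iter k p (Suc i)) z) - (W + 1)) + (W - (Y + of_nat i))"
    by (simp add: algebra_simps)
  have "cmod (inverse (poly (shift_iter k p (Suc i)) z) - (Y + of_nat (Suc i))) \<le> ?e + (1/2 + i * ?e)"
    unfolding eq by (rule order_trans[OF norm_triangle_ineq add_mono[OF a IH(2)]])
  also have "\<dots> = 1/2 + real (Suc i) * ?e"
    by (simp add: distrib_right del: times_divide_eq_right times_divide_eq_left)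
  finally show ?case using nz by simp
qed

text \<open>Partial sum of the power series of \<open>1 / (K * (z - 2))\<close>. Its inverse is
  close to \<open>K * (z - 2)\<close>, so adding 1 to the inverse moves the pole by
  \<open>1 / K\<close> towards the disc.\<close>

definition pole_poly :: "nat \<Rightarrow> complex poly" where
  "pole_poly K = smult (- 1 / of_nat (2 * K)) (\<Sum>j<K. monom ((1/2) ^ j) j)"

lemma poly_pole_poly: "poly (pole_poly K) z = - 1 / of_nat (2 * K) * (\<Sum>j<K. (z / 2) ^ j)"
proof -
  have "(1/2) ^ j * z ^ j = (z / 2) ^ j" for j
    by (simp flip: power_mult_distrib)
  then show ?thesis
    by (simp add: pole_poly_def poly_sum poly_monom)
qed

lemma degree_pole_poly: "degree (pole_poly K) \<le> K"
proof -
  have "degree (\<Sum>j<K. monom ((1/2) ^ j) j :: complex poly) \<le> K"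
    by (intro degree_sum_le) (auto intro: order_trans[OF degree_monom_le])
  then show ?thesis
    unfolding pole_poly_def by (intro order_trans[OF degree_smult_le])
qed

lemma pole_poly_props:
  assumes z: "cmod z \<le> 1" and K: "1 \<le> K" "12 * real K \<le> 2 ^ K"
  shows "poly (pole_poly K) z \<noteq> 0"
    and "cmod (inverse (poly (pole_poly K) z) - of_nat K * (z - 2)) \<le> 1/2"
    and "cmod (poly (pole_poly K) z) \<le> 1"
proof -
  define s where "s = (z / 2) ^ K"
  have "cmod s = (cmod z / 2) ^ K" by (simp add: s_def norm_power norm_divide)
  also have "\<dots> \<le> (1/2) ^ K" using z by (intro power_mono) auto
  finally have s: "cmod s \<le> 1 / 2 ^ K" by (simp add: power_divide)
  have "1 / 2 ^ K \<le> 1 / (12 * real K)" using K by (intro divide_left_mono) auto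
  with s have sK: "cmod s \<le> 1 / (12 * real K)" by linarith
  also have "\<dots> \<le> 1/12" using K(1) by (intro divide_left_mono) auto
  finally have s12: "cmod s \<le> 1/12" .
  then have s1: "1 - s \<noteq> 0" by auto
  have s2: "1/2 \<le> cmod (1 - s)" using norm_triangle_ineq2[of 1 s] s12 by simp
  have z2: "z - 2 \<noteq> 0" using z by auto
  have "(1 - z / 2) * (\<Sum>j<K. (z / 2) ^ j) = 1 - s"
    using one_diff_power_eq[of "z / 2" K] by (simp add: s_def)
  moreover have "1 - z / 2 = - (z - 2) / 2" by (simp add: field_simps)
  ultimately have "(z - 2) * (\<Sum>j<K. (z / 2) ^ j) = - 2 * (1 - s)"
    by (simp add: field_simps)
  then have sum: "(\<Sum>j<K. (z / 2) ^ j) = - 2 * (1 - s) / (z - 2)"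
    using z2 by (simp only: eq_divide_eq mult.commute if_True not_False_eq_True)
  have v: "poly (pole_poly K) z = (1 - s) / (of_nat K * (z - 2))"
  proof -
    have "- 1 / (2 * a) * (- 2 * b / c) = b / (a * c)" for a b c :: complex
      by simp
    from this[of "of_nat K" "1 - s" "z - 2"] show ?thesis
      by (simp only: poly_pole_poly sum of_nat_mult of_nat_numeral)
  qed
  then show "poly (pole_poly K) z \<noteq> 0" using s1 z2 K by simp
  have "inverse (poly (pole_poly K) z) - of_nat K * (z - 2) = of_nat K * (z - 2) * s / (1 - s)"
    unfolding v using s1 by (simp add: field_simps)
  then have "cmod (inverse (poly (pole_poly K) z) - of_nat K * (z - 2)) = real K * cmod (z - 2) * cmod s / cmod (1 - s)"
    by (simp add: norm_mult norm_divide)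
  \<comment> \<open>The hypothesis \<open>12 * K \<le> 2 ^ K\<close> is made for this estimate: the
    initial error is 1/2, which leaves another 1/2 for all the steps together.\<close>
  also have "\<dots> \<le> (real K * 3 * (1 / (12 * real K))) / (1/2)"
  proof (intro frac_le mult_mono sK s2)
    show "cmod (z - 2) \<le> 3" using norm_triangle_ineq4[of z 2] z by simp
  qed auto
  also have "\<dots> = 1/2" using K by simp
  finally show "cmod (inverse (poly (pole_poly K) z) - of_nat K * (z - 2)) \<le> 1/2" .
  have z21: "1 \<le> cmod (z - 2)" using norm_triangle_ineq2[of 2 z] z by (simp add: norm_minus_commute)
  have "cmod (poly (pole_poly K) z) = (1 / (2 * real K)) * cmod (\<Sum>j<K. (z / 2) ^ j)"
    by (simp add: poly_pole_poly norm_mult norm_divide)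
  also have "\<dots> \<le> (1 / (2 * real K)) * (\<Sum>j<K. 1)"
  proof (intro mult_left_mono sum_norm_le)
    fix j
    have "cmod ((z / 2) ^ j) = (cmod z / 2) ^ j" by (simp add: norm_power norm_divide)
    also have "\<dots> \<le> 1" using z by (intro power_le_one) auto
    finally show "cmod ((z / 2) ^ j) \<le> 1" .
  qed auto
  also have "\<dots> \<le> 1" using K by simp
  finally show "cmod (poly (pole_poly K) z) \<le> 1" .
qed

text \<open>\<open>F\<close> imitates \<open>1 / (K * (z - 2) + m) = 1 / (K * z - 5)\<close>: its
  inverse at 0 is within 1 of -5, and off the strip its modulus is at most 1/19. In between only
  \<open>|F| \<le> B / 4\<close> is known. Hence \<open>S = 1 + (F - F(0)) / B\<close>, which cannot
  vanish because \<open>|F - F(0)| \<le> B / 2\<close>.\<close>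

lemma tongue_poly:
  assumes K: "3 \<le> K" "12 * real K \<le> 2 ^ K" "2 * real K * (2 * (6 * real K + 1) / 4 ^ K) \<le> 1/2"
  defines "B \<equiv> 4 * real K ^ ((K + 1) ^ (2 * K))"
  obtains S :: "complex poly" where "degree S \<le> K ^ (2 * K) * K" "poly S 0 = 1"
    "\<And>z. cmod z \<le> 1 \<Longrightarrow> poly S z \<noteq> 0"
    "\<And>z. cmod z \<le> 1 \<Longrightarrow> 20 / real K \<le> \<bar>Im z\<bar> \<Longrightarrow> 1 + 1 / (20 * B) \<le> cmod (poly S z)"
proof -
  \<comment> \<open>The pole stops at \<open>5 / K\<close>, so that at \<open>z = 0\<close> all
    translates \<open>i - 2 * K\<close> with \<open>i \<le> m\<close> have modulus at least 5. For
    \<open>K \<ge> 3\<close> the subtraction is not truncated.\<close>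
  define m where "m = 2 * K - 5"
  define F where "F = shift_iter K (pole_poly K) m"
  have m: "m \<le> 2 * K" "m + 5 = 2 * K \<or> m = 0" by (auto simp: m_def)
  have B4: "4 \<le> B"
    using one_le_power[of "real K" "(K + 1) ^ (2 * K)"] K(1) by (simp add: B_def)
  have e: "real m * (2 * (6 * real K + 1) / 4 ^ K) \<le> 1/2"
  proof -
    have "real m * (2 * (6 * real K + 1) / 4 ^ K) \<le> 2 * real K * (2 * (6 * real K + 1) / 4 ^ K)"
      using m(1) by (intro mult_right_mono) auto
    then show ?thesis using K(3) by linarith
  qed
  have K1: "1 \<le> K" using K by simp
  have F_bound: "cmod (poly F z) \<le> B / 4" if "cmod z \<le> 1" for z
  proof -
    have "cmod (poly F z) \<le> real K ^ ((K + 1) ^ m)"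
      unfolding F_def by (rule norm_shift_iter_le[OF pole_poly_props(3)[OF that K1 K(2)] K1])
    also have "\<dots> \<le> real K ^ ((K + 1) ^ (2 * K))"
      using K m(1) by (intro power_increasing) auto
    finally show ?thesis by (simp add: B_def)
  qed
  have close: "poly F z \<noteq> 0 \<and> cmod (inverse (poly F z) - (of_nat K * (z - 2) + of_nat m)) \<le> 1"
    if z: "cmod z \<le> 1" and Y: "\<And>i. i \<le> m \<Longrightarrow> 5 \<le> cmod (of_nat K * (z - 2) + of_nat i)" for z
  proof -
    have "cmod (of_nat K * (z - 2) + of_nat i) + 1 \<le> 6 * real K" if "i \<le> m" for i
    proof -
      have "cmod (of_nat K * (z - 2) + of_nat i) \<le> real K * cmod (z - 2) + real i"
        using norm_triangle_ineq[of "of_nat K * (z - 2)" "of_nat i"] by (simp add: norm_mult)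
      also have "\<dots> \<le> real K * 3 + real (2 * K)"
      proof (intro add_mono mult_left_mono)
        show "cmod (z - 2) \<le> 3" using norm_triangle_ineq4[of z 2] z by simp
        show "real i \<le> real (2 * K)" using that m(1) by linarith
      qed simp
      finally show ?thesis using K(1) by simp
    qed
    then have "poly F z \<noteq> 0 \<and> cmod (inverse (poly F z) - (of_nat K * (z - 2) + of_nat m)) \<le> 1/2 + m * (2 * (6 * real K + 1) / 4 ^ K)"
      unfolding F_def using Y
      by (intro shift_iter_close[OF _ pole_poly_props(1,2)[OF z K1 K(2)] K1 e]) auto
    with e show ?thesis by linarith
  qed
  have m5: "m + 5 = 2 * K" using K by (simp add: m_def)
  \<comment> \<open>The inverse \<open>W\<close> of \<open>F(0)\<close> lies within 1 of -5, so
    \<open>- Re W \<ge> 4\<close> and \<open>|W| \<le> 6\<close>; the bound is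
    \<open>4 / 36\<close>.\<close>
  have F0: "1/9 \<le> Re (- poly F 0)"
  proof -
    have "5 \<le> cmod (of_nat K * (0 - 2) + of_nat i)" if "i \<le> m" for i
    proof -
      have "complex_of_nat K * (0 - 2) + of_nat i = - of_real (2 * real K - real i)" by simp
      then have "cmod (complex_of_nat K * (0 - 2) + of_nat i) = \<bar>2 * real K - real i\<bar>"
        by (simp only: norm_minus_cancel norm_of_real)
      then show ?thesis using that m5 by linarith
    qed
    then have c: "poly F 0 \<noteq> 0" "cmod (inverse (poly F 0) - (of_nat K * (0 - 2) + of_nat m)) \<le> 1"
      using close[of 0] by auto
    have "complex_of_nat K * (0 - 2) + of_nat m = - 5"
    proof -
      have "complex_of_nat (m + 5) = of_nat (2 * K)" by (simp only: m5)
      then have "complex_of_nat m + 5 = 2 * of_nat K" by simp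
      then show ?thesis by (simp add: algebra_simps)
    qed
    then have c2: "cmod (inverse (poly F 0) + 5) \<le> 1" using c(2) by simp
    define W where "W = inverse (poly F 0)"
    have "\<bar>Re (W + 5)\<bar> \<le> 1" using abs_Re_le_cmod[of "W + 5"] c2 by (simp add: W_def)
    then have ReW: "4 \<le> - Re W" by simp
    have "cmod W \<le> 6" using c2 norm_triangle_ineq4[of "W + 5" 5] by (simp add: W_def)
    then have W6: "(cmod W)\<^sup>2 \<le> 36" using power_mono[of "cmod W" 6 2] by simp
    have "W \<noteq> 0" using c(1) by (simp add: W_def)
    then have Wp: "0 < (cmod W)\<^sup>2" by simp
    have "Re (- poly F 0) = - Re W / (cmod W)\<^sup>2"
    proof -
      have "poly F 0 = inverse W" by (simp add: W_def)
      then show ?thesis by (simp add: cmod_power2)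
    qed
    moreover have "4 / 36 \<le> - Re W / (cmod W)\<^sup>2"
      using ReW W6 Wp by (intro frac_le) auto
    ultimately show ?thesis by simp
  qed
  \<comment> \<open>Translations along the real axis do not change the imaginary part
    \<open>K * Im z\<close>, so every translate has modulus at least 20. The gain
    \<open>1/9 - 1/19\<close> exceeds 1/20.\<close>
  have Fz: "cmod (poly F z) \<le> 1/19" if z: "cmod z \<le> 1" "20 / real K \<le> \<bar>Im z\<bar>" for z
  proof -
    have Y20: "20 \<le> cmod (of_nat K * (z - 2) + of_nat i)" for i
    proof -
      have "20 \<le> real K * \<bar>Im z\<bar>" using z(2) K1 by (simp add: pos_divide_le_eq mult.commute)
      also have "\<dots> = \<bar>Im (of_nat K * (z - 2) + of_nat i)\<bar>" by (simp add: abs_mult)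
      also have "\<dots> \<le> cmod (of_nat K * (z - 2) + of_nat i)" by (rule abs_Im_le_cmod)
      finally show ?thesis .
    qed
    then have c: "poly F z \<noteq> 0" "cmod (inverse (poly F z) - (of_nat K * (z - 2) + of_nat m)) \<le> 1"
    proof -
      have "5 \<le> cmod (of_nat K * (z - 2) + of_nat i)" for i
        using Y20[of i] by linarith
      from close[OF z(1) this] show "poly F z \<noteq> 0" "cmod (inverse (poly F z) - (of_nat K * (z - 2) + of_nat m)) \<le> 1"
        by blast+
    qed
    have "19 \<le> cmod (inverse (poly F z))"
      using c(2) Y20[of m] norm_triangle_ineq4[of "inverse (poly F z)" "inverse (poly F z) - (of_nat K * (z - 2) + of_nat m)"]
      by simp
    then have "19 \<le> 1 / cmod (poly F z)"
      unfolding norm_inverse by (simp only: inverse_eq_divide)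
    moreover have "0 < cmod (poly F z)" using c(1) by simp
    ultimately have "19 * cmod (poly F z) \<le> 1"
      by (simp only: pos_le_divide_eq)
    then show ?thesis by simp
  qed
  define S where "S = 1 + smult (of_real (1 / B)) (F - [:poly F 0:])"
  have Sz: "poly S z = 1 + of_real (1 / B) * (poly F z - poly F 0)" for z
    by (simp add: S_def)
  show ?thesis
  proof (rule that)
    have "degree F \<le> K ^ m * degree (pole_poly K)"
      unfolding F_def by (rule degree_shift_iter)
    also have "\<dots> \<le> K ^ (2 * K) * K"
      using K1 m(1) degree_pole_poly by (intro mult_mono power_increasing) auto
    finally have dF: "degree F \<le> K ^ (2 * K) * K" .
    have "degree (F - [:poly F 0:]) \<le> K ^ (2 * K) * K"
      using dF by (intro degree_diff_le) auto
    then show "degree S \<le> K ^ (2 * K) * K"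
      unfolding S_def by (intro degree_add_le order_trans[OF degree_smult_le]) auto
    show "poly S 0 = 1" by (simp add: Sz)
    show "poly S z \<noteq> 0" if "cmod z \<le> 1" for z
    proof
      assume "poly S z = 0"
      then have "of_real (1 / B) * (poly F z - poly F 0) = -1"
        unfolding Sz by (simp add: eq_neg_iff_add_eq_0 add.commute)
      then have "cmod (of_real (1 / B) * (poly F z - poly F 0)) = 1" by simp
      then have "cmod (poly F z - poly F 0) = B" using B4 by (simp add: norm_mult norm_divide field_simps)
      moreover have "cmod (poly F z - poly F 0) \<le> B / 4 + B / 4"
        using norm_triangle_ineq4[of "poly F z" "poly F 0"] F_bound[OF that] F_bound[of 0] by simp
      ultimately show False using B4 by simp
    qed
    show "1 + 1 / (20 * B) \<le> cmod (poly S z)" if "cmod z \<le> 1" "20 / real K \<le> \<bar>Im z\<bar>" for z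
    proof -
      have "\<bar>Re (poly F z)\<bar> \<le> 1/19" using abs_Re_le_cmod[of "poly F z"] Fz[OF that] by linarith
      then have "1/20 \<le> Re (poly F z - poly F 0)" using F0 by simp
      then have "1 / B * (1/20) \<le> 1 / B * Re (poly F z - poly F 0)" using B4 by (intro mult_left_mono) auto
      then have "1 + 1 / (20 * B) \<le> Re (poly S z)" by (simp add: Sz)
      also have "\<dots> \<le> cmod (poly S z)" by (rule complex_Re_le_cmod)
      finally show ?thesis .
    qed
  qed
qed

section \<open>The upper bound on the circle\<close>

lemma refl_poly_monic:
  assumes S0: "poly S 0 = 1" and nz: "\<And>z. cmod z \<le> 1 \<Longrightarrow> poly S z \<noteq> 0"
  shows "refl_poly S \<in> monic_polys_zeros_in (degree S) (cball 0 1)"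
    and "z \<noteq> 0 \<Longrightarrow> cmod (poly (refl_poly (refl_poly S)) z) = cmod (poly S z)"
    and "z \<noteq> 0 \<Longrightarrow> cmod (poly (refl_poly S) z) = cmod z ^ degree S * cmod (poly S (inverse (cnj z)))"
proof -
  \<comment> \<open>The constant term becomes the leading coefficient of the reflection, so the
    degree does not drop and the reflection is monic.\<close>
  have c0: "coeff S 0 = 1" using S0 by (simp add: poly_0_coeff_0)
  have d: "degree (refl_poly S) = degree S"
    unfolding refl_poly_def by (subst degree_map_poly) (auto simp: c0)
  have "lead_coeff (refl_poly S) = 1"
    unfolding d unfolding refl_poly_def using c0
    by (simp add: coeff_map_poly coeff_reflect_poly)
  moreover have "cmod z \<le> 1" if "poly (refl_poly S) z = 0" for z
  proof (rule ccontr)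
    assume z: "\<not> cmod z \<le> 1"
    then have "z \<noteq> 0" by auto
    then have "poly S (inverse (cnj z)) = 0"
      using that by (simp add: poly_refl_nz)
    moreover have "cmod (inverse (cnj z)) \<le> 1"
      using z by (simp add: norm_inverse inverse_le_1_iff)
    ultimately show False using nz by blast
  qed
  ultimately show "refl_poly S \<in> monic_polys_zeros_in (degree S) (cball 0 1)"
    using d unfolding monic_polys_zeros_in_def by auto
  show n1: "cmod (poly (refl_poly S) z) = cmod z ^ degree S * cmod (poly S (inverse (cnj z)))" if "z \<noteq> 0" for z
    using that by (simp add: poly_refl_nz norm_mult norm_power)
  show "cmod (poly (refl_poly (refl_poly S)) z) = cmod (poly S z)" if "z \<noteq> 0"
  proof -
    have "cmod (poly (refl_poly (refl_poly S)) z) = cmod z ^ degree S * cmod (poly (refl_poly S) (inverse (cnj z)))"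
      by (simp only: poly_refl_nz[OF that, of "refl_poly S"] d norm_mult norm_power complex_mod_cnj)
    also have "\<dots> = cmod z ^ degree S * (inverse (cmod z) ^ degree S * cmod (poly S z))"
      using that by (subst n1) (simp_all add: norm_inverse)
    also have "\<dots> = cmod (poly S z)"
      using that by (simp flip: power_mult_distrib mult.assoc)
    finally show ?thesis .
  qed
qed

text \<open>Balayage of \<open>p = refl_poly S\<close>, whose own reflection has the modulus of
  \<open>S\<close>. Off strip and annulus, inside the disc \<open>|S| \<ge> 1 + 2 * x\<close> beats
  \<open>|z| ^ N \<le> x\<close>. Outside, \<open>|p| > 1\<close> by reflection and
  \<open>|z| ^ N \<ge> 2\<close>. The hypothesis on \<open>n\<close> leaves
  \<open>N \<ge> K * ln (40 * B)\<close> after subtracting the degree of \<open>S\<close>.\<close>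

lemma min_area_sphere_small:
  assumes K: "3 \<le> K" "12 * real K \<le> 2 ^ K" "2 * real K * (2 * (6 * real K + 1) / 4 ^ K) \<le> 1/2"
  defines "B \<equiv> 4 * real K ^ ((K + 1) ^ (2 * K))"
  assumes n: "real K ^ (2 * K) * K + K * ln (40 * B) + K \<le> real n"
  shows "min_area n (sphere 0 1) 1 \<le> 672 / K"
proof -
  obtain S where S: "degree S \<le> K ^ (2 * K) * K" "poly S 0 = 1"
    "\<And>z. cmod z \<le> 1 \<Longrightarrow> poly S z \<noteq> 0"
    "\<And>z. cmod z \<le> 1 \<Longrightarrow> 20 / real K \<le> \<bar>Im z\<bar> \<Longrightarrow> 1 + 1 / (20 * B) \<le> cmod (poly S z)"
    using tongue_poly[OF K] unfolding B_def by blast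
  have B4: "4 \<le> B"
    using one_le_power[of "real K" "(K + 1) ^ (2 * K)"] K(1) by (simp add: B_def)
  define p where "p = refl_poly S"
  have p1: "p \<in> monic_polys_zeros_in (degree S) (cball 0 1)"
    unfolding p_def by (rule refl_poly_monic(1)[OF S(2)], rule S(3))
  have p2: "cmod (poly (refl_poly p) z) = cmod (poly S z)" if "z \<noteq> 0" for z
    unfolding p_def by (rule refl_poly_monic(2)[OF S(2) _ that], rule S(3))
  have p3: "cmod (poly p z) = cmod z ^ degree S * cmod (poly S (inverse (cnj z)))" if "z \<noteq> 0" for z
    unfolding p_def by (rule refl_poly_monic(3)[OF S(2) _ that], rule S(3))
  note p = p1 p2 p3
  have dS: "real (degree S) \<le> real K ^ (2 * K) * K"
  proof -
    have "real (degree S) \<le> real (K ^ (2 * K) * K)" using S(1) by (simp only: of_nat_le_iff)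
    then show ?thesis by simp
  qed
  have lnB: "0 \<le> K * ln (40 * B)" using B4 by (intro mult_nonneg_nonneg ln_ge_zero) auto
  define N where "N = n - degree S"
  have nN: "n = N + degree S" and NK: "K * ln (40 * B) + K \<le> real N"
  proof -
    have "real (degree S) \<le> real n" using dS n lnB by linarith
    then have "degree S \<le> n" by simp
    then show "n = N + degree S" by (simp add: N_def)
    then show "K * ln (40 * B) + K \<le> real N" using dS n by simp
  qed
  have KN: "real K \<le> real N" using NK lnB by linarith
  then have N1: "1 \<le> N" using K(1) by simp
  define q where "q = monom 1 N * p + refl_poly p"
  note q = balayage[OF p(1) N1, folded q_def]
  define d where "d = 1 / real K"
  have d: "0 < d" "d \<le> 1/2" using K(1) by (auto simp: d_def field_simps)
  \<comment> \<open>Half of the guaranteed excess of \<open>|S|\<close> over 1;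
    \<open>(1 + 2 * x) * (1 - x) > 1\<close> since \<open>0 < x < 1/2\<close>.\<close>
  define x where "x = 1 / (40 * B)"
  have x: "0 < x" "x \<le> 1/160" using B4 by (auto simp: x_def field_simps)
  have "1 \<le> n" using nN N1 by simp
  have q': "q \<in> monic_polys_zeros_in n (cball 0 1)"
    using q(1) unfolding nN monic_polys_zeros_in_def by auto
  \<comment> \<open>Reflection divides the imaginary part by \<open>|z|^2 \<le> 4\<close>, so the
    height 80 is needed to reach the 20 required by \<open>S\<close>. The area is
    \<open>4 * 160 / K\<close>, and the annulus adds \<open>32 / K\<close>.\<close>
  define R where "R = cbox (Complex (-2) (-80 / K)) (Complex 2 (80 / K))"
  define A where "A = cball 0 (1 + 2 * d) - ball (0::complex) (1 - d)"
  have sub: "filled_lemniscate q 1 \<subseteq> R \<union> A"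
  proof
    fix z assume zq: "z \<in> filled_lemniscate q 1"
    then have z: "cmod (poly q z) \<le> 1" by (simp add: filled_lemniscate_def)
    have z2: "cmod z \<le> 2"
      using filled_lemniscate_subset[OF q' \<open>1 \<le> n\<close>] zq by auto
    show "z \<in> R \<union> A"
    proof (rule ccontr)
      assume not: "z \<notin> R \<union> A"
      have im: "80 / K < \<bar>Im z\<bar>"
      proof (rule ccontr)
        assume "\<not> 80 / K < \<bar>Im z\<bar>"
        then have "\<bar>Im z\<bar> \<le> 80 / K" by simp
        moreover have "\<bar>Re z\<bar> \<le> 2" using z2 abs_Re_le_cmod[of z] by linarith
        ultimately have "z \<in> R"
          unfolding R_def by (simp add: in_cbox_complex_iff abs_le_iff)
        with not show False by simp
      qed
      have z0: "z \<noteq> 0" using im K(1) by auto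
      consider "cmod z < 1 - d" | "1 + 2 * d < cmod z" using not by (auto simp: A_def)
      then show False
      proof cases
        case 1
        then have z1: "cmod z \<le> 1" using d by linarith
        have "20 / K \<le> \<bar>Im z\<bar>" using im by (simp add: field_simps)
        then have "1 + 2 * x \<le> cmod (poly S z)" using S(4)[OF z1] by (simp add: x_def)
        also have "\<dots> = cmod (poly (refl_poly p) z)" using p(2)[OF z0] by simp
        finally have r: "1 + 2 * x \<le> cmod (poly (refl_poly p) z)" .
        have "cmod z ^ N \<le> (exp (- d)) ^ N"
          using 1 exp_ge_add_one_self[of "-d"] by (intro power_mono) auto
        also have "\<dots> = exp (- (N / K))" by (simp add: d_def flip: exp_of_nat_mult)
        also have "\<dots> \<le> exp (- ln (40 * B))"
        proof -
          have "K * ln (40 * B) \<le> real N" using NK by linarith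
          then have "ln (40 * B) \<le> N / K" using K(1) by (simp add: field_simps)
          then show ?thesis by simp
        qed
        also have "\<dots> = x" using B4 by (simp add: x_def exp_minus inverse_eq_divide)
        finally have "(1 + 2 * x) * (1 - x) \<le> cmod (poly (refl_poly p) z) * (1 - cmod z ^ N)"
          using r x by (intro mult_mono) auto
        also have "\<dots> \<le> 1" using q(2)[OF z1] z by linarith
        finally have "x \<le> 2 * x * x" by (simp add: algebra_simps)
        then show False using x by simp
      next
        case 2
        then have z1: "1 \<le> cmod z" using d by linarith
        let ?w = "inverse (cnj z)"
        have w1: "cmod ?w \<le> 1" using z1 by (simp add: norm_inverse inverse_le_1_iff)
        have "Im ?w = Im z / (cmod z)\<^sup>2" by (simp add: cmod_power2)
        then have "\<bar>Im ?w\<bar> = \<bar>Im z\<bar> / (cmod z)\<^sup>2" by (simp add: abs_divide)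
        also have "\<dots> \<ge> (80 / K) / 4"
        proof (rule frac_le)
          show "(cmod z)\<^sup>2 \<le> 4" using power_mono[OF z2, of 2] by simp
        qed (use im z0 in auto)
        finally have "20 / K \<le> \<bar>Im ?w\<bar>" by simp
        then have "1 + 2 * x \<le> cmod (poly S ?w)" using S(4)[OF w1] by (simp add: x_def)
        then have "1 < cmod (poly S ?w)" using x by linarith
        moreover have "1 \<le> cmod z ^ degree S" using z1 by (rule one_le_power)
        then have "1 * cmod (poly S ?w) \<le> cmod z ^ degree S * cmod (poly S ?w)"
          by (rule mult_right_mono) simp
        ultimately have "1 < cmod (poly p z)"
          unfolding p(3)[OF z0] by linarith
        moreover have "1 \<le> cmod z ^ N - 1"
        proof -
          have "1 + real N * (2 * d) \<le> (1 + 2 * d) ^ N"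
            using Bernoulli_inequality[of "2 * d" N] d by simp
          also have "\<dots> \<le> cmod z ^ N" using 2 d by (intro power_mono) auto
          finally have "1 + real N * (2 * d) \<le> cmod z ^ N" .
          moreover have "1 \<le> real N * d" using KN K(1) by (simp add: d_def)
          ultimately show ?thesis by linarith
        qed
        ultimately have "1 * 1 < cmod (poly p z) * (cmod z ^ N - 1)"
          by (intro mult_less_le_imp_less) auto
        with q(3)[OF z1] z show False by simp
      qed
    qed
  qed
  note Al = annulus_measure[OF d, folded A_def]
  have Rl: "R \<in> lmeasurable" unfolding R_def by (rule lmeasurable_cbox)
  have Rm: "measure lebesgue R = 640 / K"
  proof -
    have "measure lborel R = (\<Prod>b\<in>Basis. (Complex 2 (80 / K) - Complex (-2) (-80 / K)) \<bullet> b)"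
      unfolding R_def by (rule measure_lborel_cbox) (auto simp: Basis_complex_def)
    also have "\<dots> = 640 / K" by (simp add: Basis_complex_def)
    finally show ?thesis unfolding R_def by simp
  qed
  have "min_area n (sphere 0 1) 1 \<le> measure lebesgue (filled_lemniscate q 1)"
    unfolding nN by (rule min_area_le[OF q(1)])
  also have "\<dots> \<le> measure lebesgue (R \<union> A)"
    using sub filled_lemniscate_closed[of q 1] Rl Al(1)
    by (intro measure_mono_fmeasurable) (auto intro!: fmeasurable.Un)
  also have "\<dots> \<le> measure lebesgue R + measure lebesgue A"
    using Rl Al(1) by (intro measure_Un_le) (auto intro!: fmeasurableD)
  also have "\<dots> \<le> 640 / K + 32 * d" using Rm Al(2) by simp
  also have "\<dots> = 672 / K" by (simp add: d_def)
  finally show ?thesis .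
qed

lemma min_area_sphere_upper:
  "\<forall>\<^sub>F n :: nat in sequentially. min_area n (sphere 0 1) 1 \<le> 1344 / ln (ln (real n))"
proof -
  have *: "\<forall>\<^sub>F K :: nat in sequentially. 3 \<le> K \<and> 12 * real K \<le> 2 ^ K \<and> 2 * real K * (2 * (6 * real K + 1) / 4 ^ K) \<le> 1/2 \<and>
     real K ^ (2 * K) * K + K * ln (40 * (4 * real K ^ ((K + 1) ^ (2 * K)))) + K \<le> exp (exp (real K))"
  proof -
    have "\<forall>\<^sub>F K :: nat in sequentially. 12 * real K \<le> 2 ^ K" by real_asymp
    moreover have "\<forall>\<^sub>F K :: nat in sequentially. 2 * real K * (2 * (6 * real K + 1) / 4 ^ K) \<le> 1/2" by real_asymp
    \<comment> \<open>The left side is \<open>exp (O(K * ln K))\<close>, since only the logarithm of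
      \<open>B\<close> enters; \<open>K = nat \<lfloor>ln (ln n)\<rfloor>\<close> therefore meets
      the degree condition with ample room.\<close>
    moreover have "\<forall>\<^sub>F K :: nat in sequentially. real K powr (2 * real K) * real K + real K * (ln 160 + (real K + 1) powr (2 * real K) * ln (real K)) + real K \<le> exp (exp (real K))"
      by real_asymp
    moreover have "\<forall>\<^sub>F K :: nat in sequentially. 3 \<le> K" by (rule eventually_ge_at_top)
    ultimately show ?thesis
    proof eventually_elim
      fix K :: nat
      assume 1: "12 * real K \<le> 2 ^ K" "2 * real K * (2 * (6 * real K + 1) / 4 ^ K) \<le> 1/2" "3 \<le> K"
        and 2: "real K powr (2 * real K) * real K + real K * (ln 160 + (real K + 1) powr (2 * real K) * ln (real K)) + real K \<le> exp (exp (real K))"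
      have K0: "0 < real K" using 1 by simp
      have a: "real K powr (2 * real K) = real K ^ (2 * K)"
        using K0 powr_realpow[of "real K" "2 * K"] by simp
      have b: "(real K + 1) powr (2 * real K) = (real K + 1) ^ (2 * K)"
        using K0 powr_realpow[of "real K + 1" "2 * K"] by simp
      have "ln (40 * (4 * real K ^ ((K + 1) ^ (2 * K)))) = ln (160 * real K ^ ((K + 1) ^ (2 * K)))"
        by simp
      also have "\<dots> = ln 160 + ln (real K ^ ((K + 1) ^ (2 * K)))"
        using K0 by (intro ln_mult_pos) auto
      also have "\<dots> = ln 160 + (real K + 1) ^ (2 * K) * ln (real K)"
        unfolding ln_realpow by (simp add: add.commute)
      finally show "3 \<le> K \<and> 12 * real K \<le> 2 ^ K \<and> 2 * real K * (2 * (6 * real K + 1) / 4 ^ K) \<le> 1/2 \<and>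
         real K ^ (2 * K) * K + K * ln (40 * (4 * real K ^ ((K + 1) ^ (2 * K)))) + K \<le> exp (exp (real K))"
        using 1 2 unfolding a b by simp
    qed
  qed
  have "filterlim (\<lambda>n. nat \<lfloor>ln (ln (real n))\<rfloor>) at_top sequentially" by real_asymp
  from eventually_compose_filterlim[OF * this]
  have "\<forall>\<^sub>F n :: nat in sequentially. min_area n (sphere 0 1) 1 \<le> 672 / real (nat \<lfloor>ln (ln (real n))\<rfloor>) \<and> 2 \<le> ln (ln (real n))"
  proof (rule eventually_elim2)
    show "\<forall>\<^sub>F n :: nat in sequentially. 2 \<le> ln (ln (real n)) \<and> 1 < ln (real n) \<and> 1 < real n"
      by (intro eventually_conj; real_asymp)
    fix n :: nat
    let ?K = "nat \<lfloor>ln (ln (real n))\<rfloor>"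
    assume K: "3 \<le> ?K \<and> 12 * real ?K \<le> 2 ^ ?K \<and> 2 * real ?K * (2 * (6 * real ?K + 1) / 4 ^ ?K) \<le> 1/2 \<and>
     real ?K ^ (2 * ?K) * ?K + ?K * ln (40 * (4 * real ?K ^ ((?K + 1) ^ (2 * ?K)))) + ?K \<le> exp (exp (real ?K))"
      and n: "2 \<le> ln (ln (real n)) \<and> 1 < ln (real n) \<and> 1 < real n"
    have "real ?K \<le> ln (ln (real n))" using n by (simp add: of_nat_nat)
    then have "exp (real ?K) \<le> ln (real n)" using n by (simp add: ln_ge_iff)
    then have "exp (exp (real ?K)) \<le> real n" using n by (simp add: ln_ge_iff)
    with K have "real ?K ^ (2 * ?K) * ?K + ?K * ln (40 * (4 * real ?K ^ ((?K + 1) ^ (2 * ?K)))) + ?K \<le> real n"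
      by linarith
    with K n show "min_area n (sphere 0 1) 1 \<le> 672 / real ?K \<and> 2 \<le> ln (ln (real n))"
      using min_area_sphere_small[of ?K n] by blast
  qed
  then show ?thesis
  proof eventually_elim
    fix n :: nat
    let ?l = "ln (ln (real n))"
    assume a: "min_area n (sphere 0 1) 1 \<le> 672 / real (nat \<lfloor>?l\<rfloor>) \<and> 2 \<le> ?l"
    \<comment> \<open>Rounding down loses at most half of a number that is at least 2, hence
      \<open>1344 = 2 * 672\<close>.\<close>
    then have "?l / 2 \<le> real (nat \<lfloor>?l\<rfloor>)" by linarith
    then have "672 / real (nat \<lfloor>?l\<rfloor>) \<le> 672 / (?l / 2)"
      using a by (intro divide_left_mono) auto
    also have "672 / (?l / 2) = 1344 / ?l" by simp
    finally show "min_area n (sphere 0 1) 1 \<le> 1344 / ?l" using a by linarith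
  qed
qed

theorem theorem1:
  shows "\<exists>c C :: real. 0 < c \<and> c < C \<and>
    (\<forall>\<^sub>F n :: nat in sequentially.
       c / ln (real n) \<le> (1 / 3) * min_area (n * nat \<lfloor>(ln (real n)) ^ 4\<rfloor>) (sphere 0 1) 1 \<and>
       (1 / 3) * min_area (n * nat \<lfloor>(ln (real n)) ^ 4\<rfloor>) (sphere 0 1) 1 \<le> min_area n (cball 0 1) 1 \<and>
       min_area n (cball 0 1) 1 \<le> min_area n (sphere 0 1) 1 \<and>
       min_area n (sphere 0 1) 1 \<le> C / ln (ln (real n)))"
proof (intro exI conjI)
  let ?c = "exp (-120) / 108000000 :: real"
  show "0 < ?c / 6" by simp
  have "exp (-120) \<le> (1 :: real)" by simp
  then show "?c / 6 < 1344" by linarith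
  have mono: "min_area n (cball 0 1) 1 \<le> min_area n (sphere 0 1) 1" for n
    by (rule min_area_mono[of 1]) auto
  have "\<forall>\<^sub>F n :: nat in sequentially.
       ?c / 6 / ln (real n) \<le> (1 / 3) * min_area (n * nat \<lfloor>(ln (real n)) ^ 4\<rfloor>) (sphere 0 1) 1 \<and>
       (1 / 3) * min_area (n * nat \<lfloor>(ln (real n)) ^ 4\<rfloor>) (sphere 0 1) 1 \<le> min_area n (cball 0 1) 1"
    by (rule min_area_cball_ge[OF _ min_area_sphere_ge]) simp
  then show "\<forall>\<^sub>F n :: nat in sequentially.
       ?c / 6 / ln (real n) \<le> (1 / 3) * min_area (n * nat \<lfloor>(ln (real n)) ^ 4\<rfloor>) (sphere 0 1) 1 \<and>
       (1 / 3) * min_area (n * nat \<lfloor>(ln (real n)) ^ 4\<rfloor>) (sphere 0 1) 1 \<le> min_area n (cball 0 1) 1 \<and>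
       min_area n (cball 0 1) 1 \<le> min_area n (sphere 0 1) 1 \<and>
       min_area n (sphere 0 1) 1 \<le> 1344 / ln (ln (real n))"
    using min_area_sphere_upper
    by eventually_elim (use mono in blast)
qed

end
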